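(* Let $t_0$ be a seed with principal coefficients (endowed with its canonical compatible Poisson structure), and let $t=\boldsymbol\mu t_0$ be a seed obtained from $t_0$ by a sequence of mutations such that $t$ is similar to $t_0$ up to a permutation $\sigma$ of $I_{\mathrm{uf}}$. (1) There exists a twist automorphism $\mathrm{tw}^A_{t_0}$ on the (quantum) upper cluster algebra $\mathcal U^A(t_0)$ passing through $t$. (2) There exists a twist automorphism $\mathrm{tw}^X_{t_0}$ on $\mathcal U^X(t_0)$ passing through $t$. (3) One can choose $\mathrm{tw}^A_{t_0}$ and $\mathrm{tw}^X_{t_0}$ such that $p^*\mathrm{tw}^X_{t_0}=\mathrm{tw}^A_{t_0}p^*$ (as maps on $\mathcal U^X(t_0)$). These statements hold both in the classical and in the quantum case.
   Context: Seeds. Let $I=I_{\mathrm{uf}}\sqcup I_{\mathrm f}$ be a finite set (unfrozen, frozen vertices), $d_i>0$ integers, $D=\mathrm{diag}(1/d_i)$. A seed $t$ consists of indeterminates $(A_i)_{i\in I}$, $(X_i)_{i\in I}$ and an integer matrix $B(t)=(b_{ij})_{i,j\in I}$ with $DB(t)$ skew-symmetric. $N(t)=\mathbb{Z}^I$ has basis $\mathbf e_i$, $\mathbf f_i=\frac1{d_i}\mathbf e_i^*$ ($\mathbf e_i^*$ dual basis), $M^\circ(t)=\bigoplus_i\mathbb{Z}\mathbf f_i$, $M^\circ_{\mathrm f}(t)=\bigoplus_{j\in I_{\mathrm f}}\mathbb{Z}\mathbf f_j$. $p^*:N(t)\to M^\circ(t)$, $p^*\mathbf e_j=\sum_ib_{ij}\mathbf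 f_i$. $\omega$ is the skew form on $N(t)$ with $\omega(\mathbf e_i,\mathbf e_j)=\frac1{d_j}b_{ji}$. A compatible Poisson structure is a $\mathbb{Q}$-valued skew-symmetric form $\lambda$ on $M^\circ(t)$ with $\lambda(\mathbf f_i,p^*\mathbf e_k)=-\delta_{ik}\frac1{d_k}$ for $i\in I$, $k\in I_{\mathrm{uf}}$. Principal coefficients. $t_0$ has principal coefficients if $I_{\mathrm f}=I_{\mathrm{uf}}'=\{k'\mid k\in I_{\mathrm{uf}}\}$ is a copy of $I_{\mathrm{uf}}$, $d_{k'}=d_k$, and $B(t_0)=\begin{pmatrix}B_{\mathrm{uf}}&-\mathrm{Id}\\ \mathrm{Id}&0\end{pmatrix}$. Its canonical compatible Poisson structure is the form $\lambda$ with matrix $(\lambda(\mathbf f_i,\mathbf f_j))_{i,j}=B(t_0)^{-T}D=\begin{pmatrix}0&-\mathrm{Id}\\ \mathrm{Id}&B_{\mathrm{uf}}^T\end{pmatrix}D$. Base ring. Classical case: $\Bbbk=\mathbb{Z}$, $v=1$. Quantum case: $\Bbbk=\mathbb{Z}[v^{\pm1/d'}]$, $d'$ sufficiently divisible. $\mathcal{LP}^A(t)=\Bbbk[A_i^{\pm1}]$, $\mathcal{LP}^X(t)=\Bbbk[X_i^{\pm1}]$ have products $A^m*A^{m'}=v^{\lambda(m,m')}A^{m+m'}$, $X^n*X^{n'}=v^{-\omega(n,n')}X^{n+n'}$; $\cdot$ is the commutative product; $\mathcal F^\bullet(t)$ is the (skew-)field of fractions. Mutation. For $k\in I_{\mathrm{uf}}$,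 $\mu_kt$ has matrix $b'_{ij}=-b_{ij}$ if $k\in\{i,j\}$, $b'_{ij}=b_{ij}+b_{ik}[b_{kj}]_++[-b_{ik}]_+b_{kj}$ otherwise ($[x]_+=\max(x,0)$); $\lambda$ is transported by the isomorphism $M^\circ(\mu_kt)\to M^\circ(t)$, $\mathbf f'_i\mapsto\mathbf f_i$ ($i\ne k$), $\mathbf f'_k\mapsto-\mathbf f_k+\sum_j[-b_{jk}]_+\mathbf f_j$. The isomorphisms $\mu_k^*:\mathcal F^\bullet(\mu_kt)\to\mathcal F^\bullet(t)$ are: $A'_i\mapsto A_i$ ($i\ne k$), $A'_k\mapsto A^{-\mathbf f_k+\sum_j[-b_{jk}]_+\mathbf f_j}+A^{-\mathbf f_k+\sum_j[b_{jk}]_+\mathbf f_j}$; $X'_k\mapsto X_k^{-1}$, and for $i\ne k$, $X_i'\mapsto\sum_{s=0}^{-b_{ki}}\binom{-b_{ki}}{s}_{v_k}X_i\cdot X_k^s$ if $b_{ki}\le0$, $X'_i\mapsto\big(\sum_{s=0}^{b_{ki}}\binom{b_{ki}}{s}_{v_k}X_i^{-1}\cdot X_k^{s-b_{ki}}\big)^{-1}$ if $b_{ki}>0$, where $v_k=v^{1/d_k}$ and $\binom ab_q$ is the symmetric quantum binomial built from $[a]_q=\frac{q^a-q^{-a}}{q-q^{-1}}$ (ordinary binomial if $v=1$). For $\boldsymbol\mu=\mu_{k_l}\cdots\mu_{k_1}$: $\boldsymbol\mu^*=\mu_{k_1}^*\cdots\mu_{k_l}^*$. $\mathcal U^\bullet(t)=\bigcap_{\boldsymbol\nu}\boldsymbol\nu^*\mathcal{LP}^\bullet(\boldsymbol\nu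 t)\subset\mathcal F^\bullet(t)$ over all mutation sequences. The $\Bbbk$-linear map $p^*:\mathcal{LP}^X(t)\to\mathcal{LP}^A(t)$, $X^n\mapsto A^{p^*n}$, restricts to $\mathcal U^X(t)\to\mathcal U^A(t)$. Similar up to $\sigma$: $b_{ij}(t_0)=b_{\sigma i,\sigma j}(t)$, $d_i=d_{\sigma i}$ for $i,j\in I_{\mathrm{uf}}$. Variation maps from $t_0$ to $t$ (integral). Linear $M$-variation map: linear $\mathrm{var}^M:M^\circ(t_0)\to M^\circ(t)$ with $\mathrm{var}^M(\mathbf f_k(t_0))\in\mathbf f_{\sigma k}(t)+M^\circ_{\mathrm f}(t)$, $\mathrm{var}^M(\mathbf f_j(t_0))\in M^\circ_{\mathrm f}(t)$, $\mathrm{var}^M(p^*\mathbf e_k(t_0))=p^*\mathbf e_{\sigma k}(t)$ for $k\in I_{\mathrm{uf}}$, $j\in I_{\mathrm f}$. Linear $N$-variation map: linear $\mathrm{var}^N:N(t_0)\to N(t)$ with $\mathrm{var}^N(\mathbf e_k(t_0))=\mathbf e_{\sigma k}(t)$ and $\omega(\mathrm{var}^N\mathbf e_i(t_0),\mathrm{var}^N\mathbf e_k(t_0))=\omega(\mathbf e_i(t_0),\mathbf e_k(t_0))$ for $i\in I$, $k\in I_{\mathrm{uf}}$. Variation maps $\mathrm{var}^A_{t_0}:\mathcal{LP}^A(t_0)\to\mathcal{LP}^A(t)$, $\mathrm{var}^X_{t_0}:\mathcal{LP}^X(t_0)\to\mathcal{LP}^X(t)$ are the associated monomial maps $A(t_0)^m\mapsto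 A(t)^{\mathrm{var}^Mm}$, $X(t_0)^n\mapsto X(t)^{\mathrm{var}^Nn}$, required to be $\Bbbk$-algebra homomorphisms for $*$. A twist automorphism of $\mathcal U^\bullet(t_0)$ passing through $t=\boldsymbol\mu t_0$ is $\mathrm{tw}^\bullet_{t_0}=\boldsymbol\mu^*\circ\mathrm{var}^\bullet_{t_0}$ with $\mathrm{var}^\bullet_{t_0}$ an invertible variation map. *)

theory Defs
  imports
    "HOL-Analysis.Finite_Cartesian_Product"
    "HOL-Library.Poly_Mapping"
    "HOL-Library.FuncSet"
    "HOL-Algebra.QuotRing"
begin

section \<open>Right Ore fractions\<close>

text \<open>
  The skew field of fractions of an Ore domain \<open>R\<close>: the pair \<open>(a, b)\<close> stands for the right
  fraction \<open>a b\<^sup>-\<^sup>1\<close>. In the commutative case this is the usual field of fractions.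
\<close>

definition ore_pairs :: "('a, 'm) ring_scheme \<Rightarrow> ('a \<times> 'a) set" where
  "ore_pairs R = carrier R \<times> (carrier R - {\<zero>\<^bsub>R\<^esub>})"

definition ore_rel :: "('a, 'm) ring_scheme \<Rightarrow> (('a \<times> 'a) \<times> ('a \<times> 'a)) set" where
  "ore_rel R = {((a, b), (c, d)). (a, b) \<in> ore_pairs R \<and> (c, d) \<in> ore_pairs R \<and>
     (\<exists>u\<in>carrier R. \<exists>w\<in>carrier R.
        b \<otimes>\<^bsub>R\<^esub> u = d \<otimes>\<^bsub>R\<^esub> w \<and> b \<otimes>\<^bsub>R\<^esub> u \<noteq> \<zero>\<^bsub>R\<^esub> \<and> a \<otimes>\<^bsub>R\<^esub> u = c \<otimes>\<^bsub>R\<^esub> w)}"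

definition ore_frac :: "('a, 'm) ring_scheme \<Rightarrow> 'a \<Rightarrow> 'a \<Rightarrow> ('a \<times> 'a) set" where
  "ore_frac R a b = ore_rel R `` {(a, b)}"

text \<open>
  If \<open>b u = c w\<close> with \<open>w \<noteq> 0\<close> then \<open>(a b\<^sup>-\<^sup>1) (c d\<^sup>-\<^sup>1) = (a u) (d w)\<^sup>-\<^sup>1\<close>; if \<open>b u = d w \<noteq> 0\<close> then
  \<open>a b\<^sup>-\<^sup>1 + c d\<^sup>-\<^sup>1 = (a u + c w) (b u)\<^sup>-\<^sup>1\<close>. Over an Ore domain the unions below are therefore unions of
  one and the same class.
\<close>

definition ore_mult ::
    "('a, 'm) ring_scheme \<Rightarrow> ('a \<times> 'a) set \<Rightarrow> ('a \<times> 'a) set \<Rightarrow> ('a \<times> 'a) set" where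
  "ore_mult R x y = \<Union> {ore_frac R (a \<otimes>\<^bsub>R\<^esub> u) (d \<otimes>\<^bsub>R\<^esub> w) | a b c d u w.
     (a, b) \<in> x \<and> (c, d) \<in> y \<and> u \<in> carrier R \<and> w \<in> carrier R \<and>
     w \<noteq> \<zero>\<^bsub>R\<^esub> \<and> b \<otimes>\<^bsub>R\<^esub> u = c \<otimes>\<^bsub>R\<^esub> w}"

definition ore_add ::
    "('a, 'm) ring_scheme \<Rightarrow> ('a \<times> 'a) set \<Rightarrow> ('a \<times> 'a) set \<Rightarrow> ('a \<times> 'a) set" where
  "ore_add R x y = \<Union> {ore_frac R (a \<otimes>\<^bsub>R\<^esub> u \<oplus>\<^bsub>R\<^esub> c \<otimes>\<^bsub>R\<^esub> w) (b \<otimes>\<^bsub>R\<^esub> u) | a b c d u w.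
     (a, b) \<in> x \<and> (c, d) \<in> y \<and> u \<in> carrier R \<and> w \<in> carrier R \<and>
     b \<otimes>\<^bsub>R\<^esub> u \<noteq> \<zero>\<^bsub>R\<^esub> \<and> b \<otimes>\<^bsub>R\<^esub> u = d \<otimes>\<^bsub>R\<^esub> w}"

definition Frac :: "('a, 'm) ring_scheme \<Rightarrow> ('a \<times> 'a) set ring" where
  "Frac R = \<lparr> carrier = ore_pairs R // ore_rel R,
              monoid.mult = ore_mult R,
              one = ore_frac R \<one>\<^bsub>R\<^esub> \<one>\<^bsub>R\<^esub>,
              zero = ore_frac R \<zero>\<^bsub>R\<^esub> \<one>\<^bsub>R\<^esub>,
              add = ore_add R \<rparr>"

definition to_frac :: "('a, 'm) ring_scheme \<Rightarrow> 'a \<Rightarrow> ('a \<times> 'a) set" where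
  "to_frac R a = ore_frac R a \<one>\<^bsub>R\<^esub>"


section \<open>Base rings\<close>

text \<open>
  A base ring is a commutative domain together with the function \<open>v :: rat \<Rightarrow> 'k\<close> of powers
  \<open>q \<mapsto> v\<^sup>q\<close>. For the quantum case, \<open>int \<Rightarrow>\<^sub>0 int\<close> is the ring of Laurent polynomials in \<open>v\<^sup>1\<^sup>/\<^sup>d\<close>;
  \<open>quantum_v d q\<close> is meaningful only if \<open>q * d\<close> is an integer.
\<close>

definition classical_v :: "rat \<Rightarrow> int" where
  "classical_v q = 1"

definition quantum_v :: "int \<Rightarrow> rat \<Rightarrow> (int \<Rightarrow>\<^sub>0 int)" where
  "quantum_v d q = Poly_Mapping.single \<lfloor>q * of_int d\<rfloor> 1"

text \<open>
  Symmetric quantum integers and binomials at the parameter \<open>v\<^sup>e\<close>; the quotients are exact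
  quotients in the base ring.
\<close>

definition qint :: "(rat \<Rightarrow> 'k::idom) \<Rightarrow> rat \<Rightarrow> nat \<Rightarrow> 'k" where
  "qint v e a = (THE x. x * (v e - v (- e)) = v (of_nat a * e) - v (- (of_nat a * e)))"

definition qfact :: "(rat \<Rightarrow> 'k::idom) \<Rightarrow> rat \<Rightarrow> nat \<Rightarrow> 'k" where
  "qfact v e n = (\<Prod>a\<in>{1..n}. qint v e a)"

definition qbinom :: "(rat \<Rightarrow> 'k::idom) \<Rightarrow> rat \<Rightarrow> nat \<Rightarrow> nat \<Rightarrow> 'k" where
  "qbinom v e n s =
     (if v e = 1 then of_nat (n choose s)
      else (THE x. x * (qfact v e s * qfact v e (n - s)) = qfact v e n))"


section \<open>Seeds\<close>

text \<open>
  The index set is the disjoint union \<open>'u + 'f\<close> of unfrozen and frozen vertices. \<open>lam i j\<close> is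
  \<open>\<lambda>(f\<^sub>i, f\<^sub>j)\<close>. The lattices \<open>N(t)\<close> and \<open>M\<degree>(t)\<close> are both \<open>int ^ ('u + 'f)\<close>, in the coordinates given
  by the bases \<open>e\<^sub>i\<close> and \<open>f\<^sub>i\<close>, respectively.
\<close>

record ('u, 'f) seed =
  dd :: "'u + 'f \<Rightarrow> int"
  bmat :: "'u + 'f \<Rightarrow> 'u + 'f \<Rightarrow> int"
  lam :: "'u + 'f \<Rightarrow> 'u + 'f \<Rightarrow> rat"

type_synonym ('u, 'f) lattice = "int ^ ('u + 'f)"
type_synonym ('u, 'f, 'k) laurent = "(int ^ ('u + 'f)) \<Rightarrow>\<^sub>0 'k"
type_synonym ('u, 'f, 'k) fraction =
  "(((int ^ ('u + 'f)) \<Rightarrow>\<^sub>0 'k) \<times> ((int ^ ('u + 'f)) \<Rightarrow>\<^sub>0 'k)) set"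

definition is_seed :: "('u::finite, 'f::finite) seed \<Rightarrow> bool" where
  "is_seed t \<longleftrightarrow> (\<forall>i. dd t i > 0) \<and>
     (\<forall>i j. (1 / of_int (dd t i) * of_int (bmat t i j) :: rat) =
            - (1 / of_int (dd t j) * of_int (bmat t j i)))"

abbreviation basis :: "'i::finite \<Rightarrow> int ^ 'i" where
  "basis i \<equiv> axis i 1"

definition frozen_M :: "('u::finite, 'f::finite) lattice set" where
  "frozen_M = {m. \<forall>k. m $ Inl k = 0}"

definition pstar :: "('u::finite, 'f::finite) seed \<Rightarrow> ('u, 'f) lattice \<Rightarrow> ('u, 'f) lattice" where
  "pstar t n = (\<chi> i. \<Sum>j\<in>UNIV. bmat t i j * n $ j)"

definition omega :: "('u::finite, 'f::finite) seed \<Rightarrow> ('u, 'f) lattice \<Rightarrow> ('u, 'f) lattice \<Rightarrow> rat" where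
  "omega t n n' =
     (\<Sum>i\<in>UNIV. \<Sum>j\<in>UNIV. of_int (n $ i) * of_int (n' $ j) * (1 / of_int (dd t j) * of_int (bmat t j i)))"

definition lam_form :: "('u::finite, 'f::finite) seed \<Rightarrow> ('u, 'f) lattice \<Rightarrow> ('u, 'f) lattice \<Rightarrow> rat" where
  "lam_form t m m' = (\<Sum>i\<in>UNIV. \<Sum>j\<in>UNIV. of_int (m $ i) * of_int (m' $ j) * lam t i j)"

definition compatible_poisson :: "('u::finite, 'f::finite) seed \<Rightarrow> bool" where
  "compatible_poisson t \<longleftrightarrow> (\<forall>i j. lam t i j = - lam t j i) \<and>
     (\<forall>i k. lam_form t (basis i) (pstar t (basis (Inl k))) =
            (if i = Inl k then - (1 / of_int (dd t (Inl k))) else 0))"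

definition principal_coefficients :: "('u::finite, 'u) seed \<Rightarrow> bool" where
  "principal_coefficients t \<longleftrightarrow>
     (\<forall>k. dd t (Inr k) = dd t (Inl k)) \<and>
     (\<forall>i j. bmat t (Inl i) (Inr j) = (if i = j then - 1 else 0)) \<and>
     (\<forall>i j. bmat t (Inr i) (Inl j) = (if i = j then 1 else 0)) \<and>
     (\<forall>i j. bmat t (Inr i) (Inr j) = 0)"

definition canonical_poisson :: "('u::finite, 'u) seed \<Rightarrow> bool" where
  "canonical_poisson t \<longleftrightarrow>
     (\<forall>i j. lam t (Inl i) (Inl j) = 0) \<and>
     (\<forall>i j. lam t (Inl i) (Inr j) = (if i = j then - (1 / of_int (dd t (Inr j))) else 0)) \<and>
     (\<forall>i j. lam t (Inr i) (Inl j) = (if i = j then 1 / of_int (dd t (Inl j)) else 0)) \<and>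
     (\<forall>i j. lam t (Inr i) (Inr j) = of_int (bmat t (Inl j) (Inl i)) * (1 / of_int (dd t (Inr j))))"

lemma sum_over_Plus:
  "(\<Sum>i\<in>(UNIV :: ('u::finite + 'f::finite) set). g i) =
     (\<Sum>k\<in>UNIV. g (Inl k)) + (\<Sum>k\<in>UNIV. g (Inr k))"
  using sum.Plus[of "UNIV :: 'u set" "UNIV :: 'f set" g] by simp

lemma lam_form_basis_pstar:
  "lam_form t (basis i) (pstar t (basis k)) = (\<Sum>j\<in>UNIV. of_int (bmat t j k) * lam t i j)"
proof -
  have "pstar t (basis k) $ j = (\<Sum>i\<in>UNIV. if i = k then bmat t j i else 0)" for j
    unfolding pstar_def vec_lambda_beta by (intro sum.cong) (auto simp: axis_def)
  then have p: "pstar t (basis k) $ j = bmat t j k" for j by simp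
  have "lam_form t (basis i) (pstar t (basis k)) =
      (\<Sum>i'\<in>UNIV. if i' = i then (\<Sum>j\<in>UNIV. of_int (bmat t j k) * lam t i' j) else 0)"
    unfolding lam_form_def p by (intro sum.cong) (auto simp: axis_def)
  then show ?thesis by simp
qed

lemma sum_delta_mult:
  "(\<Sum>j\<in>UNIV. of_int (if j = k then 1 else 0) * g j) = (g (k::'a::finite) :: rat)"
proof -
  have "(\<Sum>j\<in>UNIV. of_int (if j = k then 1 else 0) * g j) = (\<Sum>j\<in>UNIV. if j = k then g j else 0)"
    by (intro sum.cong) auto
  then show ?thesis by simp
qed

lemma canonical_poisson_compatible:
  fixes t :: "('u::finite, 'u) seed"
  assumes "is_seed t" "principal_coefficients t" "canonical_poisson t"
  shows "compatible_poisson t"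
proof -
  have l: "lam t (Inl a) (Inl b) = 0"
      "lam t (Inl a) (Inr b) = (if a = b then - (1 / of_int (dd t (Inl b))) else 0)"
      "lam t (Inr a) (Inl b) = (if a = b then 1 / of_int (dd t (Inl b)) else 0)"
      "lam t (Inr a) (Inr b) = of_int (bmat t (Inl b) (Inl a)) / of_int (dd t (Inl b))" for a b
    using assms(2,3) by (simp_all add: canonical_poisson_def principal_coefficients_def)
  have b: "bmat t (Inr a) (Inl b) = (if a = b then 1 else 0)" for a b
    using assms(2) by (simp add: principal_coefficients_def)
  have sk: "(of_int (bmat t (Inl a) (Inl b)) / of_int (dd t (Inl a)) :: rat) =
      - (of_int (bmat t (Inl b) (Inl a)) / of_int (dd t (Inl b)))" for a b
    using assms(1) unfolding is_seed_def by (metis mult.left_neutral times_divide_eq_left)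
  have "lam t i j = - lam t j i" for i j
  proof (cases i; cases j)
    fix a b assume "i = Inr a" "j = Inr b"
    then show ?thesis using sk[of b a] by (simp only: l)
  qed (simp_all add: l)
  moreover have "lam_form t (basis i) (pstar t (basis (Inl k))) =
      (if i = Inl k then - (1 / of_int (dd t (Inl k))) else 0)" for i k
  proof (cases i)
    case (Inl a)
    have "(\<Sum>j\<in>UNIV. of_int (bmat t (Inr j) (Inl k)) * lam t i (Inr j)) = lam t i (Inr k)"
      unfolding b by (rule sum_delta_mult)
    with Inl show ?thesis unfolding lam_form_basis_pstar sum_over_Plus by (simp add: l)
  next
    case (Inr a)
    have "(\<Sum>j\<in>UNIV. of_int (bmat t (Inr j) (Inl k)) * lam t i (Inr j)) = lam t i (Inr k)"
      unfolding b by (rule sum_delta_mult)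
    moreover have "(\<Sum>j\<in>UNIV. of_int (bmat t (Inl j) (Inl k)) * lam t i (Inl j)) =
        (\<Sum>j\<in>UNIV. if j = a then of_int (bmat t (Inl j) (Inl k)) / of_int (dd t (Inl j)) else 0)"
      unfolding Inr by (intro sum.cong refl) (auto simp: l)
    ultimately show ?thesis
      unfolding lam_form_basis_pstar sum_over_Plus using Inr sk[of a k] by (simp add: l(4))
  qed
  ultimately show ?thesis unfolding compatible_poisson_def by blast
qed


section \<open>Quantum tori\<close>

text \<open>
  Laurent polynomials with the product \<open>z\<^sup>m * z\<^sup>m' = v\<^bsup>\<beta>(m,m')\<^esup> z\<^bsup>m+m'\<^esup>\<close>. The commutative product on
  the same module is the type class product of \<open>\<Rightarrow>\<^sub>0\<close>.
\<close>

definition twisted_mult ::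
    "(rat \<Rightarrow> 'k::idom) \<Rightarrow> (int ^ 'i::finite \<Rightarrow> int ^ 'i \<Rightarrow> rat) \<Rightarrow>
     (int ^ 'i \<Rightarrow>\<^sub>0 'k) \<Rightarrow> (int ^ 'i \<Rightarrow>\<^sub>0 'k) \<Rightarrow> (int ^ 'i \<Rightarrow>\<^sub>0 'k)" where
  "twisted_mult v \<beta> p q =
     (\<Sum>m\<in>Poly_Mapping.keys p. \<Sum>n\<in>Poly_Mapping.keys q.
        Poly_Mapping.single (m + n) (v (\<beta> m n) * Poly_Mapping.lookup p m * Poly_Mapping.lookup q n))"

definition quantum_torus ::
    "(rat \<Rightarrow> 'k::idom) \<Rightarrow> (int ^ 'i::finite \<Rightarrow> int ^ 'i \<Rightarrow> rat) \<Rightarrow> (int ^ 'i \<Rightarrow>\<^sub>0 'k) ring" where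
  "quantum_torus v \<beta> = \<lparr> carrier = UNIV, monoid.mult = twisted_mult v \<beta>,
     one = Poly_Mapping.single 0 1, zero = 0, add = (+) \<rparr>"

definition LPA :: "(rat \<Rightarrow> 'k::idom) \<Rightarrow> ('u::finite, 'f::finite) seed \<Rightarrow> ('u, 'f, 'k) laurent ring" where
  "LPA v t = quantum_torus v (lam_form t)"

definition LPX :: "(rat \<Rightarrow> 'k::idom) \<Rightarrow> ('u::finite, 'f::finite) seed \<Rightarrow> ('u, 'f, 'k) laurent ring" where
  "LPX v t = quantum_torus v (\<lambda>n n'. - omega t n n')"

abbreviation monomial :: "int ^ 'i::finite \<Rightarrow> (int ^ 'i \<Rightarrow>\<^sub>0 'k::idom)" where
  "monomial m \<equiv> Poly_Mapping.single m 1"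

abbreviation const :: "'k::idom \<Rightarrow> (int ^ 'i::finite \<Rightarrow>\<^sub>0 'k)" where
  "const c \<equiv> Poly_Mapping.single 0 c"

definition monomial_map ::
    "(int ^ 'i::finite \<Rightarrow> int ^ 'i) \<Rightarrow> (int ^ 'i \<Rightarrow>\<^sub>0 'k::idom) \<Rightarrow> (int ^ 'i \<Rightarrow>\<^sub>0 'k)" where
  "monomial_map V p =
     (\<Sum>m\<in>Poly_Mapping.keys p. Poly_Mapping.single (V m) (Poly_Mapping.lookup p m))"

definition torus_hom ::
    "(int ^ 'i::finite \<Rightarrow>\<^sub>0 'k::idom) ring \<Rightarrow> (int ^ 'i \<Rightarrow>\<^sub>0 'k) ring \<Rightarrow>
     ((int ^ 'i \<Rightarrow>\<^sub>0 'k) \<Rightarrow> (int ^ 'i \<Rightarrow>\<^sub>0 'k)) \<Rightarrow> bool" where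
  "torus_hom R S \<phi> \<longleftrightarrow> \<phi> \<in> ring_hom R S \<and> (\<forall>c. \<phi> (const c) = const c)"


section \<open>Mutation\<close>

definition pos :: "int \<Rightarrow> int" where
  "pos x = max x 0"

text \<open>
  \<open>mut_M t k\<close> is the isomorphism \<open>M\<degree>(\<mu>\<^sub>k t) \<rightarrow> M\<degree>(t)\<close> that transports \<open>\<lambda>\<close>. The same exponent
  \<open>mut_M_basis t k (Inl k)\<close> occurs in the mutation rule of the variable \<open>A\<^sub>k\<close>.
\<close>

definition mut_M_basis :: "('u::finite, 'f::finite) seed \<Rightarrow> 'u \<Rightarrow> 'u + 'f \<Rightarrow> ('u, 'f) lattice" where
  "mut_M_basis t k i =
     (if i = Inl k then - basis (Inl k) + (\<Sum>j\<in>UNIV. pos (- bmat t j (Inl k)) *s basis j)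
      else basis i)"

definition mut_M :: "('u::finite, 'f::finite) seed \<Rightarrow> 'u \<Rightarrow> ('u, 'f) lattice \<Rightarrow> ('u, 'f) lattice" where
  "mut_M t k m = (\<Sum>i\<in>UNIV. m $ i *s mut_M_basis t k i)"

definition mutate :: "('u::finite, 'f::finite) seed \<Rightarrow> 'u \<Rightarrow> ('u, 'f) seed" where
  "mutate t k = \<lparr> dd = dd t,
     bmat = (\<lambda>i j. if i = Inl k \<or> j = Inl k then - bmat t i j
                   else bmat t i j + bmat t i (Inl k) * pos (bmat t (Inl k) j)
                          + pos (- bmat t i (Inl k)) * bmat t (Inl k) j),
     lam = (\<lambda>i j. lam_form t (mut_M t k (basis i)) (mut_M t k (basis j))) \<rparr>"

text \<open>The list \<open>[k\<^sub>1, \<dots>, k\<^sub>l]\<close> encodes the sequence \<open>\<mu>\<^bsub>k\<^sub>l\<^esub> \<cdots> \<mu>\<^bsub>k\<^sub>1\<^esub>\<close>, \<open>k\<^sub>1\<close> being applied first.\<close>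

primrec mutate_seq :: "('u::finite, 'f::finite) seed \<Rightarrow> 'u list \<Rightarrow> ('u, 'f) seed" where
  "mutate_seq t [] = t"
| "mutate_seq t (k # ks) = mutate_seq (mutate t k) ks"

definition image_A ::
    "(rat \<Rightarrow> 'k::idom) \<Rightarrow> ('u::finite, 'f::finite) seed \<Rightarrow> 'u \<Rightarrow> 'u + 'f \<Rightarrow> ('u, 'f, 'k) fraction" where
  "image_A v t k i = to_frac (LPA v t)
     (if i = Inl k
      then monomial (- basis (Inl k) + (\<Sum>j\<in>UNIV. pos (- bmat t j (Inl k)) *s basis j))
         + monomial (- basis (Inl k) + (\<Sum>j\<in>UNIV. pos (bmat t j (Inl k)) *s basis j))
      else monomial (basis i))"

definition image_X ::
    "(rat \<Rightarrow> 'k::idom) \<Rightarrow> ('u::finite, 'f::finite) seed \<Rightarrow> 'u \<Rightarrow> 'u + 'f \<Rightarrow> ('u, 'f, 'k) fraction" where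
  "image_X v t k i =
     (let b = bmat t (Inl k) i; e = 1 / of_int (dd t (Inl k)) in
      if i = Inl k then to_frac (LPX v t) (monomial (- basis (Inl k)))
      else if b \<le> 0 then
        to_frac (LPX v t)
          (\<Sum>s\<in>{0..nat (- b)}.
             Poly_Mapping.single (basis i + int s *s basis (Inl k)) (qbinom v e (nat (- b)) s))
      else inv\<^bsub>Frac (LPX v t)\<^esub> to_frac (LPX v t)
          (\<Sum>s\<in>{0..nat b}.
             Poly_Mapping.single (- basis i + (int s - b) *s basis (Inl k)) (qbinom v e (nat b) s)))"

text \<open>
  The unique isomorphism of algebras over the base ring \<open>Frac R' \<rightarrow> Frac R\<close> sending the \<open>i\<close>-th
  variable to \<open>g i\<close>, made a unique HOL function by being \<open>undefined\<close> outside \<open>Frac R'\<close>.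
\<close>

definition iso_on_variables ::
    "(int ^ 'i::finite \<Rightarrow>\<^sub>0 'k::idom) ring \<Rightarrow> (int ^ 'i \<Rightarrow>\<^sub>0 'k) ring \<Rightarrow>
     ('i \<Rightarrow> ((int ^ 'i \<Rightarrow>\<^sub>0 'k) \<times> (int ^ 'i \<Rightarrow>\<^sub>0 'k)) set) \<Rightarrow>
     ((int ^ 'i \<Rightarrow>\<^sub>0 'k) \<times> (int ^ 'i \<Rightarrow>\<^sub>0 'k)) set \<Rightarrow> ((int ^ 'i \<Rightarrow>\<^sub>0 'k) \<times> (int ^ 'i \<Rightarrow>\<^sub>0 'k)) set" where
  "iso_on_variables R' R g =
     (THE \<phi>. \<phi> \<in> extensional (carrier (Frac R')) \<and> \<phi> \<in> ring_iso (Frac R') (Frac R) \<and>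
        (\<forall>c. \<phi> (to_frac R' (const c)) = to_frac R (const c)) \<and>
        (\<forall>i. \<phi> (to_frac R' (monomial (basis i))) = g i))"

definition mutation_A ::
    "(rat \<Rightarrow> 'k::idom) \<Rightarrow> ('u::finite, 'f::finite) seed \<Rightarrow> 'u \<Rightarrow>
     ('u, 'f, 'k) fraction \<Rightarrow> ('u, 'f, 'k) fraction" where
  "mutation_A v t k = iso_on_variables (LPA v (mutate t k)) (LPA v t) (image_A v t k)"

definition mutation_X ::
    "(rat \<Rightarrow> 'k::idom) \<Rightarrow> ('u::finite, 'f::finite) seed \<Rightarrow> 'u \<Rightarrow>
     ('u, 'f, 'k) fraction \<Rightarrow> ('u, 'f, 'k) fraction" where
  "mutation_X v t k = iso_on_variables (LPX v (mutate t k)) (LPX v t) (image_X v t k)"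

primrec mutation_seq_A ::
    "(rat \<Rightarrow> 'k::idom) \<Rightarrow> ('u::finite, 'f::finite) seed \<Rightarrow> 'u list \<Rightarrow>
     ('u, 'f, 'k) fraction \<Rightarrow> ('u, 'f, 'k) fraction" where
  "mutation_seq_A v t [] = id"
| "mutation_seq_A v t (k # ks) = mutation_A v t k \<circ> mutation_seq_A v (mutate t k) ks"

primrec mutation_seq_X ::
    "(rat \<Rightarrow> 'k::idom) \<Rightarrow> ('u::finite, 'f::finite) seed \<Rightarrow> 'u list \<Rightarrow>
     ('u, 'f, 'k) fraction \<Rightarrow> ('u, 'f, 'k) fraction" where
  "mutation_seq_X v t [] = id"
| "mutation_seq_X v t (k # ks) = mutation_X v t k \<circ> mutation_seq_X v (mutate t k) ks"

definition upper_A ::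
    "(rat \<Rightarrow> 'k::idom) \<Rightarrow> ('u::finite, 'f::finite) seed \<Rightarrow> ('u, 'f, 'k) fraction set" where
  "upper_A v t = (\<Inter>ks. mutation_seq_A v t ks `
     (to_frac (LPA v (mutate_seq t ks)) ` carrier (LPA v (mutate_seq t ks))))"

definition upper_X ::
    "(rat \<Rightarrow> 'k::idom) \<Rightarrow> ('u::finite, 'f::finite) seed \<Rightarrow> ('u, 'f, 'k) fraction set" where
  "upper_X v t = (\<Inter>ks. mutation_seq_X v t ks `
     (to_frac (LPX v (mutate_seq t ks)) ` carrier (LPX v (mutate_seq t ks))))"

text \<open>
  \<open>p\<^sup>*\<close> as a map on the copy of \<open>LPX v t\<close> inside \<open>Frac (LPX v t)\<close>, with values in the copy of
  \<open>LPA v t\<close> inside \<open>Frac (LPA v t)\<close>.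
\<close>

definition pstar_frac ::
    "(rat \<Rightarrow> 'k::idom) \<Rightarrow> ('u::finite, 'f::finite) seed \<Rightarrow>
     ('u, 'f, 'k) fraction \<Rightarrow> ('u, 'f, 'k) fraction" where
  "pstar_frac v t y =
     to_frac (LPA v t) (monomial_map (pstar t) (inv_into (carrier (LPX v t)) (to_frac (LPX v t)) y))"


section \<open>Variation maps and twist automorphisms\<close>

definition similar :: "('u::finite \<Rightarrow> 'u) \<Rightarrow> ('u, 'f::finite) seed \<Rightarrow> ('u, 'f) seed \<Rightarrow> bool" where
  "similar \<sigma> t0 t \<longleftrightarrow>
     (\<forall>i j. bmat t0 (Inl i) (Inl j) = bmat t (Inl (\<sigma> i)) (Inl (\<sigma> j))) \<and>
     (\<forall>i. dd t0 (Inl i) = dd t (Inl (\<sigma> i)))"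

definition variation_M ::
    "('u::finite \<Rightarrow> 'u) \<Rightarrow> ('u, 'f::finite) seed \<Rightarrow> ('u, 'f) seed \<Rightarrow>
     (('u, 'f) lattice \<Rightarrow> ('u, 'f) lattice) \<Rightarrow> bool" where
  "variation_M \<sigma> t0 t V \<longleftrightarrow> additive V \<and>
     (\<forall>k. \<exists>m\<in>frozen_M. V (basis (Inl k)) = basis (Inl (\<sigma> k)) + m) \<and>
     (\<forall>j. V (basis (Inr j)) \<in> frozen_M) \<and>
     (\<forall>k. V (pstar t0 (basis (Inl k))) = pstar t (basis (Inl (\<sigma> k))))"

definition variation_N ::
    "('u::finite \<Rightarrow> 'u) \<Rightarrow> ('u, 'f::finite) seed \<Rightarrow> ('u, 'f) seed \<Rightarrow>
     (('u, 'f) lattice \<Rightarrow> ('u, 'f) lattice) \<Rightarrow> bool" where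
  "variation_N \<sigma> t0 t V \<longleftrightarrow> additive V \<and>
     (\<forall>k. V (basis (Inl k)) = basis (Inl (\<sigma> k))) \<and>
     (\<forall>i k. omega t (V (basis i)) (V (basis (Inl k))) = omega t0 (basis i) (basis (Inl k)))"

definition is_variation_A ::
    "(rat \<Rightarrow> 'k::idom) \<Rightarrow> ('u::finite \<Rightarrow> 'u) \<Rightarrow> ('u, 'f::finite) seed \<Rightarrow> ('u, 'f) seed \<Rightarrow>
     (('u, 'f, 'k) laurent \<Rightarrow> ('u, 'f, 'k) laurent) \<Rightarrow> bool" where
  "is_variation_A v \<sigma> t0 t var \<longleftrightarrow>
     (\<exists>V. variation_M \<sigma> t0 t V \<and> var = monomial_map V) \<and> torus_hom (LPA v t0) (LPA v t) var"

definition is_variation_X ::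
    "(rat \<Rightarrow> 'k::idom) \<Rightarrow> ('u::finite \<Rightarrow> 'u) \<Rightarrow> ('u, 'f::finite) seed \<Rightarrow> ('u, 'f) seed \<Rightarrow>
     (('u, 'f, 'k) laurent \<Rightarrow> ('u, 'f, 'k) laurent) \<Rightarrow> bool" where
  "is_variation_X v \<sigma> t0 t var \<longleftrightarrow>
     (\<exists>V. variation_N \<sigma> t0 t V \<and> var = monomial_map V) \<and> torus_hom (LPX v t0) (LPX v t) var"

text \<open>\<open>U\<close> is a subring of \<open>Frac R\<close> and \<open>\<phi>\<close> restricts to an automorphism of \<open>U\<close> over the base ring.\<close>

definition algebra_automorphism ::
    "(int ^ 'i::finite \<Rightarrow>\<^sub>0 'k::idom) ring \<Rightarrow> ((int ^ 'i \<Rightarrow>\<^sub>0 'k) \<times> (int ^ 'i \<Rightarrow>\<^sub>0 'k)) set set \<Rightarrow>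
     (((int ^ 'i \<Rightarrow>\<^sub>0 'k) \<times> (int ^ 'i \<Rightarrow>\<^sub>0 'k)) set \<Rightarrow> ((int ^ 'i \<Rightarrow>\<^sub>0 'k) \<times> (int ^ 'i \<Rightarrow>\<^sub>0 'k)) set) \<Rightarrow> bool" where
  "algebra_automorphism R U \<phi> \<longleftrightarrow>
     \<phi> \<in> ring_iso (Frac R\<lparr>carrier := U\<rparr>) (Frac R\<lparr>carrier := U\<rparr>) \<and>
     (\<forall>c. \<phi> (to_frac R (const c)) = to_frac R (const c))"

text \<open>
  The sequence \<open>ks\<close> leads from \<open>t0\<close> to \<open>t\<close>. The equation \<open>tw = \<mu>\<^sup>* \<circ> var\<close> is imposed on all of
  \<open>LPA v t0\<close>, respectively \<open>LPX v t0\<close>, which contains the upper cluster algebra.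
\<close>

definition twist_A ::
    "(rat \<Rightarrow> 'k::idom) \<Rightarrow> ('u::finite \<Rightarrow> 'u) \<Rightarrow> ('u, 'f::finite) seed \<Rightarrow> 'u list \<Rightarrow>
     (('u, 'f, 'k) fraction \<Rightarrow> ('u, 'f, 'k) fraction) \<Rightarrow> bool" where
  "twist_A v \<sigma> t0 ks tw \<longleftrightarrow>
     algebra_automorphism (LPA v t0) (upper_A v t0) tw \<and>
     (\<exists>var. is_variation_A v \<sigma> t0 (mutate_seq t0 ks) var \<and> bij var \<and>
        (\<forall>x. tw (to_frac (LPA v t0) x) =
             mutation_seq_A v t0 ks (to_frac (LPA v (mutate_seq t0 ks)) (var x))))"

definition twist_X ::
    "(rat \<Rightarrow> 'k::idom) \<Rightarrow> ('u::finite \<Rightarrow> 'u) \<Rightarrow> ('u, 'f::finite) seed \<Rightarrow> 'u list \<Rightarrow>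
     (('u, 'f, 'k) fraction \<Rightarrow> ('u, 'f, 'k) fraction) \<Rightarrow> bool" where
  "twist_X v \<sigma> t0 ks tw \<longleftrightarrow>
     algebra_automorphism (LPX v t0) (upper_X v t0) tw \<and>
     (\<exists>var. is_variation_X v \<sigma> t0 (mutate_seq t0 ks) var \<and> bij var \<and>
        (\<forall>x. tw (to_frac (LPX v t0) x) =
             mutation_seq_X v t0 ks (to_frac (LPX v (mutate_seq t0 ks)) (var x))))"

end

(*
  For each seed, the classical and quantum tori on both the A and the X side are twisted Laurent
  rings z^m * z^n = v^beta(m,n) z^(m+n). The mutation at k is a lattice isometry tau followed by the
  automorphism of the skew field attached to one vector w (w = p^* e_k on the A side, w = e_k on the
  X side): if beta(m, w) = l(m)/d_k, then for l(m) >= 0 it sends z^m to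
  sum_s binom(l(m), s) z^(m + s w), and the elements with l >= 0 suffice as numerators and
  denominators of all fractions. Hence a lattice isometry that carries the vectors w of one seed to
  those of a similar seed commutes with all mutations and maps one upper cluster algebra onto the
  other, and the theorem becomes linear algebra.

  Let tau : M(t) -> M(t_0) be the composite of the isometries along the mutation sequence. The
  variation map is tau^-1 o Theta, where Theta sends f_k to the unfrozen part of tau f_(sigma k) and
  p^* e_k to tau p^* e_(sigma k). It is an isometry because the unfrozen f_k span an isotropic
  sublattice for the canonical Poisson structure, and it is invertible because tau is, both modulo
  the frozen part and on the span of the p^* e_k. For principal coefficients p^* is itself an
  isometric isomorphism of lattices at every seed; conjugating by it gives the X side and the
  compatibility (3).
*)
theory Submission
  imports Defs "HOL-Computational_Algebra.Polynomial"
begin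

section \<open>Skew fields of right fractions\<close>

text \<open>The obstacle is that a mutation does not preserve Laurent polynomials and that quantum
  fractions do not commute. The image of z^m is an explicit Laurent polynomial only for l(m) >= 0,
  so the homomorphism is given on the subring of elements with l >= 0 and extended from there; one
  monomial factor on the right moves numerator and denominator into it. The Ore condition itself
  comes from the polynomial growth of the lattice: the unknown coefficients of u and w in b u = a w
  outnumber the equations. Since \<open>iso_on_variables\<close> is a definite description, each
  mutation also needs uniqueness; homomorphisms are compared on each variable or its inverse,
  whichever has l >= 0. As \<open>quantum_v\<close> rounds exponents outside (1/d)Z, integrality of
  both forms is carried through all mutations. For the variation map, compatibility already fixes
  every value of \<lambda> with an argument p^* e_k; only the pairs of unfrozen f_k are at stake,
  and the projection to the unfrozen part settles them.\<close>

locale ore_domain = ring R for R (structure) +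
  assumes one_not_zero: "\<one> \<noteq> \<zero>"
    and integral: "\<lbrakk>a \<in> carrier R; b \<in> carrier R; a \<otimes> b = \<zero>\<rbrakk> \<Longrightarrow> a = \<zero> \<or> b = \<zero>"
    and right_ore: "\<lbrakk>a \<in> carrier R; b \<in> carrier R; b \<noteq> \<zero>\<rbrakk> \<Longrightarrow>
      \<exists>u\<in>carrier R. \<exists>w\<in>carrier R. w \<noteq> \<zero> \<and> b \<otimes> u = a \<otimes> w"
begin

lemma mult_nonzero:
  "\<lbrakk>a \<in> carrier R; b \<in> carrier R; a \<noteq> \<zero>; b \<noteq> \<zero>\<rbrakk> \<Longrightarrow> a \<otimes> b \<noteq> \<zero>"
  using integral by blast

lemma cancel_right:
  assumes "a \<in> carrier R" "b \<in> carrier R" "c \<in> carrier R" "c \<noteq> \<zero>" "a \<otimes> c = b \<otimes> c"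
  shows "a = b"
proof -
  have "(a \<ominus> b) \<otimes> c = \<zero>"
    using assms by (simp add: minus_eq l_distr l_minus r_neg)
  then have "a \<ominus> b = \<zero>" using integral assms minus_closed by blast
  then show ?thesis using assms by (metis a_inv_closed minus_eq minus_equality minus_minus)
qed

lemma cancel_left:
  assumes "a \<in> carrier R" "b \<in> carrier R" "c \<in> carrier R" "c \<noteq> \<zero>" "c \<otimes> a = c \<otimes> b"
  shows "a = b"
proof -
  have "c \<otimes> (a \<ominus> b) = \<zero>"
    using assms by (simp add: minus_eq r_distr r_minus r_neg)
  then have "a \<ominus> b = \<zero>" using integral assms minus_closed by blast
  then show ?thesis using assms by (metis a_inv_closed minus_eq minus_equality minus_minus)
qed

lemma right_ore_nonzero:
  assumes "a \<in> carrier R" "b \<in> carrier R" "a \<noteq> \<zero>" "b \<noteq> \<zero>"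
  obtains u w where "u \<in> carrier R" "w \<in> carrier R" "u \<noteq> \<zero>" "w \<noteq> \<zero>" "b \<otimes> u = a \<otimes> w"
proof -
  obtain u w where uw: "u \<in> carrier R" "w \<in> carrier R" "w \<noteq> \<zero>" "b \<otimes> u = a \<otimes> w"
    using right_ore assms by metis
  then have "u \<noteq> \<zero>" using mult_nonzero[of a w] assms by auto
  with uw that show ?thesis by blast
qed

section \<open>Ore equivalence of pairs and its classes\<close>

lemma ore_relD:
  assumes "((a, b), (c, d)) \<in> ore_rel R"
  shows "a \<in> carrier R" "b \<in> carrier R" "c \<in> carrier R" "d \<in> carrier R" "b \<noteq> \<zero>" "d \<noteq> \<zero>"
  using assms by (auto simp: ore_rel_def ore_pairs_def)

text \<open>Related pairs are two representatives of one partial right-linear map \<open>b p \<mapsto> a p\<close>.\<close>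

lemma ore_rel_eval:
  assumes rel: "((a, b), (c, d)) \<in> ore_rel R"
    and p: "p \<in> carrier R" and q: "q \<in> carrier R" and eq: "b \<otimes> p = d \<otimes> q"
  shows "a \<otimes> p = c \<otimes> q"
proof -
  note C = ore_relD[OF rel]
  obtain u w where uw: "u \<in> carrier R" "w \<in> carrier R" "b \<otimes> u = d \<otimes> w" "b \<otimes> u \<noteq> \<zero>" "a \<otimes> u = c \<otimes> w"
    using rel by (auto simp: ore_rel_def)
  have u0: "u \<noteq> \<zero>" using uw C by auto
  obtain s r where rs: "r \<in> carrier R" "s \<in> carrier R" "s \<noteq> \<zero>" "u \<otimes> r = p \<otimes> s"
    using right_ore[OF p uw(1) u0] by metis
  have "d \<otimes> (w \<otimes> r) = (d \<otimes> w) \<otimes> r" using C uw rs by (simp add: m_assoc)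
  also have "\<dots> = b \<otimes> (u \<otimes> r)" using C(2) uw(1) rs(1) by (simp add: m_assoc flip: uw(3))
  also have "\<dots> = d \<otimes> (q \<otimes> s)"
    unfolding rs(4) using C(2,4) rs(2) p q by (simp add: eq flip: m_assoc)
  finally have wr: "w \<otimes> r = q \<otimes> s" using cancel_left[of "w \<otimes> r" "q \<otimes> s" d] C uw rs q by simp
  have "(a \<otimes> p) \<otimes> s = (a \<otimes> u) \<otimes> r" using C uw(1,2) rs p by (simp add: m_assoc)
  also have "\<dots> = c \<otimes> (w \<otimes> r)" using C uw(1,2,5) rs by (simp add: m_assoc)
  also have "\<dots> = (c \<otimes> q) \<otimes> s" using C rs q by (simp add: wr m_assoc)
  finally show ?thesis using cancel_right[of "a \<otimes> p" "c \<otimes> q" s] C p q rs by simp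
qed

lemma ore_relI:
  assumes "(a, b) \<in> ore_pairs R" "(c, d) \<in> ore_pairs R" "u \<in> carrier R" "w \<in> carrier R"
    "u \<noteq> \<zero>" "b \<otimes> u = d \<otimes> w" "a \<otimes> u = c \<otimes> w"
  shows "((a, b), (c, d)) \<in> ore_rel R"
proof -
  have "b \<otimes> u \<noteq> \<zero>" by (rule mult_nonzero) (use assms in \<open>auto simp: ore_pairs_def\<close>)
  moreover have "\<exists>u\<in>carrier R. \<exists>w\<in>carrier R. b \<otimes> u = d \<otimes> w \<and> b \<otimes> u \<noteq> \<zero> \<and> a \<otimes> u = c \<otimes> w"
    by (rule bexI[where x = u], rule bexI[where x = w]) (use assms calculation in simp_all)
  ultimately show ?thesis using assms(1,2) unfolding ore_rel_def by simp
qed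

lemma equiv_ore_rel: "equiv (ore_pairs R) (ore_rel R)"
proof (rule equivI)
  show "ore_rel R \<subseteq> ore_pairs R \<times> ore_pairs R" by (auto simp: ore_rel_def)
  show "refl_on (ore_pairs R) (ore_rel R)"
  proof (rule refl_onI)
    fix x assume "x \<in> ore_pairs R"
    then show "(x, x) \<in> ore_rel R"
      using ore_relI[of "fst x" "snd x" "fst x" "snd x" \<one> \<one>] one_not_zero by (simp add: ore_pairs_def)
  qed
  show "sym (ore_rel R)"
    unfolding ore_rel_def by (rule symI) (clarsimp; metis)
  show "trans (ore_rel R)"
  proof (rule transI)
    fix x y z assume xy: "(x, y) \<in> ore_rel R" and yz: "(y, z) \<in> ore_rel R"
    obtain a b c d e f where [simp]: "x = (a, b)" "y = (c, d)" "z = (e, f)"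
      by (cases x, cases y, cases z) auto
    note C = ore_relD[OF xy[simplified]] ore_relD[OF yz[simplified]]
    \<comment> \<open>p and q equalize the outer denominators b and f. The further factor s makes
      this common multiple also a multiple of the middle denominator d, so that both relations can
      be evaluated at it.\<close>
    obtain p q where pq: "p \<in> carrier R" "q \<in> carrier R" "p \<noteq> \<zero>" "q \<noteq> \<zero>" "b \<otimes> p = f \<otimes> q"
      using right_ore_nonzero[of f b] C by metis
    obtain r s where rs: "r \<in> carrier R" "s \<in> carrier R" "s \<noteq> \<zero>" "d \<otimes> r = (b \<otimes> p) \<otimes> s"
      using right_ore[of "b \<otimes> p" d] C pq by auto
    have bps: "b \<otimes> (p \<otimes> s) = d \<otimes> r" and dr: "d \<otimes> r = f \<otimes> (q \<otimes> s)"
      using C(2) pq(1,2) rs(2) C(10) by (simp_all only: rs(4) pq(5) m_assoc[symmetric])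
    have 1: "a \<otimes> (p \<otimes> s) = c \<otimes> r"
      by (rule ore_rel_eval[OF xy[simplified] _ _ bps]) (use pq rs in simp_all)
    have 2: "c \<otimes> r = e \<otimes> (q \<otimes> s)"
      by (rule ore_rel_eval[OF yz[simplified] _ _ dr]) (use pq rs in simp_all)
    show "(x, z) \<in> ore_rel R"
      using ore_relI[of a b e f "p \<otimes> s" "q \<otimes> s"] C pq rs 1 2 bps dr mult_nonzero
      by (simp add: ore_pairs_def)
  qed
qed

lemma ore_frac_self: "(a, b) \<in> ore_pairs R \<Longrightarrow> (a, b) \<in> ore_frac R a b"
  unfolding ore_frac_def using equiv_ore_rel by (rule equiv_class_self)

lemma ore_frac_in_Frac: "(a, b) \<in> ore_pairs R \<Longrightarrow> ore_frac R a b \<in> carrier (Frac R)"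
  unfolding ore_frac_def Frac_def by (simp add: quotientI)

lemma Frac_repr:
  assumes "x \<in> carrier (Frac R)"
  obtains a b where "(a, b) \<in> x"
  using assms equiv_ore_rel unfolding Frac_def
  by (metis partial_object.select_convs(1) quotientE equiv_class_self surj_pair)

lemma Frac_eq_ore_frac:
  assumes "x \<in> carrier (Frac R)" "(a, b) \<in> x"
  shows "x = ore_frac R a b"
  using assms equiv_ore_rel unfolding Frac_def ore_frac_def
  by (metis Image_singleton_iff equiv_class_eq partial_object.select_convs(1) quotientE)

lemma Frac_eqI:
  assumes "x \<in> carrier (Frac R)" "y \<in> carrier (Frac R)" "p \<in> x" "p \<in> y"
  shows "x = y"
  using Frac_eq_ore_frac assms by (metis surj_pair)

lemma Frac_pairs:
  assumes "x \<in> carrier (Frac R)" "(a, b) \<in> x"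
  shows "(a, b) \<in> ore_pairs R" "a \<in> carrier R" "b \<in> carrier R" "b \<noteq> \<zero>"
proof -
  have "((a, b), (a, b)) \<in> ore_rel R"
    using assms equiv_ore_rel unfolding Frac_def
    by (metis Image_singleton_iff equiv_class_eq_iff partial_object.select_convs(1) quotientE)
  from ore_relD[OF this] show "(a, b) \<in> ore_pairs R" "a \<in> carrier R" "b \<in> carrier R" "b \<noteq> \<zero>"
    by (auto simp: ore_pairs_def)
qed

lemma Frac_rel:
  assumes "x \<in> carrier (Frac R)" "(a, b) \<in> x" "(c, d) \<in> x"
  shows "((a, b), (c, d)) \<in> ore_rel R"
  using assms equiv_ore_rel unfolding Frac_def
  by (metis partial_object.select_convs(1) quotient_eq_iff)

lemma Frac_eval:
  assumes "x \<in> carrier (Frac R)" "(a, b) \<in> x" "(c, d) \<in> x"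
    "p \<in> carrier R" "q \<in> carrier R" "b \<otimes> p = d \<otimes> q"
  shows "a \<otimes> p = c \<otimes> q"
  using ore_rel_eval[OF Frac_rel[OF assms(1-3)]] assms(4-) .

lemma Frac_memI:
  assumes "x \<in> carrier (Frac R)" "(a, b) \<in> x" "(c, d) \<in> ore_pairs R"
    "u \<in> carrier R" "w \<in> carrier R" "u \<noteq> \<zero>" "b \<otimes> u = d \<otimes> w" "a \<otimes> u = c \<otimes> w"
  shows "(c, d) \<in> x"
proof -
  have "((a, b), (c, d)) \<in> ore_rel R"
    using ore_relI[OF Frac_pairs(1)[OF assms(1,2)]] assms by blast
  then show ?thesis using Frac_eq_ore_frac[OF assms(1,2)] by (simp add: ore_frac_def)
qed

lemma Frac_scale:
  assumes x: "x \<in> carrier (Frac R)" and ab: "(a, b) \<in> x" and r: "r \<in> carrier R" "r \<noteq> \<zero>"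
  shows "(a \<otimes> r, b \<otimes> r) \<in> x"
proof (rule Frac_memI[OF x ab, where u = r and w = \<one>])
  note C = Frac_pairs[OF x ab]
  show "(a \<otimes> r, b \<otimes> r) \<in> ore_pairs R" using C r mult_nonzero by (simp add: ore_pairs_def)
qed (use r Frac_pairs[OF x ab] in auto)

lemma ore_frac_cong:
  assumes "(a, b) \<in> ore_pairs R" "(c, d) \<in> ore_pairs R" "u \<in> carrier R" "w \<in> carrier R"
    "u \<noteq> \<zero>" "b \<otimes> u = d \<otimes> w" "a \<otimes> u = c \<otimes> w"
  shows "ore_frac R a b = ore_frac R c d"
  using ore_relI[OF assms] equiv_ore_rel unfolding ore_frac_def by (simp add: equiv_class_eq)

lemma Frac_common:
  assumes x: "x \<in> carrier (Frac R)" and y: "y \<in> carrier (Frac R)"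
  obtains a c b where "(a, b) \<in> x" "(c, b) \<in> y"
proof -
  obtain a b c d where m: "(a, b) \<in> x" "(c, d) \<in> y" using Frac_repr assms by metis
  note C = Frac_pairs[OF x m(1)] Frac_pairs[OF y m(2)]
  obtain u w where "u \<in> carrier R" "w \<in> carrier R" "u \<noteq> \<zero>" "w \<noteq> \<zero>" "b \<otimes> u = d \<otimes> w"
    using right_ore_nonzero[of d b] C by metis
  then show ?thesis using that Frac_scale[OF x m(1), of u] Frac_scale[OF y m(2), of w] by metis
qed

section \<open>Arithmetic of fractions\<close>

lemma zero_Frac: "\<zero>\<^bsub>Frac R\<^esub> = ore_frac R \<zero> \<one>" and one_Frac: "\<one>\<^bsub>Frac R\<^esub> = ore_frac R \<one> \<one>"
  by (simp_all add: Frac_def)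

lemma zero_mem_Frac: "x \<in> carrier (Frac R) \<Longrightarrow> (\<zero>, b) \<in> x \<Longrightarrow> x = \<zero>\<^bsub>Frac R\<^esub>"
  unfolding zero_Frac using Frac_pairs[of x \<zero> b] Frac_eq_ore_frac[of x \<zero> b]
    ore_frac_cong[of \<zero> b \<zero> \<one> \<one> b] one_not_zero by (auto simp: ore_pairs_def)

lemma Frac_zero_closed: "\<zero>\<^bsub>Frac R\<^esub> \<in> carrier (Frac R)"
  and Frac_one_closed: "\<one>\<^bsub>Frac R\<^esub> \<in> carrier (Frac R)"
  using ore_frac_in_Frac[of _ \<one>] one_not_zero by (simp_all add: zero_Frac one_Frac ore_pairs_def)

text \<open>A product can be read off as soon as the denominator of x equals the numerator of y.
  That numerator then serves as a denominator, which is why y must be nonzero.\<close>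

lemma Frac_chain:
  assumes x: "x \<in> carrier (Frac R)" and cd: "(c, d) \<in> y" and y: "y \<in> carrier (Frac R)"
    and nz: "y \<noteq> \<zero>\<^bsub>Frac R\<^esub>"
  obtains a w where "w \<in> carrier R" "w \<noteq> \<zero>" "(a, c \<otimes> w) \<in> x" "(c \<otimes> w, d \<otimes> w) \<in> y"
proof -
  obtain a b where ab: "(a, b) \<in> x" using Frac_repr x by metis
  note C = Frac_pairs[OF x ab] Frac_pairs[OF y cd]
  have "c \<noteq> \<zero>" using zero_mem_Frac[OF y] cd nz by blast
  then obtain u w where "u \<in> carrier R" "w \<in> carrier R" "u \<noteq> \<zero>" "w \<noteq> \<zero>" "b \<otimes> u = c \<otimes> w"
    using right_ore_nonzero[of c b] C by metis
  then show ?thesis using that Frac_scale[OF x ab, of u] Frac_scale[OF y cd, of w] by metis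
qed

lemma Union_const: "X \<noteq> {} \<Longrightarrow> (\<And>x. x \<in> X \<Longrightarrow> x = c) \<Longrightarrow> \<Union>X = c"
  by blast

text \<open>\<open>ore_mult\<close> is a union over all representatives and multipliers, so all
  choices must give one class. Two choices are compared after r and s equalize their final
  denominators: evaluating y there equalizes the inner terms, hence the denominators of x, and
  evaluating x then equalizes the numerators.\<close>

lemma Frac_mult_eq:
  assumes x: "x \<in> carrier (Frac R)" and y: "y \<in> carrier (Frac R)"
    and ab: "(a, b) \<in> x" and cd: "(c, d) \<in> y"
    and uw: "u \<in> carrier R" "w \<in> carrier R" "w \<noteq> \<zero>" "b \<otimes> u = c \<otimes> w"
  shows "x \<otimes>\<^bsub>Frac R\<^esub> y = ore_frac R (a \<otimes> u) (d \<otimes> w)"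
proof -
  note C = Frac_pairs[OF x ab] Frac_pairs[OF y cd]
  have "ore_mult R x y = ore_frac R (a \<otimes> u) (d \<otimes> w)"
    unfolding ore_mult_def
  proof (rule Union_const, goal_cases)
    case 1
    show ?case using ab cd uw by blast
  next
    case (2 z)
    then obtain a' b' c' d' u' w' where z: "z = ore_frac R (a' \<otimes> u') (d' \<otimes> w')"
      and m': "(a', b') \<in> x" "(c', d') \<in> y"
      and uw': "u' \<in> carrier R" "w' \<in> carrier R" "w' \<noteq> \<zero>" "b' \<otimes> u' = c' \<otimes> w'"
      by blast
    note C' = Frac_pairs[OF x m'(1)] Frac_pairs[OF y m'(2)]
    obtain r s where rs: "r \<in> carrier R" "s \<in> carrier R" "r \<noteq> \<zero>" "s \<noteq> \<zero>"
      "(d \<otimes> w) \<otimes> r = (d' \<otimes> w') \<otimes> s"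
      using right_ore_nonzero[of "d' \<otimes> w'" "d \<otimes> w"] C C' uw uw' mult_nonzero by (metis m_closed)
    have c: "c \<otimes> (w \<otimes> r) = c' \<otimes> (w' \<otimes> s)"
      using Frac_eval[OF y cd m'(2), of "w \<otimes> r" "w' \<otimes> s"] C C' uw uw' rs by (simp add: m_assoc)
    have "b \<otimes> (u \<otimes> r) = b' \<otimes> (u' \<otimes> s)"
      using C C' uw uw' rs c by (metis m_assoc)
    then have "a \<otimes> (u \<otimes> r) = a' \<otimes> (u' \<otimes> s)"
      using Frac_eval[OF x ab m'(1), of "u \<otimes> r" "u' \<otimes> s"] C C' uw uw' rs by simp
    then show ?case unfolding z
      using C C' uw uw' rs mult_nonzero
      by (intro ore_frac_cong[of _ _ _ _ s r]) (simp_all add: ore_pairs_def m_assoc)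
  qed
  then show ?thesis by (simp add: Frac_def)
qed

lemma Frac_mult_closed:
  assumes x: "x \<in> carrier (Frac R)" and y: "y \<in> carrier (Frac R)"
  shows "x \<otimes>\<^bsub>Frac R\<^esub> y \<in> carrier (Frac R)"
proof -
  obtain a b c d where m: "(a, b) \<in> x" "(c, d) \<in> y" using Frac_repr assms by metis
  note C = Frac_pairs[OF x m(1)] Frac_pairs[OF y m(2)]
  obtain u w where uw: "u \<in> carrier R" "w \<in> carrier R" "w \<noteq> \<zero>" "b \<otimes> u = c \<otimes> w"
    using right_ore C by metis
  then show ?thesis
    using Frac_mult_eq[OF x y m uw] ore_frac_in_Frac C mult_nonzero by (simp add: ore_pairs_def)
qed

lemma Frac_mult_mem:
  assumes "x \<in> carrier (Frac R)" "y \<in> carrier (Frac R)" "(a, b) \<in> x" "(b, d) \<in> y"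
  shows "(a, d) \<in> x \<otimes>\<^bsub>Frac R\<^esub> y"
  using Frac_mult_eq[OF assms, of \<one> \<one>] Frac_pairs[OF assms(1,3)] Frac_pairs[OF assms(2,4)]
    ore_frac_self[of a d] one_not_zero by (simp add: ore_pairs_def)

lemma Frac_mult_zero_right:
  assumes x: "x \<in> carrier (Frac R)"
  shows "x \<otimes>\<^bsub>Frac R\<^esub> \<zero>\<^bsub>Frac R\<^esub> = \<zero>\<^bsub>Frac R\<^esub>"
proof -
  obtain a b where ab: "(a, b) \<in> x" using Frac_repr x by metis
  have "(\<zero>, \<one>) \<in> \<zero>\<^bsub>Frac R\<^esub>"
    using ore_frac_self one_not_zero by (simp add: zero_Frac ore_pairs_def)
  from Frac_mult_eq[OF x Frac_zero_closed ab this, of \<zero> \<one>] Frac_pairs[OF x ab] one_not_zero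
  show ?thesis by (simp add: zero_Frac)
qed

lemma Frac_add_eq:
  assumes x: "x \<in> carrier (Frac R)" and y: "y \<in> carrier (Frac R)"
    and ab: "(a, b) \<in> x" and cb: "(c, b) \<in> y"
  shows "x \<oplus>\<^bsub>Frac R\<^esub> y = ore_frac R (a \<oplus> c) b"
proof -
  note C = Frac_pairs[OF x ab] Frac_pairs[OF y cb]
  have "ore_add R x y = ore_frac R (a \<oplus> c) b"
    unfolding ore_add_def
  proof (rule Union_const, goal_cases)
    case 1
    have "b \<otimes> \<one> \<noteq> \<zero>" "b \<otimes> \<one> = b \<otimes> \<one>" using C by auto
    then show ?case using ab cb one_closed by blast
  next
    case (2 z)
    then obtain a' b' c' d' u' w' where z: "z = ore_frac R (a' \<otimes> u' \<oplus> c' \<otimes> w') (b' \<otimes> u')"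
      and m': "(a', b') \<in> x" "(c', d') \<in> y"
      and uw': "u' \<in> carrier R" "w' \<in> carrier R" "b' \<otimes> u' \<noteq> \<zero>" "b' \<otimes> u' = d' \<otimes> w'"
      by blast
    note C' = Frac_pairs[OF x m'(1)] Frac_pairs[OF y m'(2)]
    obtain r s where rs: "r \<in> carrier R" "s \<in> carrier R" "r \<noteq> \<zero>" "s \<noteq> \<zero>"
      "b \<otimes> r = (b' \<otimes> u') \<otimes> s"
      using right_ore_nonzero[of "b' \<otimes> u'" b] C C' uw' by (metis m_closed)
    have br: "b \<otimes> r = b' \<otimes> (u' \<otimes> s)" "b \<otimes> r = d' \<otimes> (w' \<otimes> s)"
      using C' uw' rs by (simp_all only: m_assoc[symmetric])
    have "a \<otimes> r = a' \<otimes> (u' \<otimes> s)"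
      using Frac_eval[OF x ab m'(1), of r "u' \<otimes> s"] C' uw'(1,2) rs(1,2) br(1) by blast
    moreover have "c \<otimes> r = c' \<otimes> (w' \<otimes> s)"
      using Frac_eval[OF y cb m'(2), of r "w' \<otimes> s"] C' uw'(1,2) rs(1,2) br(2) by blast
    ultimately show ?case unfolding z
      using C C' uw' rs
      by (intro ore_frac_cong[of _ _ _ _ s r]) (simp_all add: ore_pairs_def m_assoc l_distr)
  qed
  then show ?thesis by (simp add: Frac_def)
qed

lemma Frac_add_mem:
  assumes "x \<in> carrier (Frac R)" "y \<in> carrier (Frac R)" "(a, b) \<in> x" "(c, b) \<in> y"
  shows "(a \<oplus> c, b) \<in> x \<oplus>\<^bsub>Frac R\<^esub> y"
  using Frac_add_eq[OF assms] Frac_pairs[OF assms(1,3)] Frac_pairs[OF assms(2,4)]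
    ore_frac_self[of "a \<oplus> c" b] by (simp add: ore_pairs_def)

lemma Frac_add_closed:
  assumes x: "x \<in> carrier (Frac R)" and y: "y \<in> carrier (Frac R)"
  shows "x \<oplus>\<^bsub>Frac R\<^esub> y \<in> carrier (Frac R)"
proof -
  obtain a b c where m: "(a, b) \<in> x" "(c, b) \<in> y" using Frac_common assms by metis
  show ?thesis
    using Frac_add_eq[OF x y m] ore_frac_in_Frac Frac_pairs[OF x m(1)] Frac_pairs[OF y m(2)]
    by (simp add: ore_pairs_def)
qed

lemma to_frac_closed: "a \<in> carrier R \<Longrightarrow> to_frac R a \<in> carrier (Frac R)"
  using ore_frac_in_Frac one_not_zero by (simp add: to_frac_def ore_pairs_def)

lemma to_frac_mem: "a \<in> carrier R \<Longrightarrow> (a, \<one>) \<in> to_frac R a"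
  using ore_frac_self one_not_zero by (simp add: to_frac_def ore_pairs_def)

lemma to_frac_scale_mem: "a \<in> carrier R \<Longrightarrow> b \<in> carrier R \<Longrightarrow> b \<noteq> \<zero> \<Longrightarrow> (a \<otimes> b, b) \<in> to_frac R a"
  using Frac_scale[OF to_frac_closed to_frac_mem, of a b] by simp

lemma to_frac_inj: "inj_on (to_frac R) (carrier R)"
proof (rule inj_onI)
  fix a b assume ab: "a \<in> carrier R" "b \<in> carrier R" "to_frac R a = to_frac R b"
  then have "(b, \<one>) \<in> to_frac R a" using to_frac_mem by simp
  from Frac_eval[OF to_frac_closed to_frac_mem this, of \<one> \<one>] ab show "a = b" by simp
qed

lemma to_frac_one: "to_frac R \<one> = \<one>\<^bsub>Frac R\<^esub>" and to_frac_zero: "to_frac R \<zero> = \<zero>\<^bsub>Frac R\<^esub>"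
  by (simp_all add: to_frac_def one_Frac zero_Frac)

text \<open>The chain goes through b as intermediate denominator, which is possible only for nonzero
  b; hence the case split.\<close>

lemma to_frac_mult:
  assumes "a \<in> carrier R" "b \<in> carrier R"
  shows "to_frac R (a \<otimes> b) = to_frac R a \<otimes>\<^bsub>Frac R\<^esub> to_frac R b"
proof (cases "b = \<zero>")
  case True
  then show ?thesis using assms Frac_mult_zero_right to_frac_closed by (simp add: to_frac_zero)
next
  case False
  then have "(a \<otimes> b, \<one>) \<in> to_frac R a \<otimes>\<^bsub>Frac R\<^esub> to_frac R b"
    by (intro Frac_mult_mem[OF _ _ to_frac_scale_mem to_frac_mem] to_frac_closed assms)
  then show ?thesis
    by (intro Frac_eqI[of _ _ "(a \<otimes> b, \<one>)"] to_frac_mem to_frac_closed Frac_mult_closed m_closed assms)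
qed

lemma to_frac_add:
  assumes "a \<in> carrier R" "b \<in> carrier R"
  shows "to_frac R (a \<oplus> b) = to_frac R a \<oplus>\<^bsub>Frac R\<^esub> to_frac R b"
  by (intro Frac_eqI[of _ _ "(a \<oplus> b, \<one>)"] to_frac_mem to_frac_closed Frac_add_closed Frac_add_mem
      a_closed assms)

text \<open>Swapping the entries of all pairs of x stays within a single class, and a nonzero x has
  only nonzero numerators.\<close>

lemma Frac_inverse:
  assumes x: "x \<in> carrier (Frac R)" and nz: "x \<noteq> \<zero>\<^bsub>Frac R\<^esub>"
  obtains y where "y \<in> carrier (Frac R)" "x \<otimes>\<^bsub>Frac R\<^esub> y = \<one>\<^bsub>Frac R\<^esub>"
    "y \<otimes>\<^bsub>Frac R\<^esub> x = \<one>\<^bsub>Frac R\<^esub>" "\<And>a b. (a, b) \<in> x \<Longrightarrow> (b, a) \<in> y"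
proof -
  obtain a b where ab: "(a, b) \<in> x" using Frac_repr x by metis
  note C = Frac_pairs[OF x ab]
  have a0: "a \<noteq> \<zero>" using zero_mem_Frac[OF x] ab nz by blast
  define y where "y = ore_frac R b a"
  have y: "y \<in> carrier (Frac R)" "(b, a) \<in> y"
    using ore_frac_in_Frac[of b a] ore_frac_self[of b a] C a0 by (simp_all add: ore_pairs_def y_def)
  have one: "z = \<one>\<^bsub>Frac R\<^esub>" if "z \<in> carrier (Frac R)" "(c, c) \<in> z" for z c
    using Frac_eqI[OF that(1) to_frac_closed that(2), of \<one>] Frac_pairs[OF that]
      to_frac_scale_mem[of \<one> c] to_frac_one by simp
  have "(c, d) \<in> x \<Longrightarrow> (d, c) \<in> y" for c d
  proof -
    assume cd: "(c, d) \<in> x"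
    note C' = Frac_pairs[OF x cd]
    have c0: "c \<noteq> \<zero>" using zero_mem_Frac[OF x] cd nz by blast
    obtain u w where uw: "u \<in> carrier R" "w \<in> carrier R" "u \<noteq> \<zero>" "w \<noteq> \<zero>" "b \<otimes> u = d \<otimes> w"
      using right_ore_nonzero[of d b] C C' by metis
    then have "a \<otimes> u = c \<otimes> w" using Frac_eval[OF x ab cd] by simp
    then show ?thesis using Frac_memI[OF y, of d c u w] uw C' c0 by (simp add: ore_pairs_def)
  qed
  then show ?thesis
    using that[of y] y one Frac_mult_mem[OF x y(1) ab y(2)] Frac_mult_mem[OF y(1) x y(2) ab]
      Frac_mult_closed x by simp
qed

lemma Frac_l_one:
  assumes x: "x \<in> carrier (Frac R)" shows "\<one>\<^bsub>Frac R\<^esub> \<otimes>\<^bsub>Frac R\<^esub> x = x"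
proof (cases "x = \<zero>\<^bsub>Frac R\<^esub>")
  case True
  then show ?thesis using Frac_mult_zero_right Frac_one_closed by simp
next
  case False
  obtain a b where ab: "(a, b) \<in> x" using Frac_repr x by metis
  have "a \<noteq> \<zero>" using zero_mem_Frac[OF x] ab False by blast
  then have "(a, a) \<in> \<one>\<^bsub>Frac R\<^esub>"
    using to_frac_scale_mem[of \<one> a] Frac_pairs[OF x ab] by (simp add: to_frac_one)
  from Frac_mult_mem[OF Frac_one_closed x this ab]
  show ?thesis using Frac_eqI[OF _ x _ ab] Frac_mult_closed Frac_one_closed x by blast
qed

lemma Frac_r_one:
  assumes x: "x \<in> carrier (Frac R)" shows "x \<otimes>\<^bsub>Frac R\<^esub> \<one>\<^bsub>Frac R\<^esub> = x"
proof -
  obtain a b where ab: "(a, b) \<in> x" using Frac_repr x by metis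
  have "(b, b) \<in> \<one>\<^bsub>Frac R\<^esub>"
    using to_frac_scale_mem[of \<one> b] Frac_pairs[OF x ab] by (simp add: to_frac_one)
  from Frac_mult_mem[OF x Frac_one_closed ab this]
  show ?thesis using Frac_eqI[OF _ x _ ab] Frac_mult_closed Frac_one_closed x by blast
qed

lemma Frac_mult_zero_left:
  assumes x: "x \<in> carrier (Frac R)"
  shows "\<zero>\<^bsub>Frac R\<^esub> \<otimes>\<^bsub>Frac R\<^esub> x = \<zero>\<^bsub>Frac R\<^esub>"
proof (cases "x = \<zero>\<^bsub>Frac R\<^esub>")
  case True
  then show ?thesis using Frac_mult_zero_right Frac_zero_closed by simp
next
  case False
  obtain a b where ab: "(a, b) \<in> x" using Frac_repr x by metis
  have "a \<noteq> \<zero>" using zero_mem_Frac[OF x] ab False by blast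
  then have "(\<zero>, a) \<in> \<zero>\<^bsub>Frac R\<^esub>"
    using to_frac_scale_mem[of \<zero> a] Frac_pairs[OF x ab] by (simp add: to_frac_zero)
  from Frac_mult_mem[OF Frac_zero_closed x this ab]
  show ?thesis using zero_mem_Frac Frac_mult_closed Frac_zero_closed x by blast
qed

lemma Frac_mult_nonzero:
  assumes x: "x \<in> carrier (Frac R)" and y: "y \<in> carrier (Frac R)"
    and "x \<noteq> \<zero>\<^bsub>Frac R\<^esub>" and nz: "y \<noteq> \<zero>\<^bsub>Frac R\<^esub>"
  shows "x \<otimes>\<^bsub>Frac R\<^esub> y \<noteq> \<zero>\<^bsub>Frac R\<^esub>"
proof
  assume "x \<otimes>\<^bsub>Frac R\<^esub> y = \<zero>\<^bsub>Frac R\<^esub>"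
  obtain c d where cd: "(c, d) \<in> y" using Frac_repr y by metis
  obtain a w where "(a, c \<otimes> w) \<in> x" "(c \<otimes> w, d \<otimes> w) \<in> y"
    using Frac_chain[OF x cd y nz] by metis
  from Frac_mult_mem[OF x y this] have ad: "(a, d \<otimes> w) \<in> to_frac R \<zero>"
    by (simp add: \<open>x \<otimes>\<^bsub>Frac R\<^esub> y = _\<close> to_frac_zero)
  have "a = \<zero>"
    using Frac_eval[OF to_frac_closed ad to_frac_mem, of \<one> "d \<otimes> w"]
      Frac_pairs[OF to_frac_closed ad] by simp
  then show False using zero_mem_Frac[OF x] \<open>(a, c \<otimes> w) \<in> x\<close> assms(3) by blast
qed

text \<open>Chaining twice gives representatives (a, p), (p, q), (q, r) of x, y, z, and both
  bracketings contain (a, r). Chains need y and z nonzero, so zero factors are treated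
  separately.\<close>

lemma Frac_m_assoc:
  assumes x: "x \<in> carrier (Frac R)" and y: "y \<in> carrier (Frac R)" and z: "z \<in> carrier (Frac R)"
  shows "x \<otimes>\<^bsub>Frac R\<^esub> y \<otimes>\<^bsub>Frac R\<^esub> z = x \<otimes>\<^bsub>Frac R\<^esub> (y \<otimes>\<^bsub>Frac R\<^esub> z)"
proof (cases "y = \<zero>\<^bsub>Frac R\<^esub> \<or> z = \<zero>\<^bsub>Frac R\<^esub>")
  case True
  then show ?thesis
    using assms by (auto simp: Frac_mult_zero_left Frac_mult_zero_right Frac_mult_closed Frac_zero_closed)
next
  case False
  then have yz: "y \<otimes>\<^bsub>Frac R\<^esub> z \<noteq> \<zero>\<^bsub>Frac R\<^esub>" using Frac_mult_nonzero y z by blast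
  obtain e f where "(e, f) \<in> z" using Frac_repr z by metis
  then obtain c w where cw: "w \<in> carrier R" "w \<noteq> \<zero>" "(c, e \<otimes> w) \<in> y" "(e \<otimes> w, f \<otimes> w) \<in> z"
    using Frac_chain[OF y _ z] False by metis
  then obtain a v where av: "v \<in> carrier R" "v \<noteq> \<zero>" "(a, c \<otimes> v) \<in> x" "(c \<otimes> v, e \<otimes> w \<otimes> v) \<in> y"
    using Frac_chain[OF x cw(3) y] False by metis
  have ev: "(e \<otimes> w \<otimes> v, f \<otimes> w \<otimes> v) \<in> z" using Frac_scale[OF z cw(4) av(1,2)] .
  have "(a, f \<otimes> w \<otimes> v) \<in> x \<otimes>\<^bsub>Frac R\<^esub> y \<otimes>\<^bsub>Frac R\<^esub> z"
    using Frac_mult_mem[OF _ z _ ev] Frac_mult_mem[OF x y av(3,4)] Frac_mult_closed x y by blast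
  moreover have "(a, f \<otimes> w \<otimes> v) \<in> x \<otimes>\<^bsub>Frac R\<^esub> (y \<otimes>\<^bsub>Frac R\<^esub> z)"
    using Frac_mult_mem[OF x _ av(3)] Frac_mult_mem[OF y z av(4) ev] Frac_mult_closed y z by blast
  ultimately show ?thesis using Frac_eqI Frac_mult_closed x y z by meson
qed

lemma monoid_Frac: "monoid (Frac R)"
  by (rule monoidI)
    (simp_all add: Frac_mult_closed Frac_one_closed Frac_m_assoc Frac_l_one Frac_r_one)

lemma to_frac_nonzero: "a \<in> carrier R \<Longrightarrow> a \<noteq> \<zero> \<Longrightarrow> to_frac R a \<noteq> \<zero>\<^bsub>Frac R\<^esub>"
  using to_frac_inj to_frac_zero by (metis inj_onD zero_closed)

lemma Frac_eq_quotient: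
  assumes x: "x \<in> carrier (Frac R)" and ab: "(a, b) \<in> x"
  shows "x \<otimes>\<^bsub>Frac R\<^esub> to_frac R b = to_frac R a"
proof -
  note C = Frac_pairs[OF x ab]
  have "(a, \<one>) \<in> x \<otimes>\<^bsub>Frac R\<^esub> to_frac R b"
    by (rule Frac_mult_mem[OF x _ ab]) (use C to_frac_closed to_frac_mem in auto)
  then show ?thesis
    using Frac_eqI to_frac_mem[OF C(2)] Frac_mult_closed[OF x] to_frac_closed C by blast
qed

end

section \<open>Extension of homomorphisms to fractions\<close>

definition frac_map ::
    "('a, 'm) ring_scheme \<Rightarrow> ('b, 'n) ring_scheme \<Rightarrow> 'a set \<Rightarrow> ('a \<Rightarrow> 'b) \<Rightarrow>
     ('a \<times> 'a) set \<Rightarrow> ('b \<times> 'b) set" where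
  "frac_map R R' S \<phi> x =
     (let p = (SOME p. p \<in> x \<and> p \<in> S \<times> S) in ore_frac R' (\<phi> (fst p)) (\<phi> (snd p)))"

text \<open>
  A ring homomorphism defined only on a subring \<open>S\<close> still extends to all fractions, provided that
  every fraction can be written with numerator and denominator in \<open>S\<close>.
\<close>

locale ore_partial_hom = R: ore_domain R + R': ore_domain R' for R (structure) and R' +
  fixes S \<phi>
  assumes S_sub: "S \<subseteq> carrier R"
    and S_one: "\<one> \<in> S"
    and S_mult: "\<And>a b. a \<in> S \<Longrightarrow> b \<in> S \<Longrightarrow> a \<otimes> b \<in> S"
    and S_add: "\<And>a b. a \<in> S \<Longrightarrow> b \<in> S \<Longrightarrow> a \<oplus> b \<in> S"
    and \<phi>_closed: "\<And>a. a \<in> S \<Longrightarrow> \<phi> a \<in> carrier R'"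
    and \<phi>_one: "\<phi> \<one> = \<one>\<^bsub>R'\<^esub>"
    and \<phi>_mult: "\<And>a b. a \<in> S \<Longrightarrow> b \<in> S \<Longrightarrow> \<phi> (a \<otimes> b) = \<phi> a \<otimes>\<^bsub>R'\<^esub> \<phi> b"
    and \<phi>_add: "\<And>a b. a \<in> S \<Longrightarrow> b \<in> S \<Longrightarrow> \<phi> (a \<oplus> b) = \<phi> a \<oplus>\<^bsub>R'\<^esub> \<phi> b"
    and \<phi>_inj: "inj_on \<phi> S"
    and S_large: "\<And>F. finite F \<Longrightarrow> F \<subseteq> carrier R \<Longrightarrow> \<exists>r\<in>S. r \<noteq> \<zero> \<and> (\<forall>a\<in>F. a \<otimes> r \<in> S)"
begin

lemma S_carrier: "a \<in> S \<Longrightarrow> a \<in> carrier R"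
  using S_sub by blast

lemma S_zero: "\<zero> \<in> S"
  using S_large[of "{\<zero>}"] S_carrier by auto

lemma \<phi>_zero: "\<phi> \<zero> = \<zero>\<^bsub>R'\<^esub>"
proof -
  have "\<phi> \<zero> \<oplus>\<^bsub>R'\<^esub> \<phi> \<zero> = \<phi> \<zero>" using \<phi>_add[OF S_zero S_zero] by simp
  then show ?thesis using \<phi>_closed[OF S_zero] R'.add.l_cancel_one' by metis
qed

lemma \<phi>_nonzero: "a \<in> S \<Longrightarrow> a \<noteq> \<zero> \<Longrightarrow> \<phi> a \<noteq> \<zero>\<^bsub>R'\<^esub>"
  using \<phi>_inj \<phi>_zero S_zero by (metis inj_onD)

lemma pairs_\<phi>: "a \<in> S \<Longrightarrow> b \<in> S \<Longrightarrow> b \<noteq> \<zero> \<Longrightarrow> (\<phi> a, \<phi> b) \<in> ore_pairs R'"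
  using \<phi>_nonzero \<phi>_closed by (simp add: ore_pairs_def)

lemma frac_map_welldef:
  assumes x: "x \<in> carrier (Frac R)" and ab: "(a, b) \<in> x" and cd: "(c, d) \<in> x"
    and S: "a \<in> S" "b \<in> S" "c \<in> S" "d \<in> S"
  shows "ore_frac R' (\<phi> a) (\<phi> b) = ore_frac R' (\<phi> c) (\<phi> d)"
proof -
  note C = R.Frac_pairs[OF x ab] R.Frac_pairs[OF x cd]
  obtain p q where pq: "p \<in> carrier R" "q \<in> carrier R" "p \<noteq> \<zero>" "q \<noteq> \<zero>" "b \<otimes> p = d \<otimes> q"
    using R.right_ore_nonzero[of d b] C by metis
  \<comment> \<open>The Ore multipliers p and q need not lie in \<open>S\<close>, where \<phi> is
    multiplicative; one common factor r moves both into it.\<close>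
  obtain r where r: "r \<in> S" "r \<noteq> \<zero>" "p \<otimes> r \<in> S" "q \<otimes> r \<in> S"
    using S_large[of "{p, q}"] pq by auto
  note rC = S_carrier[OF r(1)]
  have pr0: "p \<otimes> r \<noteq> \<zero>" using R.mult_nonzero[OF pq(1) rC pq(3) r(2)] .
  have "b \<otimes> (p \<otimes> r) = (d \<otimes> q) \<otimes> r" using C pq(1,2) rC by (simp add: pq(5)[symmetric] R.m_assoc)
  then have eq: "b \<otimes> (p \<otimes> r) = d \<otimes> (q \<otimes> r)" using C pq(1,2) rC by (simp add: R.m_assoc)
  then have eq': "a \<otimes> (p \<otimes> r) = c \<otimes> (q \<otimes> r)"
    using R.Frac_eval[OF x ab cd] S_carrier r by blast
  show ?thesis
  proof (rule R'.ore_frac_cong)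
    show "(\<phi> a, \<phi> b) \<in> ore_pairs R'" "(\<phi> c, \<phi> d) \<in> ore_pairs R'" using pairs_\<phi> S C by auto
    show "\<phi> (p \<otimes> r) \<in> carrier R'" "\<phi> (q \<otimes> r) \<in> carrier R'" "\<phi> (p \<otimes> r) \<noteq> \<zero>\<^bsub>R'\<^esub>"
      using \<phi>_closed \<phi>_nonzero r pr0 by auto
    show "\<phi> b \<otimes>\<^bsub>R'\<^esub> \<phi> (p \<otimes> r) = \<phi> d \<otimes>\<^bsub>R'\<^esub> \<phi> (q \<otimes> r)"
      "\<phi> a \<otimes>\<^bsub>R'\<^esub> \<phi> (p \<otimes> r) = \<phi> c \<otimes>\<^bsub>R'\<^esub> \<phi> (q \<otimes> r)"
      using S r eq eq' by (simp_all flip: \<phi>_mult)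
  qed
qed

abbreviation "\<Phi> \<equiv> frac_map R R' S \<phi>"

lemma frac_map_eq:
  assumes x: "x \<in> carrier (Frac R)" and ab: "(a, b) \<in> x" and S: "a \<in> S" "b \<in> S"
  shows "\<Phi> x = ore_frac R' (\<phi> a) (\<phi> b)"
proof -
  define p where "p = (SOME p. p \<in> x \<and> p \<in> S \<times> S)"
  have "p \<in> x \<and> p \<in> S \<times> S" unfolding p_def by (rule someI[of _ "(a, b)"]) (use ab S in simp)
  then have "ore_frac R' (\<phi> (fst p)) (\<phi> (snd p)) = ore_frac R' (\<phi> a) (\<phi> b)"
    using frac_map_welldef[OF x _ ab, of "fst p" "snd p"] S by (cases p) simp
  then show ?thesis by (simp add: frac_map_def p_def Let_def)
qed

lemma frac_map_mem:
  assumes x: "x \<in> carrier (Frac R)" and ab: "(a, b) \<in> x" and S: "a \<in> S" "b \<in> S"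
  shows "(\<phi> a, \<phi> b) \<in> \<Phi> x"
  using frac_map_eq[OF assms] R'.ore_frac_self pairs_\<phi> S R.Frac_pairs[OF x ab] by simp

lemma repr_S:
  assumes x: "x \<in> carrier (Frac R)"
  obtains a b where "(a, b) \<in> x" "a \<in> S" "b \<in> S"
proof -
  obtain a b where ab: "(a, b) \<in> x" using R.Frac_repr x by metis
  obtain r where "r \<in> S" "r \<noteq> \<zero>" "a \<otimes> r \<in> S" "b \<otimes> r \<in> S"
    using S_large[of "{a, b}"] R.Frac_pairs[OF x ab] by auto
  then show ?thesis using that R.Frac_scale[OF x ab] S_carrier by blast
qed

lemma frac_map_closed: "x \<in> carrier (Frac R) \<Longrightarrow> \<Phi> x \<in> carrier (Frac R')"
  using repr_S frac_map_eq pairs_\<phi> R.Frac_pairs R'.ore_frac_in_Frac by metis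

lemma frac_map_to_frac: "a \<in> S \<Longrightarrow> \<Phi> (to_frac R a) = to_frac R' (\<phi> a)"
  using frac_map_eq[OF R.to_frac_closed R.to_frac_mem] S_one S_carrier
  by (simp add: to_frac_def \<phi>_one)

lemma frac_map_mult:
  assumes x: "x \<in> carrier (Frac R)" and y: "y \<in> carrier (Frac R)"
  shows "\<Phi> (x \<otimes>\<^bsub>Frac R\<^esub> y) = \<Phi> x \<otimes>\<^bsub>Frac R'\<^esub> \<Phi> y"
proof (cases "y = \<zero>\<^bsub>Frac R\<^esub>")
  case True
  have "\<Phi> y = \<zero>\<^bsub>Frac R'\<^esub>"
    using frac_map_to_frac[OF S_zero] True by (simp add: \<phi>_zero R.to_frac_zero R'.to_frac_zero)
  then show ?thesis
    using x True by (simp add: R.Frac_mult_zero_right R'.Frac_mult_zero_right frac_map_closed)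
next
  case False
  obtain c d where "(c, d) \<in> y" using R.Frac_repr y by metis
  then obtain a w where w: "w \<in> carrier R" "w \<noteq> \<zero>" "(a, c \<otimes> w) \<in> x" "(c \<otimes> w, d \<otimes> w) \<in> y"
    using R.Frac_chain[OF x _ y False] by metis
  obtain r where r: "r \<in> S" "r \<noteq> \<zero>" "a \<otimes> r \<in> S" "c \<otimes> w \<otimes> r \<in> S" "d \<otimes> w \<otimes> r \<in> S"
    using S_large[of "{a, c \<otimes> w, d \<otimes> w}"] R.Frac_pairs[OF x w(3)] R.Frac_pairs[OF y w(4)] by auto
  note m = R.Frac_scale[OF x w(3) S_carrier[OF r(1)] r(2)] R.Frac_scale[OF y w(4) S_carrier[OF r(1)] r(2)]
  have "(\<phi> (a \<otimes> r), \<phi> (d \<otimes> w \<otimes> r)) \<in> \<Phi> (x \<otimes>\<^bsub>Frac R\<^esub> y)"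
    using frac_map_mem[OF R.Frac_mult_closed[OF x y] R.Frac_mult_mem[OF x y m]] r by blast
  moreover have "(\<phi> (a \<otimes> r), \<phi> (d \<otimes> w \<otimes> r)) \<in> \<Phi> x \<otimes>\<^bsub>Frac R'\<^esub> \<Phi> y"
    using R'.Frac_mult_mem[OF _ _ frac_map_mem[OF x m(1)] frac_map_mem[OF y m(2)]]
      frac_map_closed x y r by blast
  ultimately show ?thesis
    using R'.Frac_eqI frac_map_closed R.Frac_mult_closed R'.Frac_mult_closed x y by meson
qed

lemma common_S:
  assumes x: "x \<in> carrier (Frac R)" and y: "y \<in> carrier (Frac R)"
  obtains a b d where "(a, d) \<in> x" "(b, d) \<in> y" "a \<in> S" "b \<in> S" "d \<in> S"
proof -
  obtain a b d where m: "(a, d) \<in> x" "(b, d) \<in> y" using R.Frac_common assms by metis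
  obtain r where r: "r \<in> S" "r \<noteq> \<zero>" "a \<otimes> r \<in> S" "b \<otimes> r \<in> S" "d \<otimes> r \<in> S"
    using S_large[of "{a, b, d}"] R.Frac_pairs[OF x m(1)] R.Frac_pairs[OF y m(2)] by auto
  then show ?thesis
    using that R.Frac_scale[OF x m(1)] R.Frac_scale[OF y m(2)] S_carrier by blast
qed

lemma frac_map_add:
  assumes x: "x \<in> carrier (Frac R)" and y: "y \<in> carrier (Frac R)"
  shows "\<Phi> (x \<oplus>\<^bsub>Frac R\<^esub> y) = \<Phi> x \<oplus>\<^bsub>Frac R'\<^esub> \<Phi> y"
proof -
  obtain a b d where m: "(a, d) \<in> x" "(b, d) \<in> y" "a \<in> S" "b \<in> S" "d \<in> S"
    using common_S assms by metis
  have "(\<phi> (a \<oplus> b), \<phi> d) \<in> \<Phi> (x \<oplus>\<^bsub>Frac R\<^esub> y)"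
    using frac_map_mem[OF R.Frac_add_closed[OF x y] R.Frac_add_mem[OF x y m(1,2)]] m S_add by blast
  moreover have "(\<phi> (a \<oplus> b), \<phi> d) \<in> \<Phi> x \<oplus>\<^bsub>Frac R'\<^esub> \<Phi> y"
    unfolding \<phi>_add[OF m(3,4)]
    using R'.Frac_add_mem[OF _ _ frac_map_mem[OF x m(1)] frac_map_mem[OF y m(2)]]
      frac_map_closed x y m by blast
  ultimately show ?thesis
    using R'.Frac_eqI frac_map_closed R.Frac_add_closed R'.Frac_add_closed x y by meson
qed

lemma frac_map_hom: "\<Phi> \<in> ring_hom (Frac R) (Frac R')"
proof (rule ring_hom_memI)
  show "\<Phi> \<one>\<^bsub>Frac R\<^esub> = \<one>\<^bsub>Frac R'\<^esub>"
    using frac_map_to_frac[OF S_one] by (simp add: \<phi>_one R.to_frac_one R'.to_frac_one)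
qed (simp_all add: frac_map_closed frac_map_mult frac_map_add)

lemma frac_map_inj: "inj_on \<Phi> (carrier (Frac R))"
proof (rule inj_onI)
  fix x y assume x: "x \<in> carrier (Frac R)" and y: "y \<in> carrier (Frac R)" and eq: "\<Phi> x = \<Phi> y"
  obtain a b d where m: "(a, d) \<in> x" "(b, d) \<in> y" "a \<in> S" "b \<in> S" "d \<in> S"
    using common_S x y by metis
  have "(\<phi> a, \<phi> d) \<in> \<Phi> x" "(\<phi> b, \<phi> d) \<in> \<Phi> x"
    using frac_map_mem[OF x m(1)] frac_map_mem[OF y m(2)] m eq by auto
  from R'.Frac_eval[OF frac_map_closed[OF x] this, of "\<one>\<^bsub>R'\<^esub>" "\<one>\<^bsub>R'\<^esub>"]
  have "\<phi> a = \<phi> b" using m \<phi>_closed by simp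
  then have "a = b" using \<phi>_inj m by (meson inj_onD)
  then show "x = y" using R.Frac_eqI[OF x y m(1)] m by simp
qed

end

text \<open>For a pair (a, b) in x the equation x b = a holds in the skew field, and the image of b
  is invertible because b is; so the values on \<open>R\<close> determine the value at x.\<close>

lemma frac_hom_eqI:
  assumes "ore_domain R" "ore_domain R'"
    and \<phi>: "\<phi> \<in> ring_hom (Frac R) (Frac R')" and \<psi>: "\<psi> \<in> ring_hom (Frac R) (Frac R')"
    and eq: "\<And>a. a \<in> carrier R \<Longrightarrow> \<phi> (to_frac R a) = \<psi> (to_frac R a)"
    and x: "x \<in> carrier (Frac R)"
  shows "\<phi> x = \<psi> x"
proof -
  interpret R: ore_domain R by fact
  interpret R': ore_domain R' by fact
  interpret F: monoid "Frac R" by (rule R.monoid_Frac)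
  interpret F': monoid "Frac R'" by (rule R'.monoid_Frac)
  obtain a b where ab: "(a, b) \<in> x" using R.Frac_repr x by metis
  note C = R.Frac_pairs[OF x ab]
  let ?b = "to_frac R b"
  have b: "?b \<in> carrier (Frac R)" using R.to_frac_closed C by simp
  obtain y where y: "y \<in> carrier (Frac R)" "?b \<otimes>\<^bsub>Frac R\<^esub> y = \<one>\<^bsub>Frac R\<^esub>"
    using R.Frac_inverse[OF b R.to_frac_nonzero[OF C(3,4)]] by metis
  have b': "\<phi> ?b \<otimes>\<^bsub>Frac R'\<^esub> \<phi> y = \<one>\<^bsub>Frac R'\<^esub>"
    using ring_hom_mult[OF \<phi> b y(1)] ring_hom_one[OF \<phi>] y(2) by simp
  have "\<phi> x \<otimes>\<^bsub>Frac R'\<^esub> \<phi> ?b = \<psi> x \<otimes>\<^bsub>Frac R'\<^esub> \<phi> ?b"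
    using ring_hom_mult[OF \<phi> x b] ring_hom_mult[OF \<psi> x b] R.Frac_eq_quotient[OF x ab] eq C by simp
  then have "(\<phi> x \<otimes>\<^bsub>Frac R'\<^esub> \<phi> ?b) \<otimes>\<^bsub>Frac R'\<^esub> \<phi> y = (\<psi> x \<otimes>\<^bsub>Frac R'\<^esub> \<phi> ?b) \<otimes>\<^bsub>Frac R'\<^esub> \<phi> y"
    by simp
  then show ?thesis
    using ring_hom_closed[OF \<phi>] ring_hom_closed[OF \<psi>] x y(1) b b' by (simp add: F'.m_assoc)
qed

text \<open>If p and q are preimages of a and b, then p q^-1 is one of a b^-1. The hypothesis on
  zero makes q nonzero; membership in \<open>ring_hom\<close> speaks only of closure, sums, products
  and one.\<close>

lemma frac_hom_surjI:
  assumes "ore_domain R" "ore_domain R'"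
    and \<phi>: "\<phi> \<in> ring_hom (Frac R) (Frac R')"
    and zero: "\<phi> \<zero>\<^bsub>Frac R\<^esub> = \<zero>\<^bsub>Frac R'\<^esub>"
    and sur: "\<And>a. a \<in> carrier R' \<Longrightarrow> to_frac R' a \<in> \<phi> ` carrier (Frac R)"
    and y: "y \<in> carrier (Frac R')"
  shows "y \<in> \<phi> ` carrier (Frac R)"
proof -
  interpret R: ore_domain R by fact
  interpret R': ore_domain R' by fact
  interpret F: monoid "Frac R" by (rule R.monoid_Frac)
  interpret F': monoid "Frac R'" by (rule R'.monoid_Frac)
  obtain a b where ab: "(a, b) \<in> y" using R'.Frac_repr y by metis
  note C = R'.Frac_pairs[OF y ab]
  obtain p q where p: "p \<in> carrier (Frac R)" "\<phi> p = to_frac R' a"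
    and q: "q \<in> carrier (Frac R)" "\<phi> q = to_frac R' b"
    using sur[OF C(2)] sur[OF C(3)] by (metis imageE)
  have "q \<noteq> \<zero>\<^bsub>Frac R\<^esub>" using R'.to_frac_nonzero[OF C(3,4)] zero q(2) by metis
  then obtain q' where q': "q' \<in> carrier (Frac R)" "q \<otimes>\<^bsub>Frac R\<^esub> q' = \<one>\<^bsub>Frac R\<^esub>"
    using R.Frac_inverse[OF q(1)] by metis
  have 1: "\<phi> q \<otimes>\<^bsub>Frac R'\<^esub> \<phi> q' = \<one>\<^bsub>Frac R'\<^esub>"
    using ring_hom_mult[OF \<phi> q(1) q'(1)] ring_hom_one[OF \<phi>] q'(2) by simp
  have c: "\<phi> q \<in> carrier (Frac R')" "\<phi> q' \<in> carrier (Frac R')"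
    using ring_hom_closed[OF \<phi>] q(1) q'(1) by auto
  have "\<phi> (p \<otimes>\<^bsub>Frac R\<^esub> q') = (y \<otimes>\<^bsub>Frac R'\<^esub> \<phi> q) \<otimes>\<^bsub>Frac R'\<^esub> \<phi> q'"
    using ring_hom_mult[OF \<phi> p(1) q'(1)] R'.Frac_eq_quotient[OF y ab] p q by simp
  also have "\<dots> = y" using y 1 c by (simp add: F'.m_assoc)
  finally show ?thesis using F.m_closed[OF p(1) q'(1)] by (metis imageI)
qed

section \<open>Quantum tori as Ore domains\<close>

lemma poly_mapping_sum_single:
  "p = (\<Sum>m\<in>Poly_Mapping.keys p. Poly_Mapping.single m (Poly_Mapping.lookup p m))"
proof (rule poly_mapping_eqI)
  fix n
  show "Poly_Mapping.lookup p n =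
      Poly_Mapping.lookup (\<Sum>m\<in>Poly_Mapping.keys p. Poly_Mapping.single m (Poly_Mapping.lookup p m)) n"
    by (cases "n \<in> Poly_Mapping.keys p")
      (auto simp: lookup_sum lookup_single when_def in_keys_iff)
qed

lemma poly_mapping_add_induct [case_names zero single add]:
  fixes p :: "'a \<Rightarrow>\<^sub>0 'b::comm_monoid_add"
  assumes "P 0" "\<And>m c. P (Poly_Mapping.single m c)" "\<And>p q. P p \<Longrightarrow> P q \<Longrightarrow> P (p + q)"
  shows "P p"
proof -
  have "P (\<Sum>m\<in>A. Poly_Mapping.single m (Poly_Mapping.lookup p m))" if "finite A" for A
    using that by (induction A rule: finite_induct) (simp_all add: assms)
  from this[OF finite_keys, of p] show ?thesis using poly_mapping_sum_single[of p] by simp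
qed

lemma lookup_const_mult [simp]:
  "Poly_Mapping.lookup (const c * p) m = c * Poly_Mapping.lookup p m"
  by (subst mult_map_scale_conv_mult[symmetric]) (simp add: map.rep_eq when_def)

lemma const_mult_const: "const a * (const b * p) = const (a * b) * p"
  by (simp add: mult_single flip: mult.assoc)

lemma const_one_mult [simp]: "const 1 * p = p"
  by (simp add: poly_mapping_eq_iff fun_eq_iff)

section \<open>Linear extensions and monomial maps\<close>

definition lin_ext ::
    "('j \<Rightarrow> (int ^ 'i::finite \<Rightarrow>\<^sub>0 'k::idom)) \<Rightarrow> ('j \<Rightarrow>\<^sub>0 'k) \<Rightarrow> (int ^ 'i \<Rightarrow>\<^sub>0 'k)" where
  "lin_ext f p = (\<Sum>m\<in>Poly_Mapping.keys p. const (Poly_Mapping.lookup p m) * f m)"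

lemma lin_ext_superset:
  assumes "finite A" "Poly_Mapping.keys p \<subseteq> A"
  shows "lin_ext f p = (\<Sum>m\<in>A. const (Poly_Mapping.lookup p m) * f m)"
  unfolding lin_ext_def by (rule sum.mono_neutral_left) (use assms in \<open>auto simp: in_keys_iff\<close>)

lemma lin_ext_zero [simp]: "lin_ext f 0 = 0"
  by (simp add: lin_ext_def)

lemma lin_ext_single [simp]: "lin_ext f (Poly_Mapping.single m c) = const c * f m"
  by (simp add: lin_ext_def)

lemma lin_ext_add [simp]: "lin_ext f (p + q) = lin_ext f p + lin_ext f q"
proof -
  let ?A = "Poly_Mapping.keys p \<union> Poly_Mapping.keys q"
  have *: "finite ?A" "Poly_Mapping.keys p \<subseteq> ?A" "Poly_Mapping.keys q \<subseteq> ?A"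
    "Poly_Mapping.keys (p + q) \<subseteq> ?A"
    using keys_add[of p q] by auto
  show ?thesis
    unfolding lin_ext_superset[OF *(1,2)] lin_ext_superset[OF *(1,3)] lin_ext_superset[OF *(1,4)]
    by (simp add: lookup_add single_add distrib_right sum.distrib)
qed

lemma lin_ext_sum: "lin_ext f (\<Sum>x\<in>A. g x) = (\<Sum>x\<in>A. lin_ext f (g x))"
  by (induction A rule: infinite_finite_induct) auto

lemma monomial_map_lin_ext: "monomial_map V p = lin_ext (\<lambda>m. monomial (V m)) p"
  by (simp add: monomial_map_def lin_ext_def mult_single)

lemma monomial_map_single [simp]:
  "monomial_map V (Poly_Mapping.single m c) = Poly_Mapping.single (V m) c"
  by (simp add: monomial_map_lin_ext mult_single)

lemma monomial_map_comp: "monomial_map V (monomial_map W p) = monomial_map (V \<circ> W) p"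
  by (induction p rule: poly_mapping_add_induct) (simp_all add: monomial_map_lin_ext mult_single)

lemma monomial_map_id: "monomial_map id p = p"
  by (induction p rule: poly_mapping_add_induct) (simp_all add: monomial_map_lin_ext mult_single)

lemma bij_monomial_map:
  assumes "bij V" shows "bij (monomial_map V)"
proof -
  let ?W = "inv_into UNIV V"
  have *: "?W \<circ> V = id" "V \<circ> ?W = id"
    using assms by (simp_all add: bij_is_inj fun_eq_iff bij_is_surj surj_f_inv_f)
  have "monomial_map ?W \<circ> monomial_map V = id" "monomial_map V \<circ> monomial_map ?W = id"
    by (simp_all only: fun_eq_iff o_apply[of "monomial_map _"] monomial_map_comp * monomial_map_id id_apply)
      simp_all
  then show ?thesis by (rule o_bij)
qed

text \<open>
  A linear form separating finitely many vectors plays the role of a monomial order: evaluate at a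
  non-root of the finitely many polynomials whose coefficients are the differences.
\<close>

lemma generic_form:
  assumes "finite (D :: (int ^ 'i::finite) set)" "0 \<notin> D"
  obtains h :: "int ^ 'i \<Rightarrow> int" where "additive h" "\<And>m. m \<in> D \<Longrightarrow> h m \<noteq> 0"
proof -
  obtain ix :: "'i \<Rightarrow> nat" where ix: "inj ix"
    using finite_imp_inj_to_nat_seg[of "UNIV :: 'i set"] by auto
  define P where "P m = (\<Sum>i\<in>UNIV. monom (m $ i) (ix i))" for m :: "int ^ 'i"
  have P0: "P m \<noteq> 0" if nz: "m \<noteq> 0" for m
  proof -
    obtain j where j: "m $ j \<noteq> 0" using nz by (metis vec_eq_iff zero_index)
    have "coeff (P m) (ix j) = (\<Sum>i\<in>UNIV. if i = j then m $ i else 0)"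
      unfolding P_def coeff_sum by (rule sum.cong) (auto dest: injD[OF ix])
    with j show ?thesis by auto
  qed
  have "finite (\<Union>m\<in>D. {x. poly (P m) x = 0})"
    using assms(2) by (intro finite_UN_I assms(1) poly_roots_finite P0) metis
  then obtain N where N: "N \<notin> (\<Union>m\<in>D. {x. poly (P m) x = 0})"
    using ex_new_if_finite infinite_UNIV_int by blast
  show ?thesis
  proof (rule that[of "\<lambda>m. poly (P m) N"])
    show "additive (\<lambda>m. poly (P m) N)"
      by unfold_locales (simp add: P_def poly_sum poly_monom distrib_right sum.distrib)
  qed (use N in auto)
qed

lemma finite_maximum:
  fixes h :: "'a \<Rightarrow> 'b::linorder"
  assumes "finite A" "A \<noteq> {}"
  obtains a where "a \<in> A" "\<And>x. x \<in> A \<Longrightarrow> h x \<le> h a"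
proof -
  have "Max (h ` A) \<in> h ` A" using assms by (intro Max_in) auto
  then obtain a where a: "a \<in> A" "Max (h ` A) = h a" by auto
  have "h x \<le> h a" if "x \<in> A" for x
    unfolding a(2)[symmetric] using assms that by (intro Max_ge) auto
  with a that show ?thesis by blast
qed

text \<open>Elimination without division, by induction on the equations. An equation with pivot c e
  w is removed from the others by cross-multiplication; scaling the remaining unknowns by the pivot
  then makes the value of x w available in the domain itself.\<close>

lemma homogeneous_system_solvable:
  fixes c :: "'e \<Rightarrow> 'u \<Rightarrow> 'k::idom"
  assumes "finite E" "finite U" "card E < card U"
  shows "\<exists>x. (\<exists>u\<in>U. x u \<noteq> 0) \<and> (\<forall>e\<in>E. (\<Sum>u\<in>U. c e u * x u) = 0)"
  using assms
proof (induction E arbitrary: U c rule: finite_induct)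
  case empty
  then have "U \<noteq> {}" by auto
  then show ?case by (intro exI[of _ "\<lambda>_. 1"]) auto
next
  case (insert e E)
  show ?case
  proof (cases "\<forall>u\<in>U. c e u = 0")
    case True
    then show ?thesis using insert.IH[of U c] insert.prems insert.hyps by auto
  next
    case False
    then obtain w where w: "w \<in> U" "c e w \<noteq> 0" by auto
    define U' where "U' = U - {w}"
    have U': "finite U'" "card E < card U'" "U = insert w U'" "w \<notin> U'"
      using insert w by (auto simp: U'_def)
    obtain y where y: "\<exists>u\<in>U'. y u \<noteq> 0"
      "\<forall>e'\<in>E. (\<Sum>u\<in>U'. (c e w * c e' u - c e' w * c e u) * y u) = 0"
      using insert.IH[OF U'(1,2), of "\<lambda>e' u. c e w * c e' u - c e' w * c e u"] by blast
    define x where "x u = (if u = w then - (\<Sum>u\<in>U'. c e u * y u) else c e w * y u)" for u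
    have S: "(\<Sum>u\<in>U. c e' u * x u) = (\<Sum>u\<in>U'. (c e w * c e' u - c e' w * c e u) * y u)" for e'
    proof -
      have "(\<Sum>u\<in>U'. c e' u * x u) = (\<Sum>u\<in>U'. c e w * c e' u * y u)"
        using U'(4) by (intro sum.cong) (auto simp: x_def)
      then show ?thesis
        using U' by (simp add: x_def left_diff_distrib sum_subtractf sum_distrib_left mult.assoc)
    qed
    have "(\<Sum>u\<in>U. c e u * x u) = 0" unfolding S by (simp add: mult.commute)
    moreover have "\<exists>u\<in>U. x u \<noteq> 0" using y(1) w U' by (auto simp: x_def)
    ultimately show ?thesis using y(2) S by (intro exI[of _ x]) auto
  qed
qed

definition box :: "int \<Rightarrow> (int ^ 'i::finite) set" where
  "box n = {m. \<forall>i. \<bar>m $ i\<bar> \<le> n}"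

lemma box_image: "(box n :: (int ^ 'i::finite) set) = vec_lambda ` (UNIV \<rightarrow>\<^sub>E {-n..n})"
proof (intro equalityI subsetI)
  fix m :: "int ^ 'i" assume "m \<in> box n"
  then have "- n \<le> m $ i" "m $ i \<le> n" for i by (auto simp: box_def abs_le_iff minus_le_iff)
  then have "($) m \<in> UNIV \<rightarrow>\<^sub>E {-n..n}" by auto
  then show "m \<in> vec_lambda ` (UNIV \<rightarrow>\<^sub>E {-n..n})" by (metis imageI vec_lambda_eta)
qed (auto simp: box_def PiE_iff abs_le_iff minus_le_iff)

lemma finite_box [simp]: "finite (box n :: (int ^ 'i::finite) set)"
  unfolding box_image by (intro finite_imageI finite_PiE) auto

lemma card_box: "n \<ge> 0 \<Longrightarrow> card (box n :: (int ^ 'i::finite) set) = nat (2 * n + 1) ^ CARD('i)"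
proof -
  have "inj_on (vec_lambda :: ('i \<Rightarrow> int) \<Rightarrow> _) (UNIV \<rightarrow>\<^sub>E {-n..n})"
    by (rule inj_onI) (simp add: vec_lambda_inject)
  then have "card (box n :: (int ^ 'i) set) = card ((UNIV :: 'i set) \<rightarrow>\<^sub>E {-n..n})"
    unfolding box_image by (rule card_image)
  then show "n \<ge> 0 \<Longrightarrow> card (box n :: (int ^ 'i) set) = nat (2 * n + 1) ^ CARD('i)"
    by (simp add: card_PiE algebra_simps)
qed

text \<open>Polynomial growth of \<open>\<int>\<^sup>d\<close>, in the form needed for the Ore condition.\<close>

lemma box_growth:
  assumes "c \<ge> 0"
  obtains n where "n \<ge> 0"
    "card (box (n + c) :: (int ^ 'i::finite) set) < 2 * card (box n :: (int ^ 'i) set)"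
proof -
  let ?d = "CARD('i)"
  \<comment> \<open>With this n, the side N = 2 (n + c) + 1 of the larger box exceeds 4 c times the
    dimension, so Bernoulli's inequality bounds the power of 1 - 2 c / N below by more than 1/2; N -
    2 c is the side of the smaller box.\<close>
  define n where "n = 2 * c * int ?d"
  define N :: real where "N = of_int (2 * n + 2 * c + 1)"
  have n0: "n \<ge> 0" using assms by (simp add: n_def)
  have "2 * n + 2 * c + 1 > 0" "2 * n + 2 * c + 1 > 4 * c * int ?d" using assms n0 by (auto simp: n_def)
  then have N0: "N > 0" "N > 4 * of_int c * ?d"
    unfolding N_def by (simp_all only: of_int_0_less_iff flip: of_int_less_iff[where 'a = real]) simp_all
  have "2 * c \<le> 2 * n + 2 * c + 1" using n0 by simp
  then have "2 * of_int c \<le> N" unfolding N_def by (metis of_int_le_iff of_int_mult of_int_numeral)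
  then have "1 + real ?d * (- (2 * of_int c / N)) \<le> (1 + - (2 * of_int c / N)) ^ ?d"
    using N0 by (intro Bernoulli_inequality) (simp add: field_simps)
  moreover have "1 / 2 < 1 + real ?d * (- (2 * of_int c / N))"
    using N0 by (simp add: field_simps)
  ultimately have "1 / 2 < (1 + - (2 * of_int c / N)) ^ ?d" by linarith
  then have "1 / 2 < ((N - 2 * of_int c) / N) ^ ?d" using N0 by (simp add: diff_divide_distrib)
  then have "N ^ ?d < 2 * (N - 2 * of_int c) ^ ?d"
    using N0 by (simp add: power_divide field_simps)
  moreover have "N - 2 * of_int c = of_int (2 * n + 1)" by (simp add: N_def)
  ultimately have "of_int ((2 * (n + c) + 1) ^ ?d) < (of_int (2 * (2 * n + 1) ^ ?d) :: real)"
    by (simp add: N_def algebra_simps)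
  then have *: "(2 * (n + c) + 1) ^ ?d < 2 * (2 * n + 1) ^ ?d" by (simp only: of_int_less_iff)
  have "int (nat (2 * (n + c) + 1) ^ ?d) < int (2 * nat (2 * n + 1) ^ ?d)"
    using * assms n0 by simp
  then have "nat (2 * (n + c) + 1) ^ ?d < 2 * nat (2 * n + 1) ^ ?d"
    by (simp only: of_nat_less_iff)
  then show ?thesis using that[of n] n0 assms card_box[where 'i = 'i] by simp
qed

lemma finite_subset_box:
  assumes "finite (A :: (int ^ 'i::finite) set)"
  obtains c where "c \<ge> 0" "A \<subseteq> box c"
proof -
  define c where "c = (\<Sum>m\<in>A. \<Sum>i\<in>UNIV. \<bar>m $ i\<bar>)"
  have "\<bar>m $ i\<bar> \<le> c" if "m \<in> A" for m i
  proof -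
    have "\<bar>m $ i\<bar> \<le> (\<Sum>i\<in>UNIV. \<bar>m $ i\<bar>)" by (rule member_le_sum) auto
    also have "\<dots> \<le> c" unfolding c_def
      by (rule member_le_sum[of m A "\<lambda>m. \<Sum>i\<in>UNIV. \<bar>m $ i\<bar>"]) (use that assms in \<open>auto intro: sum_nonneg\<close>)
    finally show ?thesis .
  qed
  moreover have "c \<ge> 0" by (auto simp: c_def intro!: sum_nonneg)
  ultimately show ?thesis using that[of c] by (auto simp: box_def)
qed

text \<open>Additivity is demanded only for exponents in (1/d)Z, since \<open>quantum_v\<close>
  rounds all others down.\<close>

locale qbase =
  fixes v :: "rat \<Rightarrow> 'k::idom" and d :: int
  assumes v_zero: "v 0 = 1"
    and v_add: "\<And>q r. q * of_int d \<in> \<int> \<Longrightarrow> r * of_int d \<in> \<int> \<Longrightarrow> v (q + r) = v q * v r"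

lemma (in qbase) v_nonzero:
  assumes "q * of_int d \<in> \<int>" shows "v q \<noteq> 0"
proof -
  have "(- q) * of_int d \<in> \<int>" using assms by simp
  then have "v q * v (- q) = 1" using v_add[OF assms, of "- q"] v_zero by simp
  then show ?thesis by auto
qed

locale qtorus = qbase v d for v :: "rat \<Rightarrow> 'k::idom" and d :: int +
  fixes \<beta> :: "int ^ 'i::finite \<Rightarrow> int ^ 'i \<Rightarrow> rat"
  assumes \<beta>_add_left: "\<And>m m' n. \<beta> (m + m') n = \<beta> m n + \<beta> m' n"
    and \<beta>_skew: "\<And>m n. \<beta> m n = - \<beta> n m"
    and \<beta>_integral: "\<And>m n. \<beta> m n * of_int d \<in> \<int>"
begin

lemma \<beta>_add_right: "\<beta> m (n + n') = \<beta> m n + \<beta> m n'"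
  by (metis \<beta>_add_left \<beta>_skew minus_add_distrib)

lemma \<beta>_zero [simp]: "\<beta> 0 n = 0" "\<beta> n 0 = 0"
  using \<beta>_add_left[of 0 0 n] \<beta>_add_right[of n 0 0] by simp_all

lemma \<beta>_uminus: "\<beta> (- m) n = - \<beta> m n" "\<beta> m (- n) = - \<beta> m n"
  using \<beta>_add_left[of m "- m" n] \<beta>_add_right[of m n "- n"] by simp_all

lemma \<beta>_self [simp]: "\<beta> m m = 0"
  using \<beta>_skew[of m m] by simp

lemma v_\<beta>_add: "v (\<beta> m n + \<beta> m' n') = v (\<beta> m n) * v (\<beta> m' n')"
  by (simp add: v_add \<beta>_integral)

abbreviation tm (infixl \<open>\<star>\<close> 70) where "tm \<equiv> twisted_mult v \<beta>"
abbreviation "QT \<equiv> quantum_torus v \<beta>"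

lemma tm_superset:
  assumes "finite A" "finite B" "Poly_Mapping.keys p \<subseteq> A" "Poly_Mapping.keys q \<subseteq> B"
  shows "p \<star> q = (\<Sum>m\<in>A. \<Sum>n\<in>B.
     Poly_Mapping.single (m + n) (v (\<beta> m n) * Poly_Mapping.lookup p m * Poly_Mapping.lookup q n))"
proof -
  have "p \<star> q = (\<Sum>m\<in>A. \<Sum>n\<in>Poly_Mapping.keys q.
     Poly_Mapping.single (m + n) (v (\<beta> m n) * Poly_Mapping.lookup p m * Poly_Mapping.lookup q n))"
    unfolding twisted_mult_def
    by (rule sum.mono_neutral_left) (use assms in \<open>auto simp: in_keys_iff\<close>)
  also have "\<dots> = (\<Sum>m\<in>A. \<Sum>n\<in>B.
     Poly_Mapping.single (m + n) (v (\<beta> m n) * Poly_Mapping.lookup p m * Poly_Mapping.lookup q n))"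
    by (intro sum.cong refl sum.mono_neutral_left) (use assms in \<open>auto simp: in_keys_iff\<close>)
  finally show ?thesis .
qed

lemma tm_single [simp]:
  "Poly_Mapping.single m a \<star> Poly_Mapping.single n b = Poly_Mapping.single (m + n) (v (\<beta> m n) * a * b)"
  by (subst tm_superset[of "{m}" "{n}"]) auto

lemma tm_add_left [simp]: "(p + p') \<star> q = p \<star> q + p' \<star> q"
proof -
  let ?A = "Poly_Mapping.keys p \<union> Poly_Mapping.keys p'"
  have *: "finite ?A" "Poly_Mapping.keys p \<subseteq> ?A" "Poly_Mapping.keys p' \<subseteq> ?A"
    "Poly_Mapping.keys (p + p') \<subseteq> ?A"
    using keys_add[of p p'] by auto
  show ?thesis
    unfolding tm_superset[OF *(1) finite_keys[of q] *(2) order_refl]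
      tm_superset[OF *(1) finite_keys[of q] *(3) order_refl]
      tm_superset[OF *(1) finite_keys[of q] *(4) order_refl]
    by (simp add: lookup_add single_add distrib_left distrib_right sum.distrib)
qed

lemma tm_add_right [simp]: "p \<star> (q + q') = p \<star> q + p \<star> q'"
proof -
  let ?A = "Poly_Mapping.keys q \<union> Poly_Mapping.keys q'"
  have *: "finite ?A" "Poly_Mapping.keys q \<subseteq> ?A" "Poly_Mapping.keys q' \<subseteq> ?A"
    "Poly_Mapping.keys (q + q') \<subseteq> ?A"
    using keys_add[of q q'] by auto
  show ?thesis
    unfolding tm_superset[OF finite_keys[of p] *(1) order_refl *(2)]
      tm_superset[OF finite_keys[of p] *(1) order_refl *(3)]
      tm_superset[OF finite_keys[of p] *(1) order_refl *(4)]
    by (simp add: lookup_add single_add distrib_left distrib_right sum.distrib)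
qed

lemma tm_zero [simp]: "0 \<star> q = 0" "p \<star> 0 = 0"
  by (simp_all add: twisted_mult_def)

lemma tm_sum: "(\<Sum>x\<in>A. f x) \<star> q = (\<Sum>x\<in>A. f x \<star> q)" "p \<star> (\<Sum>x\<in>A. f x) = (\<Sum>x\<in>A. p \<star> f x)"
  by (induction A rule: infinite_finite_induct) auto

lemma tm_assoc: "(p \<star> q) \<star> r = p \<star> (q \<star> r)"
proof (induction p rule: poly_mapping_add_induct)
  case (single m a)
  show ?case
  proof (induction q rule: poly_mapping_add_induct)
    case (single n b)
    show ?case
    proof (induction r rule: poly_mapping_add_induct)
      case (single l c)
      show ?case
        by (simp add: \<beta>_add_left \<beta>_add_right v_\<beta>_add add.assoc mult_ac)
    qed simp_all
  qed simp_all
qed simp_all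

lemma const_tm [simp]: "const c \<star> p = const c * p" and tm_const [simp]: "p \<star> const c = const c * p"
proof (induction p rule: poly_mapping_add_induct)
  case (single m a)
  show "const c \<star> Poly_Mapping.single m a = const c * Poly_Mapping.single m a"
    "Poly_Mapping.single m a \<star> const c = const c * Poly_Mapping.single m a"
    by (simp_all add: v_zero mult_single mult.commute)
qed (simp_all add: distrib_left)

lemma const_mult_tm [simp]: "(const c * p) \<star> q = const c * (p \<star> q)"
  "p \<star> (const c * q) = const c * (p \<star> q)"
  using tm_assoc[of "const c" p q] tm_assoc[of p "const c" q] tm_assoc[of "const c" p q]
  by (simp_all only: const_tm tm_const tm_assoc[of p "const c" q, unfolded const_tm tm_const])

lemma tm_one [simp]: "1 \<star> p = p" "p \<star> 1 = p"
  using const_tm[of 1 p] tm_const[of p 1] by simp_all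

lemma ring_QT: "ring QT"
proof (rule ringI)
  show "abelian_group QT"
    by (rule abelian_groupI)
      (auto simp: quantum_torus_def add.assoc add.commute intro: exI[of _ "- _"] ab_left_minus)
  show "monoid QT"
    by (rule monoidI) (simp_all add: quantum_torus_def tm_assoc)
qed (simp_all add: quantum_torus_def)

lemma keys_tm:
  "Poly_Mapping.keys (p \<star> q) \<subseteq> (\<lambda>(m, n). m + n) ` (Poly_Mapping.keys p \<times> Poly_Mapping.keys q)"
proof
  fix l assume l: "l \<in> Poly_Mapping.keys (p \<star> q)"
  let ?f = "\<lambda>(m, n). (v (\<beta> m n) * Poly_Mapping.lookup p m * Poly_Mapping.lookup q n when m + n = l)"
  have "(\<Sum>x\<in>Poly_Mapping.keys p \<times> Poly_Mapping.keys q. ?f x) \<noteq> 0"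
    unfolding sum.cartesian_product[symmetric]
    using l by (simp add: twisted_mult_def in_keys_iff lookup_sum lookup_single)
  then obtain x where x: "x \<in> Poly_Mapping.keys p \<times> Poly_Mapping.keys q" "?f x \<noteq> 0"
    by (rule sum.not_neutral_contains_not_neutral)
  obtain m n where mn: "x = (m, n)" by (cases x)
  have "l = m + n" using x(2) by (auto simp: mn when_def split: if_splits)
  then show "l \<in> (\<lambda>(m, n). m + n) ` (Poly_Mapping.keys p \<times> Poly_Mapping.keys q)"
    using x(1) mn by (intro image_eqI[of _ _ x]) auto
qed

text \<open>A linear form that is injective on each support acts as a monomial order. The sum of the
  two leading exponents is reached by one pair only, so its coefficient is a nonzero power of v
  times the product of two nonzero leading coefficients.\<close>

lemma tm_nonzero:
  assumes "p \<noteq> 0" "q \<noteq> 0" shows "p \<star> q \<noteq> 0"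
proof -
  let ?A = "Poly_Mapping.keys p" and ?B = "Poly_Mapping.keys q"
  let ?D = "((\<lambda>(m, n). m - n) ` (?A \<times> ?A \<union> ?B \<times> ?B)) - {0}"
  have "finite ?D" by auto
  then obtain h :: "int ^ 'i \<Rightarrow> int" where h: "additive h" "\<And>m. m \<in> ?D \<Longrightarrow> h m \<noteq> 0"
    using generic_form[of ?D] by auto
  interpret additive h by (rule h(1))
  have inj: "m = n" if "(m, n) \<in> ?A \<times> ?A \<union> ?B \<times> ?B" "h m = h n" for m n
  proof (rule ccontr)
    assume "m \<noteq> n"
    moreover have "m - n \<in> (\<lambda>(m, n). m - n) ` (?A \<times> ?A \<union> ?B \<times> ?B)"
      by (rule image_eqI[OF _ that(1)]) simp
    ultimately have "m - n \<in> ?D" by simp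
    from h(2)[OF this] that(2) show False by (simp only: diff)
  qed
  have ne: "?A \<noteq> {}" "?B \<noteq> {}" using assms by auto
  obtain a where a: "a \<in> ?A" "\<And>m. m \<in> ?A \<Longrightarrow> h m \<le> h a"
    using finite_maximum[of ?A h] ne by auto
  obtain b where b: "b \<in> ?B" "\<And>m. m \<in> ?B \<Longrightarrow> h m \<le> h b"
    using finite_maximum[of ?B h] ne by auto
  have uniq: "m = a \<and> n = b" if "m \<in> ?A" "n \<in> ?B" "m + n = a + b" for m n
  proof -
    have "h m + h n = h a + h b" using that(3) by (metis add)
    with a(2)[OF that(1)] b(2)[OF that(2)] have "h m = h a" "h n = h b" by linarith+
    with inj a b that show ?thesis by blast
  qed
  have "Poly_Mapping.lookup (p \<star> q) (a + b) = (\<Sum>m\<in>?A. \<Sum>n\<in>?B.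
      (v (\<beta> m n) * Poly_Mapping.lookup p m * Poly_Mapping.lookup q n when m + n = a + b))"
    by (simp add: twisted_mult_def lookup_sum lookup_single)
  also have "\<dots> = (\<Sum>(m, n)\<in>?A \<times> ?B.
      (v (\<beta> m n) * Poly_Mapping.lookup p m * Poly_Mapping.lookup q n when m + n = a + b))"
    by (simp add: sum.cartesian_product)
  also have "\<dots> = (\<Sum>(m, n)\<in>{(a, b)}.
      (v (\<beta> m n) * Poly_Mapping.lookup p m * Poly_Mapping.lookup q n when m + n = a + b))"
  proof (rule sum.mono_neutral_right)
    show "\<forall>x\<in>?A \<times> ?B - {(a, b)}. (case x of (m, n) \<Rightarrow>
        v (\<beta> m n) * Poly_Mapping.lookup p m * Poly_Mapping.lookup q n when m + n = a + b) = 0"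
    proof
      fix x assume x: "x \<in> ?A \<times> ?B - {(a, b)}"
      obtain m n where mn: "x = (m, n)" by (cases x)
      have "m + n \<noteq> a + b" using uniq[of m n] x mn by blast
      then show "(case x of (m, n) \<Rightarrow>
        v (\<beta> m n) * Poly_Mapping.lookup p m * Poly_Mapping.lookup q n when m + n = a + b) = 0"
        by (simp add: mn)
    qed
  qed (use a(1) b(1) in auto)
  finally have "Poly_Mapping.lookup (p \<star> q) (a + b) =
      v (\<beta> a b) * Poly_Mapping.lookup p a * Poly_Mapping.lookup q b" by simp
  then have "Poly_Mapping.lookup (p \<star> q) (a + b) \<noteq> 0"
    using a(1) b(1) v_nonzero[OF \<beta>_integral] by (simp add: in_keys_iff)
  then show ?thesis by auto
qed

text \<open>Give u and w unknown coefficients on a box of size n. The coefficients of b u - a w are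
  supported on the box of size n + c, and by growth these equations are fewer than the unknowns,
  twice the number of points of the smaller box. A nonzero solution has nonzero w, because w = 0
  gives b u = 0 and hence u = 0.\<close>

lemma tm_right_ore:
  assumes b: "b \<noteq> 0"
  shows "\<exists>u w. w \<noteq> 0 \<and> b \<star> u = a \<star> w"
proof -
  obtain c where c: "c \<ge> 0" "Poly_Mapping.keys a \<union> Poly_Mapping.keys b \<subseteq> box c"
    using finite_subset_box[of "Poly_Mapping.keys a \<union> Poly_Mapping.keys b"] by auto
  obtain n where n: "n \<ge> 0"
      "card (box (n + c) :: (int ^ 'i) set) < 2 * card (box n :: (int ^ 'i) set)"
    using box_growth[OF c(1)] by metis
  let ?F = "box n :: (int ^ 'i) set" and ?E = "box (n + c) :: (int ^ 'i) set"
  \<comment> \<open>The Boolean labels the unknowns: \<open>True\<close> for the coefficients of u,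
    \<open>False\<close> for those of w. The signs are those of b u - a w.\<close>
  define C where "C e mt = (if snd mt then Poly_Mapping.lookup (b \<star> monomial (fst mt)) e
      else - Poly_Mapping.lookup (a \<star> monomial (fst mt)) e)" for e and mt :: "(int ^ 'i) \<times> bool"
  have "card ?E < card (?F \<times> (UNIV :: bool set))"
    using n by (simp add: card_cartesian_product mult.commute)
  then obtain x where x: "\<exists>u\<in>?F \<times> UNIV. x u \<noteq> 0"
      "\<And>e. e \<in> ?E \<Longrightarrow> (\<Sum>u\<in>?F \<times> UNIV. C e u * x u) = 0"
    using homogeneous_system_solvable[of ?E "?F \<times> UNIV" C] by auto
  define U where "U t = (\<Sum>m\<in>?F. Poly_Mapping.single m (x (m, t)))" for t
  have U: "Poly_Mapping.lookup (U t) m = (if m \<in> ?F then x (m, t) else 0)" for t m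
    by (simp add: U_def lookup_sum lookup_single when_def)
  have tU: "Poly_Mapping.lookup (p \<star> U t) e = (\<Sum>m\<in>?F. Poly_Mapping.lookup (p \<star> monomial m) e * x (m, t))" for p t e
  proof -
    have "p \<star> U t = (\<Sum>m\<in>?F. const (x (m, t)) * (p \<star> monomial m))"
      unfolding U_def tm_sum by (intro sum.cong refl) (simp add: mult_single flip: const_mult_tm(2))
    then show ?thesis by (simp add: lookup_sum mult.commute)
  qed
  have "Poly_Mapping.lookup (b \<star> U True) e = Poly_Mapping.lookup (a \<star> U False) e" for e
  proof (cases "e \<in> ?E")
    case True
    have "(\<Sum>u\<in>?F \<times> UNIV. C e u * x u) = (\<Sum>m\<in>?F. \<Sum>t\<in>UNIV. C e (m, t) * x (m, t))"
      by (simp add: sum.cartesian_product)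
    also have "\<dots> = Poly_Mapping.lookup (b \<star> U True) e - Poly_Mapping.lookup (a \<star> U False) e"
      by (simp add: UNIV_bool C_def tU sum_subtractf)
    finally show ?thesis using x(2)[OF True] by simp
  next
    case False
    have "Poly_Mapping.lookup (p \<star> monomial m) e = 0"
      if "m \<in> ?F" "Poly_Mapping.keys p \<subseteq> box c" for p m
    proof (rule ccontr)
      assume "Poly_Mapping.lookup (p \<star> monomial m) e \<noteq> 0"
      then obtain l where l: "l \<in> Poly_Mapping.keys p" "e = l + m"
        using keys_tm[of p "monomial m"] by (auto simp: in_keys_iff split: if_splits)
      have "\<bar>l $ i + m $ i\<bar> \<le> n + c" for i
      proof -
        have "\<bar>l $ i\<bar> \<le> c" "\<bar>m $ i\<bar> \<le> n" using that l by (auto simp: box_def)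
        then show ?thesis by linarith
      qed
      with False l show False by (simp add: box_def)
    qed
    then show ?thesis using c(2) by (simp add: tU)
  qed
  then have eq: "b \<star> U True = a \<star> U False" by (rule poly_mapping_eqI)
  have "U False \<noteq> 0"
  proof
    assume F: "U False = 0"
    then have "U True = 0" using eq tm_nonzero[OF b] by auto
    obtain m t where "m \<in> ?F" "x (m, t) \<noteq> 0" using x(1) by auto
    then have "Poly_Mapping.lookup (U t) m \<noteq> 0" by (simp add: U)
    then show False using F \<open>U True = 0\<close> by (cases t) auto
  qed
  with eq show ?thesis by blast
qed

lemma ore_domain_QT: "ore_domain QT"
proof -
  interpret ring QT by (rule ring_QT)
  show ?thesis
  proof unfold_locales
    show "\<one>\<^bsub>QT\<^esub> \<noteq> \<zero>\<^bsub>QT\<^esub>"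
      by (simp add: quantum_torus_def)
  qed (use tm_nonzero tm_right_ore in \<open>auto simp: quantum_torus_def\<close>)
qed

end

section \<open>Quantum binomial coefficients\<close>

text \<open>This recursion provides the exact quotients on which \<open>qbinom\<close> relies.\<close>

fun qb :: "(rat \<Rightarrow> 'k::idom) \<Rightarrow> rat \<Rightarrow> nat \<Rightarrow> nat \<Rightarrow> 'k" where
  "qb v e 0 s = (if s = 0 then 1 else 0)"
| "qb v e (Suc a) s = v (of_int (int s) * e) * qb v e a s +
     (if s = 0 then 0 else v (of_int (int s - int a - 1) * e) * qb v e a (s - 1))"

lemma qb_eq_0: "a < s \<Longrightarrow> qb v e a s = 0"
  by (induction a arbitrary: s) auto

text \<open>The alternative matches the case split in \<open>qbinom\<close>: either v^e = 1, with
  ordinary binomials, or no quantum integer [n] with n >= 1 vanishes, so that the quotients by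
  quantum factorials are unique.\<close>

locale qexp = qbase v d for v :: "rat \<Rightarrow> 'k::idom" and d :: int +
  fixes e :: rat
  assumes e_integral: "e * of_int d \<in> \<int>"
    and e_generic: "v e = 1 \<or> (\<forall>n\<ge>1. v (of_nat n * e) \<noteq> v (- (of_nat n * e)))"
begin

definition W :: "int \<Rightarrow> 'k" where "W j = v (of_int j * e)"

lemma W_integral: "of_int j * e * of_int d \<in> \<int>"
  using Ints_mult[OF Ints_of_int e_integral, of j] by (simp add: mult.assoc)

lemma W_add: "W (i + j) = W i * W j"
  unfolding W_def using v_add[OF W_integral[of i] W_integral[of j]] by (simp add: distrib_right)

lemma W_zero [simp]: "W 0 = 1"
  by (simp add: W_def v_zero)

lemma W_one: "v e = W 1" "v (- e) = W (- 1)" "v (of_nat n * e) = W (int n)" "v (- (of_nat n * e)) = W (- int n)"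
  by (simp_all add: W_def)

lemma qb_0 [simp]: "qb v e a 0 = 1"
  by (induction a) (simp_all add: v_zero)

lemma qb_Suc_W: "qb v e (Suc a) s =
    W (int s) * qb v e a s + (if s = 0 then 0 else W (int s - int a - 1) * qb v e a (s - 1))"
  by (simp add: W_def)

declare qb.simps(2) [simp del]

lemma qb_degenerate:
  assumes "v e = 1" shows "qb v e a s = of_nat (a choose s)"
proof -
  have n: "W (int n) = 1" for n
    by (induction n) (use assms in \<open>simp_all add: W_add W_one\<close>)
  have m: "W (- int n) = 1" for n
    using W_add[of "int n" "- int n"] n by simp
  have W1: "W j = 1" for j
    using n m by (cases j rule: int_cases2) auto
  show ?thesis
  proof (induction a arbitrary: s)
    case (Suc a)
    then show ?case by (cases s) (simp_all add: qb_Suc_W W1 add.commute)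
  next
    case 0
    show ?case by (cases s) simp_all
  qed
qed

context
  assumes nd: "v e \<noteq> 1"
begin

lemma W_distinct: "n \<ge> 1 \<Longrightarrow> W (int n) \<noteq> W (- int n)"
  using e_generic nd by (simp add: W_one)

text \<open>The recursion [n+1] = q [n] + q^-n stays inside the base ring, so no division is
  performed.\<close>

lemma qint_exists: "\<exists>x. x * (W 1 - W (- 1)) = W (int n) - W (- int n)"
proof (induction n)
  case (Suc n)
  then obtain x where x: "x * (W 1 - W (- 1)) = W (int n) - W (- int n)" by blast
  have "(W 1 * x + W (- int n)) * (W 1 - W (- 1)) = W 1 * (x * (W 1 - W (- 1))) + W (- int n) * (W 1 - W (- 1))"
    by (simp add: algebra_simps)
  also have "\<dots> = W (1 + int n) - W (1 + - int n) + (W (- int n + 1) - W (- int n + - 1))"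
    unfolding x W_add by (simp only: right_diff_distrib mult.commute)
  also have "\<dots> = W (int (Suc n)) - W (- int (Suc n))" by (simp add: algebra_simps)
  finally show ?case by blast
qed (intro exI[of _ 0], simp)

lemma qint_eq: "qint v e n * (W 1 - W (- 1)) = W (int n) - W (- int n)"
proof -
  have ne: "W 1 - W (- 1) \<noteq> 0" using W_distinct[of 1] by simp
  obtain x where x: "x * (W 1 - W (- 1)) = W (int n) - W (- int n)" using qint_exists by blast
  have "qint v e n = x" unfolding qint_def W_one
    by (rule the_equality, rule x) (use x ne in \<open>metis mult_right_cancel\<close>)
  then show ?thesis using x by simp
qed

lemma qint_unique: "x * (W 1 - W (- 1)) = W (int n) - W (- int n) \<Longrightarrow> x = qint v e n"
  using qint_eq[of n] W_distinct[of 1] by (metis mult_right_cancel eq_iff_diff_eq_0 le_refl of_nat_1)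

lemma qint_nonzero: "n \<ge> 1 \<Longrightarrow> qint v e n \<noteq> 0"
  using qint_eq[of n] W_distinct[of n] by auto

lemma qint_0 [simp]: "qint v e 0 = 0"
  using qint_unique[of 0 0] by simp

lemma qfact_Suc: "qfact v e (Suc n) = qfact v e n * qint v e (Suc n)"
  by (simp add: qfact_def prod.atLeast_Suc_atMost_Suc_shift)

lemma qfact_0 [simp]: "qfact v e 0 = 1"
  by (simp add: qfact_def)

lemma qfact_nonzero: "qfact v e n \<noteq> 0"
  by (induction n) (simp_all add: qfact_Suc qint_nonzero)

text \<open>The quantum Pascal rule after cancelling common factorials; it is what makes the
  recursion of \<open>qb\<close> produce factorial quotients.\<close>

lemma qint_pascal:
  assumes "s \<le> Suc a"
  shows "W (int s) * qint v e (Suc a - s) + W (int s - int a - 1) * qint v e s = qint v e (Suc a)"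
proof (rule qint_unique)
  have i: "int (Suc a - s) = 1 + int a - int s" using assms by simp
  have "(W (int s) * qint v e (Suc a - s) + W (int s - int a - 1) * qint v e s) * (W 1 - W (- 1)) =
      W (int s) * (qint v e (Suc a - s) * (W 1 - W (- 1))) +
      W (int s - int a - 1) * (qint v e s * (W 1 - W (- 1)))"
    by (simp add: algebra_simps)
  also have "\<dots> = W (int s + (1 + int a - int s)) - W (int s + - (1 + int a - int s)) +
      (W ((int s - int a - 1) + int s) - W ((int s - int a - 1) + - int s))"
    unfolding qint_eq i W_add by (simp add: right_diff_distrib)
  also have "\<dots> = W (int (Suc a)) - W (- int (Suc a))" by (simp add: algebra_simps)
  finally show "(W (int s) * qint v e (Suc a - s) + W (int s - int a - 1) * qint v e s) *
    (W 1 - W (- 1)) = W (int (Suc a)) - W (- int (Suc a))" .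
qed

lemma qb_qfact: "s \<le> a \<Longrightarrow> qb v e a s * (qfact v e s * qfact v e (a - s)) = qfact v e a"
proof (induction a arbitrary: s)
  case (Suc a)
  show ?case
  proof (cases s)
    case (Suc r)
    have r: "r \<le> a" "a - r = Suc a - s" using Suc.prems Suc by auto
    have 1: "qb v e a s * (qfact v e s * qfact v e (Suc a - s)) = qfact v e a * qint v e (Suc a - s)"
    proof (cases "s \<le> a")
      case True
      then have "qfact v e (Suc a - s) = qfact v e (a - s) * qint v e (Suc a - s)"
        by (simp add: Suc_diff_le qfact_Suc)
      then show ?thesis using Suc.IH[OF True] by (metis mult.assoc)
    next
      \<comment> \<open>At s = a + 1 both sides vanish: \<open>qb\<close> is zero beyond its range,
        and [0] = 0 on the right.\<close>
      case False
      then have "s = Suc a" using Suc.prems by simp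
      then show ?thesis by (simp add: qb_eq_0)
    qed
    have 2: "qb v e a r * (qfact v e s * qfact v e (Suc a - s)) = qfact v e a * qint v e s"
      using Suc.IH[OF r(1)] unfolding Suc qfact_Suc r(2)[symmetric, unfolded Suc]
      by (simp add: mult_ac)
    have "qb v e (Suc a) s * (qfact v e s * qfact v e (Suc a - s)) =
        W (int s) * (qb v e a s * (qfact v e s * qfact v e (Suc a - s))) +
        W (int s - int a - 1) * (qb v e a r * (qfact v e s * qfact v e (Suc a - s)))"
      using Suc by (simp add: qb_Suc_W algebra_simps)
    also have "\<dots> = qfact v e a *
        (W (int s) * qint v e (Suc a - s) + W (int s - int a - 1) * qint v e s)"
      unfolding 1 2 by (simp add: algebra_simps)
    also have "\<dots> = qfact v e (Suc a)" unfolding qint_pascal[OF Suc.prems] qfact_Suc ..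
    finally show ?thesis .
  qed simp
qed simp

end

lemma qbinom_eq_qb:
  assumes "s \<le> a" shows "qbinom v e a s = qb v e a s"
proof (cases "v e = 1")
  case False
  have ne: "qfact v e s * qfact v e (a - s) \<noteq> 0" using qfact_nonzero[OF False] by simp
  have "(THE x. x * (qfact v e s * qfact v e (a - s)) = qfact v e a) = qb v e a s"
  proof (rule the_equality)
    fix x assume "x * (qfact v e s * qfact v e (a - s)) = qfact v e a"
    then show "x = qb v e a s" using qb_qfact[OF False assms] ne by (metis mult_right_cancel)
  qed (rule qb_qfact[OF False assms])
  with False show ?thesis by (simp add: qbinom_def)
qed (simp add: qbinom_def qb_degenerate)

text \<open>Both sides solve the same equation with quantum factorials. The symmetry is what makes a
  double mutation trivial.\<close>

lemma qb_symmetric: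
  assumes "s \<le> a" shows "qb v e a (a - s) = qb v e a s"
proof (cases "v e = 1")
  case True
  then show ?thesis using assms by (simp add: qb_degenerate binomial_symmetric[symmetric])
next
  case False
  have ne: "qfact v e s * qfact v e (a - s) \<noteq> 0" using qfact_nonzero[OF False] by simp
  have "qb v e a (a - s) * (qfact v e s * qfact v e (a - s)) = qfact v e a"
    using qb_qfact[OF False, of "a - s" a] assms by (simp add: mult.commute)
  then show ?thesis using qb_qfact[OF False assms] ne by (metis mult_right_cancel)
qed

end

lemma ring_hom_inverse_unique:
  assumes "monoid A" "monoid B" "\<phi> \<in> ring_hom A B" "\<psi> \<in> ring_hom A B"
    and x: "x \<in> carrier A" and y: "y \<in> carrier A" and "x \<otimes>\<^bsub>A\<^esub> y = \<one>\<^bsub>A\<^esub>" "y \<otimes>\<^bsub>A\<^esub> x = \<one>\<^bsub>A\<^esub>"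
    and eq: "\<phi> x = \<psi> x"
  shows "\<phi> y = \<psi> y"
proof -
  interpret B: monoid B by fact
  note h = ring_hom_closed[OF assms(3)] ring_hom_closed[OF assms(4)]
  have 1: "\<psi> x \<otimes>\<^bsub>B\<^esub> \<psi> y = \<one>\<^bsub>B\<^esub>" "\<phi> y \<otimes>\<^bsub>B\<^esub> \<phi> x = \<one>\<^bsub>B\<^esub>"
    using ring_hom_mult[OF assms(4) x y] ring_hom_mult[OF assms(3) y x]
    by (simp_all add: assms(7,8) ring_hom_one[OF assms(3)] ring_hom_one[OF assms(4)])
  have "\<phi> y = \<phi> y \<otimes>\<^bsub>B\<^esub> (\<psi> x \<otimes>\<^bsub>B\<^esub> \<psi> y)" unfolding 1 using h[OF y] by simp
  also have "\<dots> = (\<phi> y \<otimes>\<^bsub>B\<^esub> \<phi> x) \<otimes>\<^bsub>B\<^esub> \<psi> y"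
    using h x y eq by (simp add: B.m_assoc)
  also have "\<dots> = \<psi> y"
    unfolding 1 using h[OF y] by simp
  finally show ?thesis .
qed

lemma lattice_induct [case_names basis add uminus]:
  fixes m :: "int ^ 'i::finite"
  assumes b: "\<And>i. P (basis i)" and a: "\<And>m n. P m \<Longrightarrow> P n \<Longrightarrow> P (m + n)"
    and u: "\<And>m. P m \<Longrightarrow> P (- m)"
  shows "P m"
proof -
  \<comment> \<open>\<open>undefined\<close> stands for an arbitrary index; zero is a basis vector
    plus its negative.\<close>
  have z: "P 0" using a[OF b u[OF b], of undefined undefined] by simp
  have nat: "P (int n *s basis i)" for n i
  proof (induction n)
    case (Suc n)
    have "int (Suc n) *s basis i = int n *s basis i + (basis i :: int ^ 'i)"
      by (simp add: vec_eq_iff axis_def distrib_right)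
    with a[OF Suc b] show ?case by simp
  qed (simp add: z)
  have int: "P (k *s basis i)" for k i
  proof (cases k rule: int_cases2)
    case (nonpos n)
    have "k *s basis i = - (int n *s (basis i :: int ^ 'i))" by (simp add: nonpos vec_eq_iff)
    with u[OF nat] show ?thesis by simp
  qed (simp add: nat)
  have "P (\<Sum>i\<in>A. m $ i *s basis i)" if "finite A" for A
    using that by (induction A) (simp_all add: z a int)
  from this[of UNIV] show ?thesis by (simp add: basis_expansion)
qed

context qtorus
begin

lemma QT_simps: "carrier QT = UNIV" "monoid.mult QT = tm" "one QT = 1" "zero QT = 0" "add QT = (+)"
  by (simp_all add: quantum_torus_def)

interpretation R: ore_domain QT by (rule ore_domain_QT)

lemma to_frac_in [simp]: "to_frac QT p \<in> carrier (Frac QT)"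
  using R.to_frac_closed by (simp add: QT_simps)

lemma to_frac_tm: "to_frac QT (p \<star> q) = to_frac QT p \<otimes>\<^bsub>Frac QT\<^esub> to_frac QT q"
  using R.to_frac_mult[of p q] by (simp add: QT_simps)

lemma to_frac_plus: "to_frac QT (p + q) = to_frac QT p \<oplus>\<^bsub>Frac QT\<^esub> to_frac QT q"
  using R.to_frac_add[of p q] by (simp add: QT_simps)

lemma to_frac_eq_iff: "to_frac QT p = to_frac QT q \<longleftrightarrow> p = q"
  using R.to_frac_inj by (simp add: QT_simps inj_on_eq_iff)

lemma to_frac_1: "to_frac QT 1 = \<one>\<^bsub>Frac QT\<^esub>"
  using R.to_frac_one by (simp add: QT_simps)

lemma to_frac_0: "to_frac QT 0 = \<zero>\<^bsub>Frac QT\<^esub>"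
  using R.to_frac_zero by (simp add: QT_simps)

lemma to_frac_single:
  "to_frac QT (Poly_Mapping.single m c) = to_frac QT (const c) \<otimes>\<^bsub>Frac QT\<^esub> to_frac QT (monomial m)"
  by (simp add: mult_single v_zero flip: to_frac_tm)

lemma monomial_add:
  "monomial (m + n) = const (v (- \<beta> m n)) \<star> (monomial m \<star> monomial n)"
proof -
  have "v (- \<beta> m n) * v (\<beta> m n) = 1"
    using v_\<beta>_add[of n m m n] \<beta>_skew[of n m] v_zero by simp
  then show ?thesis by (simp add: mult_single v_zero)
qed

lemma monomial_inverse: "monomial m \<star> monomial (- m) = 1" "monomial (- m) \<star> monomial m = 1"
  by (simp_all add: \<beta>_uminus v_zero)

lemma frac_monomial_inverse:
  "to_frac QT (monomial m) \<otimes>\<^bsub>Frac QT\<^esub> to_frac QT (monomial (- m)) = \<one>\<^bsub>Frac QT\<^esub>"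
  "to_frac QT (monomial (- m)) \<otimes>\<^bsub>Frac QT\<^esub> to_frac QT (monomial m) = \<one>\<^bsub>Frac QT\<^esub>"
  by (simp_all only: monomial_inverse to_frac_1 flip: to_frac_tm)

text \<open>The disjunction fits mutations, whose value is explicit at a variable or at its inverse
  depending on the sign of the level. Either one suffices, because homomorphisms respect inverses
  and constants and variables generate the torus.\<close>

lemma frac_torus_hom_eqI:
  assumes R': "ore_domain R'"
    and \<phi>: "\<phi> \<in> ring_hom (Frac QT) (Frac R')" and \<psi>: "\<psi> \<in> ring_hom (Frac QT) (Frac R')"
    and c: "\<And>c. \<phi> (to_frac QT (const c)) = \<psi> (to_frac QT (const c))"
    and b: "\<And>i. \<phi> (to_frac QT (monomial (basis i))) = \<psi> (to_frac QT (monomial (basis i))) \<or>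
      \<phi> (to_frac QT (monomial (- basis i))) = \<psi> (to_frac QT (monomial (- basis i)))"
    and x: "x \<in> carrier (Frac QT)"
  shows "\<phi> x = \<psi> x"
proof -
  have inv: "\<phi> (to_frac QT (monomial (- m))) = \<psi> (to_frac QT (monomial (- m)))"
    if "\<phi> (to_frac QT (monomial m)) = \<psi> (to_frac QT (monomial m))" for m
    by (rule ring_hom_inverse_unique[OF R.monoid_Frac ore_domain.monoid_Frac[OF R'] \<phi> \<psi> _ _
          frac_monomial_inverse that]) auto
  have mon: "\<phi> (to_frac QT (monomial m)) = \<psi> (to_frac QT (monomial m))" for m
  proof (induction m rule: lattice_induct)
    case (basis i)
    then show ?case using b[of i] inv[of "- basis i"] by auto
  next
    case (add m n)
    then show ?case
      by (simp only: monomial_add to_frac_tm) (simp add: ring_hom_mult[OF \<phi>] ring_hom_mult[OF \<psi>]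
        R.Frac_mult_closed c)
  qed (rule inv)
  have "\<phi> (to_frac QT p) = \<psi> (to_frac QT p)" for p
  proof (induction p rule: poly_mapping_add_induct)
    case zero
    then show ?case using c[of 0] by simp
  next
    case (single m a)
    then show ?case
      by (simp add: to_frac_single[of m a] ring_hom_mult[OF \<phi>] ring_hom_mult[OF \<psi>] c mon)
  next
    case (add p q)
    then show ?case by (simp add: to_frac_plus ring_hom_add[OF \<phi>] ring_hom_add[OF \<psi>])
  qed
  then show ?thesis using frac_hom_eqI[OF ore_domain_QT R' \<phi> \<psi> _ x] by simp
qed

end

section \<open>The automorphism attached to a vector\<close>

lemma additive_int_scale:
  assumes "additive (f :: int ^ 'i \<Rightarrow> 'b::ring_1)"
  shows "f (k *s m) = of_int k * f m"
proof -
  interpret additive f by fact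
  have nat: "f (int n *s m) = of_int (int n) * f m" for n
  proof (induction n)
    case (Suc n)
    have "int (Suc n) *s m = int n *s m + m" by (simp add: vec_eq_iff distrib_right)
    then show ?case using Suc by (simp add: add distrib_right)
  qed (simp add: zero)
  show ?thesis
  proof (cases k rule: int_cases2)
    case (nonpos n)
    have "k *s m = - (int n *s m)" by (simp add: nonpos vec_eq_iff)
    then show ?thesis using nat[of n] by (simp add: minus nonpos)
  qed (use nat in simp)
qed

lemma additive_int_scale_vec:
  assumes "additive (f :: int ^ 'i \<Rightarrow> int ^ 'j)"
  shows "f (k *s m) = k *s f m"
proof (rule vec_eq_iff[THEN iffD2], rule allI)
  fix i
  have "additive (\<lambda>m. f m $ i)" using assms by (simp add: additive_def)
  from additive_int_scale[OF this, of k m] show "f (k *s m) $ i = (k *s f m) $ i" by simp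
qed

text \<open>For l >= 0 this is the quantum form of z^m (1 + z^w)^l, expanded with the commutative
  product. The level l is a separate argument so that an isometry can move m and w while l stays
  fixed.\<close>

definition binomial_image ::
    "(rat \<Rightarrow> 'k::idom) \<Rightarrow> rat \<Rightarrow> int ^ 'i::finite \<Rightarrow> int \<Rightarrow> int ^ 'i \<Rightarrow> (int ^ 'i \<Rightarrow>\<^sub>0 'k)" where
  "binomial_image v e w l m = (\<Sum>s\<le>nat l. Poly_Mapping.single (m + int s *s w) (qb v e (nat l) s))"

locale qmut = qtorus v d \<beta> + qexp v d e
  for v :: "rat \<Rightarrow> 'k::idom" and d :: int and \<beta> :: "int ^ 'i::finite \<Rightarrow> int ^ 'i \<Rightarrow> rat" and e :: rat +
  fixes w :: "int ^ 'i" and lv :: "int ^ 'i \<Rightarrow> int"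
  assumes e_nonzero: "e \<noteq> 0" and w_nonzero: "w \<noteq> 0"
    and \<beta>_w: "\<And>m. \<beta> m w = of_int (lv m) * e"
begin

sublocale R: ore_domain QT by (rule ore_domain_QT)

lemma lv_add: "lv (m + n) = lv m + lv n"
proof -
  have "of_int (lv (m + n)) * e = of_int (lv m + lv n) * e"
    using \<beta>_add_left[of m n w] by (simp add: \<beta>_w distrib_right)
  then have "(of_int (lv (m + n)) :: rat) = of_int (lv m + lv n)" using e_nonzero by simp
  then show ?thesis by (simp only: of_int_eq_iff)
qed

lemma lv_additive: "additive lv"
  by (simp add: additive_def lv_add)

lemma lv_zero [simp]: "lv 0 = 0" and lv_uminus: "lv (- m) = - lv m"
  using lv_additive additive.zero additive.minus by blast+

lemma lv_scale: "lv (k *s m) = k * lv m"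
  using additive_int_scale[OF lv_additive] by simp

lemma lv_w [simp]: "lv w = 0"
  using \<beta>_w[of w] e_nonzero by simp

lemma v_\<beta>_scale: "v (\<beta> m (k *s w)) = W (k * lv m)" "v (\<beta> (k *s w) m) = W (- k * lv m)"
proof -
  have "additive (\<beta> m)" using \<beta>_add_right by (simp add: additive_def)
  from additive_int_scale[OF this, of k w]
  have "\<beta> m (k *s w) = of_int (k * lv m) * e" by (simp add: \<beta>_w)
  then show "v (\<beta> m (k *s w)) = W (k * lv m)" "v (\<beta> (k *s w) m) = W (- k * lv m)"
    using \<beta>_skew[of "k *s w" m] by (simp_all add: W_def)
qed

abbreviation "E \<equiv> binomial_image v e w"

text \<open>\<open>Pol b a\<close> is the product of the factors \<open>1 + q\<^bsup>1-2i-2b\<^esup> x\<close>, \<open>1 \<le> i \<le> a\<close>, where \<open>x = z\<^sup>w\<close> and \<open>q = v\<^sup>e\<close>.\<close>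

definition Pol :: "int \<Rightarrow> nat \<Rightarrow> (int ^ 'i \<Rightarrow>\<^sub>0 'k)" where
  "Pol b a = (\<Sum>s\<le>a. Poly_Mapping.single (int s *s w) (qb v e a s * W (- (int a + 2 * b) * int s)))"

lemma Pol_0 [simp]: "Pol b 0 = 1"
  by (simp add: Pol_def)

text \<open>The factor split off is the one with i = a + 1, whose exponent is 1 - 2 (a + 1) - 2 b.
  Coefficientwise this is the recursion of \<open>qb\<close> with the powers of q
  redistributed.\<close>

lemma Pol_Suc: "Pol b (Suc a) = (1 + Poly_Mapping.single w (W (- 1 - 2 * int a - 2 * b))) \<star> Pol b a"
proof -
  let ?c = "\<lambda>a s. qb v e a s * W (- (int a + 2 * b) * int s)"
  let ?f = "\<lambda>s. Poly_Mapping.single (int s *s w) (?c a s)"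
  let ?g = "\<lambda>s. Poly_Mapping.single (int (Suc s) *s w) (W (- 1 - 2 * int a - 2 * b) * ?c a s)"
  have c: "?c (Suc a) 0 = ?c a 0"
    "?c (Suc a) (Suc s) = ?c a (Suc s) + W (- 1 - 2 * int a - 2 * b) * ?c a s" for s
  proof -
    have W: "W (int (Suc s)) * W (- (int (Suc a) + 2 * b) * int (Suc s)) = W (- (int a + 2 * b) * int (Suc s))"
      "W (int (Suc s) - int a - 1) * W (- (int (Suc a) + 2 * b) * int (Suc s)) =
         W (- 1 - 2 * int a - 2 * b) * W (- (int a + 2 * b) * int s)"
      unfolding W_add[symmetric] by (simp_all add: algebra_simps)
    have "?c (Suc a) (Suc s) = qb v e a (Suc s) * (W (int (Suc s)) * W (- (int (Suc a) + 2 * b) * int (Suc s)))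
       + qb v e a s * (W (int (Suc s) - int a - 1) * W (- (int (Suc a) + 2 * b) * int (Suc s)))"
      unfolding qb_Suc_W by (simp add: distrib_left distrib_right mult_ac)
    then show "?c (Suc a) (Suc s) = ?c a (Suc s) + W (- 1 - 2 * int a - 2 * b) * ?c a s"
      unfolding W by (simp add: mult_ac)
  qed simp
  have g: "Poly_Mapping.single w (W (- 1 - 2 * int a - 2 * b)) \<star> Poly_Mapping.single (int s *s w) x =
      Poly_Mapping.single (int (Suc s) *s w) (W (- 1 - 2 * int a - 2 * b) * x)" for s x
  proof -
    have "w + int s *s w = int (Suc s) *s w" by (simp add: vec_eq_iff distrib_right)
    then show ?thesis using v_\<beta>_scale(1)[of w "int s"] by (simp del: of_nat_Suc)
  qed
  have "Pol b (Suc a) = (\<Sum>s\<le>Suc a. Poly_Mapping.single (int s *s w) (?c (Suc a) s))"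
    by (simp add: Pol_def)
  also have "\<dots> = ?f 0 + (\<Sum>s\<le>a. ?f (Suc s)) + (\<Sum>s\<le>a. ?g s)"
    unfolding sum.atMost_Suc_shift c single_add sum.distrib by (simp add: add.assoc)
  also have "?f 0 + (\<Sum>s\<le>a. ?f (Suc s)) = (\<Sum>s\<le>Suc a. ?f s)"
    unfolding sum.atMost_Suc_shift ..
  also have "\<dots> = (\<Sum>s\<le>a. ?f s)" by (simp add: qb_eq_0)
  also have "(\<Sum>s\<le>a. ?f s) + (\<Sum>s\<le>a. ?g s) =
      (1 + Poly_Mapping.single w (W (- 1 - 2 * int a - 2 * b))) \<star> Pol b a"
    by (simp only: Pol_def tm_add_left tm_one tm_sum g sum.distrib)
  finally show ?thesis .
qed

text \<open>The shift by b turns the factor of index i into that of index i + b, so the two products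
  concatenate.\<close>

lemma Pol_tm_Pol: "Pol (int b) a \<star> Pol 0 b = Pol 0 (a + b)"
proof (induction a)
  case (Suc a)
  have "- 1 - 2 * int a - 2 * int b = - 1 - 2 * int (a + b) - 2 * 0" by simp
  then show ?case using Suc unfolding Pol_Suc tm_assoc by (metis Pol_Suc add_Suc)
qed simp

text \<open>Since x z^n = q^(-2 b) z^n x for b = lv n, moving z^n to the left multiplies every x by
  q^(-2 b), which is the shift built into \<open>Pol b a\<close>.\<close>

lemma Pol_tm_monomial:
  assumes "lv n = b" shows "Pol 0 a \<star> monomial n = monomial n \<star> Pol b a"
proof -
  have "W (- (int a) * int s) * W (- int s * b) = W (int s * b) * W (- (int a + 2 * b) * int s)" for s
    unfolding W_add[symmetric] by (simp add: algebra_simps)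
  then show ?thesis
    by (simp add: Pol_def tm_sum v_\<beta>_scale assms add.commute mult_ac)
qed

lemma binomial_image_eq:
  assumes "lv m \<ge> 0" shows "E (lv m) m = monomial m \<star> Pol 0 (nat (lv m))"
proof -
  have "W (int s * lv m) * W (- lv m * int s) = 1" for s
    unfolding W_add[symmetric] by simp
  then show ?thesis
    using assms by (simp add: binomial_image_def Pol_def tm_sum v_\<beta>_scale mult_ac)
qed

text \<open>The factor \<open>Pol\<close> belonging to m crosses z^n, is shifted by lv n, and then
  joins the factor belonging to n. With both levels nonnegative the numbers of factors add up to lv
  (m + n).\<close>

lemma binomial_image_mult:
  assumes "lv m \<ge> 0" "lv n \<ge> 0"
  shows "E (lv m) m \<star> E (lv n) n = const (v (\<beta> m n)) * E (lv (m + n)) (m + n)"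
proof -
  let ?a = "nat (lv m)" and ?b = "nat (lv n)"
  have "E (lv m) m \<star> E (lv n) n = monomial m \<star> (Pol 0 ?a \<star> monomial n) \<star> Pol 0 ?b"
    using assms by (simp add: binomial_image_eq tm_assoc)
  also have "\<dots> = (monomial m \<star> monomial n) \<star> (Pol (int ?b) ?a \<star> Pol 0 ?b)"
    using Pol_tm_monomial[of n "int ?b" ?a] assms by (simp only: tm_assoc) simp
  also have "\<dots> = (const (v (\<beta> m n)) * monomial (m + n)) \<star> Pol 0 (?a + ?b)"
    unfolding Pol_tm_Pol by (simp add: mult_single)
  also have "\<dots> = const (v (\<beta> m n)) * E (lv (m + n)) (m + n)"
    using assms binomial_image_eq[of "m + n"] by (simp add: lv_add nat_add_distrib)
  finally show ?thesis .
qed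

lemma binomial_image_level_0: "lv m = 0 \<Longrightarrow> E (lv m) m = monomial m"
  by (simp add: binomial_image_def)

text \<open>At exponents of negative level \<open>nat\<close> truncates the level to 0, so z^m is
  fixed there. The map is linear everywhere; multiplicativity is claimed on
  \<open>S\<close>.\<close>

definition \<rho> :: "(int ^ 'i \<Rightarrow>\<^sub>0 'k) \<Rightarrow> (int ^ 'i \<Rightarrow>\<^sub>0 'k)" where
  "\<rho> = lin_ext (\<lambda>m. E (lv m) m)"

definition S :: "(int ^ 'i \<Rightarrow>\<^sub>0 'k) set" where
  "S = {p. \<forall>m\<in>Poly_Mapping.keys p. lv m \<ge> 0}"

lemma \<rho>_single: "\<rho> (Poly_Mapping.single m c) = const c * E (lv m) m"
  by (simp add: \<rho>_def)

lemma \<rho>_add: "\<rho> (p + q) = \<rho> p + \<rho> q" and \<rho>_sum: "\<rho> (\<Sum>x\<in>A. f x) = (\<Sum>x\<in>A. \<rho> (f x))"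
  by (simp_all add: \<rho>_def lin_ext_sum)

lemma \<rho>_mult:
  assumes "p \<in> S" "q \<in> S" shows "\<rho> (p \<star> q) = \<rho> p \<star> \<rho> q"
proof -
  have *: "Poly_Mapping.single (m + n) (v (\<beta> m n) * a * b) = Poly_Mapping.single m a \<star> Poly_Mapping.single n b" for m n a b
    by simp
  have "\<rho> (p \<star> q) = (\<Sum>m\<in>Poly_Mapping.keys p. \<Sum>n\<in>Poly_Mapping.keys q.
      const (v (\<beta> m n) * Poly_Mapping.lookup p m * Poly_Mapping.lookup q n) * E (lv (m + n)) (m + n))"
    by (simp add: twisted_mult_def \<rho>_sum \<rho>_single)
  also have "\<dots> = (\<Sum>m\<in>Poly_Mapping.keys p. \<Sum>n\<in>Poly_Mapping.keys q.
      (const (Poly_Mapping.lookup p m) * E (lv m) m) \<star> (const (Poly_Mapping.lookup q n) * E (lv n) n))"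
  proof (intro sum.cong refl)
    fix m n assume "m \<in> Poly_Mapping.keys p" "n \<in> Poly_Mapping.keys q"
    then have "lv m \<ge> 0" "lv n \<ge> 0" using assms by (auto simp: S_def)
    then show "const (v (\<beta> m n) * Poly_Mapping.lookup p m * Poly_Mapping.lookup q n) * E (lv (m + n)) (m + n) =
      (const (Poly_Mapping.lookup p m) * E (lv m) m) \<star> (const (Poly_Mapping.lookup q n) * E (lv n) n)"
      by (simp only: const_mult_tm binomial_image_mult const_mult_const) (simp only: mult_ac)
  qed
  also have "\<dots> = \<rho> p \<star> \<rho> q"
    unfolding \<rho>_def lin_ext_def tm_sum(1) unfolding tm_sum(2) ..
  finally show ?thesis .
qed

text \<open>\<rho> is triangular: \<open>h\<close> decreases along w, and the terms other than z^m
  lie at m + s w with s > 0. At an exponent of p with maximal \<open>h\<close> the coefficient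
  therefore survives unchanged.\<close>

lemma \<rho>_eq_0:
  assumes "\<rho> p = 0" shows "p = 0"
proof (rule ccontr)
  assume "p \<noteq> 0"
  obtain i where i: "w $ i \<noteq> 0" using w_nonzero by (metis vec_eq_iff zero_index)
  define h where "h m = - (sgn (w $ i) * m $ i)" for m :: "int ^ 'i"
  obtain m0 where m0: "m0 \<in> Poly_Mapping.keys p" "\<And>m. m \<in> Poly_Mapping.keys p \<Longrightarrow> h m \<le> h m0"
    using finite_maximum[of "Poly_Mapping.keys p" h] \<open>p \<noteq> 0\<close> by auto
  have E: "Poly_Mapping.lookup (E (lv m) m) m0 = (if m = m0 then 1 else 0)" if m: "m \<in> Poly_Mapping.keys p" for m
  proof -
    have s: "s = 0" if "m + int s *s w = m0" for s
    proof -
      have "m0 $ i = m $ i + int s * w $ i" using that by auto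
      then have "h m = h m0 + int s * \<bar>w $ i\<bar>"
        by (simp add: h_def distrib_left) (simp add: mult.left_commute abs_sgn mult.commute)
      with m0(2)[OF m] have "int s * \<bar>w $ i\<bar> \<le> 0" by simp
      then show ?thesis using i by (simp add: mult_le_0_iff)
    qed
    have "Poly_Mapping.lookup (E (lv m) m) m0 =
        (\<Sum>s\<le>nat (lv m). (qb v e (nat (lv m)) s when m + int s *s w = m0))"
      by (simp add: binomial_image_def lookup_sum lookup_single)
    also have "\<dots> = (\<Sum>s\<in>{0}. (qb v e (nat (lv m)) s when m + int s *s w = m0))"
      by (rule sum.mono_neutral_right) (use s in \<open>auto simp: when_def\<close>)
    finally show ?thesis by (simp add: when_def)
  qed
  have "Poly_Mapping.lookup (\<rho> p) m0 =
      (\<Sum>m\<in>Poly_Mapping.keys p. Poly_Mapping.lookup p m * (if m = m0 then 1 else 0))"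
    by (simp add: \<rho>_def lin_ext_def lookup_sum E)
  also have "\<dots> = Poly_Mapping.lookup p m0" using m0(1) by (simp add: if_distrib cong: if_cong)
  finally show False using assms m0(1) by (simp add: in_keys_iff)
qed

text \<open>If m0 has positive level, right multiplication by z^(N m0) raises every level by at
  least N, which outweighs the finitely many levels present. If all levels vanish, \<open>S\<close>
  is the whole torus.\<close>

lemma S_large:
  assumes "finite F" shows "\<exists>r\<in>S. r \<noteq> 0 \<and> (\<forall>a\<in>F. a \<star> r \<in> S)"
proof (cases "\<forall>m. lv m = 0")
  case True
  then show ?thesis by (intro bexI[of _ 1]) (auto simp: S_def)
next
  case False
  then obtain m1 where "lv m1 \<noteq> 0" by blast
  then obtain m0 where m0: "lv m0 > 0"
    using that[of m1] that[of "- m1"] by (cases "lv m1 > 0") (auto simp: lv_uminus)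
  define K where "K = (\<Union>a\<in>F. Poly_Mapping.keys a)"
  define N where "N = (\<Sum>m\<in>K. \<bar>lv m\<bar>)"
  have K: "finite K" using assms by (simp add: K_def)
  have N: "N \<ge> 0" "\<And>m. m \<in> K \<Longrightarrow> - lv m \<le> N"
  proof -
    fix m assume "m \<in> K"
    then have "\<bar>lv m\<bar> \<le> N" unfolding N_def using K by (intro member_le_sum) auto
    then show "- lv m \<le> N" by simp
  qed (simp add: N_def sum_nonneg)
  have Nm: "N \<le> N * lv m0" "0 \<le> N * lv m0" using N(1) m0 by (simp_all add: mult_le_cancel_left1)
  show ?thesis
  proof (intro bexI[of _ "monomial (N *s m0)"] conjI ballI)
    fix a assume a: "a \<in> F"
    show "a \<star> monomial (N *s m0) \<in> S" unfolding S_def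
    proof (intro CollectI ballI)
      fix l assume "l \<in> Poly_Mapping.keys (a \<star> monomial (N *s m0))"
      then obtain m where m: "m \<in> Poly_Mapping.keys a" "l = m + N *s m0"
        using keys_tm[of a "monomial (N *s m0)"] by (auto split: if_splits)
      have "- lv m \<le> N" using N(2) m a by (auto simp: K_def)
      then show "lv l \<ge> 0" unfolding m(2) lv_add lv_scale using Nm by linarith
    qed
  next
    show "monomial (N *s m0) \<noteq> (0 :: _ \<Rightarrow>\<^sub>0 'k)"
      by (metis lookup_single_eq lookup_zero one_neq_zero)
  qed (use Nm in \<open>simp add: S_def lv_scale\<close>)
qed

sublocale P: ore_partial_hom QT QT S \<rho>
proof
  fix a b assume ab: "a \<in> S" "b \<in> S"
  show "a \<otimes>\<^bsub>QT\<^esub> b \<in> S" using ab keys_tm[of a b] by (fastforce simp: QT_simps S_def lv_add)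
  show "a \<oplus>\<^bsub>QT\<^esub> b \<in> S" using ab keys_add[of a b] by (auto simp: QT_simps S_def)
  show "\<rho> (a \<otimes>\<^bsub>QT\<^esub> b) = \<rho> a \<otimes>\<^bsub>QT\<^esub> \<rho> b" using \<rho>_mult[OF ab] by (simp add: QT_simps)
next
  show "\<rho> \<one>\<^bsub>QT\<^esub> = \<one>\<^bsub>QT\<^esub>"
    using \<rho>_single[of 0 1] binomial_image_level_0[of 0] by (simp add: QT_simps)
  show "inj_on \<rho> S"
  proof (rule inj_onI)
    fix p q assume "\<rho> p = \<rho> q"
    then have "\<rho> (p - q) = 0" using \<rho>_add[of "p - q" q] by simp
    then show "p = q" using \<rho>_eq_0 by fastforce
  qed
next
  fix F :: "(int ^ 'i \<Rightarrow>\<^sub>0 'k) set" assume "finite F"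
  then show "\<exists>r\<in>S. r \<noteq> \<zero>\<^bsub>QT\<^esub> \<and> (\<forall>a\<in>F. a \<otimes>\<^bsub>QT\<^esub> r \<in> S)"
    using S_large by (simp add: QT_simps)
qed (auto simp: QT_simps S_def \<rho>_add)

abbreviation "\<rho>F \<equiv> frac_map QT QT S \<rho>"

lemma \<rho>F_hom: "\<rho>F \<in> ring_hom (Frac QT) (Frac QT)"
  by (rule P.frac_map_hom)

lemma \<rho>F_to_frac: "p \<in> S \<Longrightarrow> \<rho>F (to_frac QT p) = to_frac QT (\<rho> p)"
  by (rule P.frac_map_to_frac)

lemma \<rho>F_const: "\<rho>F (to_frac QT (const c)) = to_frac QT (const c)"
  using \<rho>F_to_frac[of "const c"] binomial_image_level_0[of 0] by (simp add: S_def \<rho>_single)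

lemma \<rho>F_monomial: "lv m \<ge> 0 \<Longrightarrow> \<rho>F (to_frac QT (monomial m)) = to_frac QT (E (lv m) m)"
  using \<rho>F_to_frac[of "monomial m"] by (simp add: S_def \<rho>_single)

text \<open>All exponents s w have level zero because \<beta> w w = 0, so \<rho> fixes every
  term.\<close>

lemma \<rho>F_Pol: "\<rho>F (to_frac QT (Pol b a)) = to_frac QT (Pol b a)"
proof -
  have l: "lv (int s *s w) = 0" for s by (simp add: lv_scale)
  have "Pol b a \<in> S" unfolding S_def
  proof (intro CollectI ballI)
    fix m assume "m \<in> Poly_Mapping.keys (Pol b a)"
    then have "Poly_Mapping.lookup (Pol b a) m \<noteq> 0" by (simp add: in_keys_iff)
    then have "(\<Sum>s\<le>a. (qb v e a s * W (- (int a + 2 * b) * int s) when int s *s w = m)) \<noteq> 0"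
      by (simp add: Pol_def lookup_sum lookup_single)
    then obtain s where "(qb v e a s * W (- (int a + 2 * b) * int s) when int s *s w = m) \<noteq> 0"
      by (rule sum.not_neutral_contains_not_neutral)
    then have "m = int s *s w" by (simp add: when_def split: if_splits)
    then show "lv m \<ge> 0" by (simp add: l)
  qed
  moreover have "\<rho> (Pol b a) = Pol b a"
    using binomial_image_level_0[OF l] by (simp add: Pol_def \<rho>_sum \<rho>_single mult_single l)
  ultimately show ?thesis using \<rho>F_to_frac by simp
qed

lemma Pol_nonzero: "Pol b a \<noteq> 0"
proof (induction a)
  case (Suc a)
  have "Poly_Mapping.lookup (1 + Poly_Mapping.single w (W (- 1 - 2 * int a - 2 * b))) 0 = 1"
    using w_nonzero by (simp add: lookup_add lookup_single when_def flip: single_one)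
  then have "1 + Poly_Mapping.single w (W (- 1 - 2 * int a - 2 * b)) \<noteq> 0" by auto
  then show ?case unfolding Pol_Suc using Suc by (rule tm_nonzero)
qed simp

text \<open>For lv m >= 0 the map sends z^m to z^m P with P itself fixed, so z^m P^-1 is a preimage
  of z^m. Negative levels follow by inversion.\<close>

lemma \<rho>F_surj_to_frac: "to_frac QT p \<in> \<rho>F ` carrier (Frac QT)"
proof -
  let ?I = "\<rho>F ` carrier (Frac QT)"
  interpret F: monoid "Frac QT" by (rule R.monoid_Frac)
  have mult: "x \<otimes>\<^bsub>Frac QT\<^esub> y \<in> ?I" if xy: "x \<in> ?I" "y \<in> ?I" for x y
  proof -
    obtain x' where x: "x = \<rho>F x'" "x' \<in> carrier (Frac QT)" using xy(1) by (rule imageE)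
    obtain y' where y: "y = \<rho>F y'" "y' \<in> carrier (Frac QT)" using xy(2) by (rule imageE)
    note x' = x(2) y(2)
    have "x \<otimes>\<^bsub>Frac QT\<^esub> y = \<rho>F (x' \<otimes>\<^bsub>Frac QT\<^esub> y')" using ring_hom_mult[OF \<rho>F_hom x'] x(1) y(1) by simp
    then show ?thesis using F.m_closed[OF x'] by (rule image_eqI)
  qed
  have c: "to_frac QT (const c) \<in> ?I" for c
    using \<rho>F_const[of c] by (metis imageI to_frac_in)
  have pos: "to_frac QT (monomial m) \<in> ?I" if m: "lv m \<ge> 0" for m
  proof -
    let ?P = "to_frac QT (Pol 0 (nat (lv m)))"
    have "?P \<noteq> \<zero>\<^bsub>Frac QT\<^esub>" using Pol_nonzero by (simp add: to_frac_eq_iff flip: to_frac_0)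
    then obtain y where y: "y \<in> carrier (Frac QT)" "?P \<otimes>\<^bsub>Frac QT\<^esub> y = \<one>\<^bsub>Frac QT\<^esub>"
      using R.Frac_inverse[OF to_frac_in, of "Pol 0 (nat (lv m))"] by metis
    have Py: "?P \<otimes>\<^bsub>Frac QT\<^esub> \<rho>F y = \<one>\<^bsub>Frac QT\<^esub>"
      using ring_hom_mult[OF \<rho>F_hom to_frac_in y(1), of "Pol 0 (nat (lv m))"]
      by (simp only: y(2) \<rho>F_Pol ring_hom_one[OF \<rho>F_hom])
    have "\<rho>F (to_frac QT (monomial m) \<otimes>\<^bsub>Frac QT\<^esub> y) = (to_frac QT (monomial m) \<otimes>\<^bsub>Frac QT\<^esub> ?P) \<otimes>\<^bsub>Frac QT\<^esub> \<rho>F y"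
      using ring_hom_mult[OF \<rho>F_hom _ y(1)] m by (simp add: \<rho>F_monomial binomial_image_eq to_frac_tm)
    also have "\<dots> = to_frac QT (monomial m)"
      using ring_hom_closed[OF \<rho>F_hom y(1)] Py by (simp add: F.m_assoc)
    finally show ?thesis using y(1) by (metis F.m_closed imageI to_frac_in)
  qed
  have mon: "to_frac QT (monomial m) \<in> ?I" for m
  proof (cases "lv m \<ge> 0")
    case False
    then obtain x where x: "x \<in> carrier (Frac QT)" "\<rho>F x = to_frac QT (monomial (- m))"
      using pos[of "- m"] by (auto simp: lv_uminus)
    have zero: "\<rho>F \<zero>\<^bsub>Frac QT\<^esub> = \<zero>\<^bsub>Frac QT\<^esub>" using \<rho>F_const[of 0] by (simp add: to_frac_0)
    have "monomial (- m) \<noteq> (0 :: _ \<Rightarrow>\<^sub>0 'k)" by (metis lookup_single_eq lookup_zero one_neq_zero)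
    then have "x \<noteq> \<zero>\<^bsub>Frac QT\<^esub>" using x(2) zero by (metis to_frac_0 to_frac_eq_iff)
    then obtain y where y: "y \<in> carrier (Frac QT)" "x \<otimes>\<^bsub>Frac QT\<^esub> y = \<one>\<^bsub>Frac QT\<^esub>"
      using R.Frac_inverse[OF x(1)] by metis
    have 1: "to_frac QT (monomial (- m)) \<otimes>\<^bsub>Frac QT\<^esub> \<rho>F y = \<one>\<^bsub>Frac QT\<^esub>"
      using ring_hom_mult[OF \<rho>F_hom x(1) y(1)] ring_hom_one[OF \<rho>F_hom] y(2) x(2) by simp
    have "\<rho>F y = to_frac QT (monomial m)"
      by (rule F.inv_unique[OF frac_monomial_inverse(1) 1 _ _ ring_hom_closed[OF \<rho>F_hom y(1)], symmetric]) auto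
    then show ?thesis using y(1) by (metis imageI)
  qed (rule pos)
  show ?thesis
  proof (induction p rule: poly_mapping_add_induct)
    case (add p q)
    then obtain x y where xy: "x \<in> carrier (Frac QT)" "y \<in> carrier (Frac QT)"
      and "to_frac QT p = \<rho>F x" "to_frac QT q = \<rho>F y"
      by blast
    then have "to_frac QT (p + q) = \<rho>F (x \<oplus>\<^bsub>Frac QT\<^esub> y)"
      using ring_hom_add[OF \<rho>F_hom xy] by (simp add: to_frac_plus)
    then show ?case using R.Frac_add_closed[OF xy] by (rule image_eqI)
  next
    case zero
    show ?case using c[of 0] by simp
  next
    case (single m a)
    show ?case unfolding to_frac_single[of m a] by (rule mult[OF c mon])
  qed
qed

lemma \<rho>F_iso: "\<rho>F \<in> ring_iso (Frac QT) (Frac QT)"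
proof -
  have zero: "\<rho>F \<zero>\<^bsub>Frac QT\<^esub> = \<zero>\<^bsub>Frac QT\<^esub>" using \<rho>F_const[of 0] by (simp add: to_frac_0)
  have "\<rho>F ` carrier (Frac QT) = carrier (Frac QT)"
    using frac_hom_surjI[OF ore_domain_QT ore_domain_QT \<rho>F_hom zero] \<rho>F_surj_to_frac
      ring_hom_closed[OF \<rho>F_hom] by blast
  then show ?thesis
    using \<rho>F_hom P.frac_map_inj by (simp add: ring_iso_def bij_betw_def)
qed

end

lemma ring_iso_compose:
  "f \<in> ring_iso A B \<Longrightarrow> g \<in> ring_iso B C \<Longrightarrow> g \<circ> f \<in> ring_iso A C"
  by (auto simp: ring_iso_def ring_hom_def bij_betw_trans Pi_iff)

section \<open>Lattice isometries acting on skew fields\<close>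

locale torus_iso = T: qtorus v d \<beta> + T': qtorus v d \<beta>'
  for v :: "rat \<Rightarrow> 'k::idom" and d :: int and \<beta> \<beta>' :: "int ^ 'i::finite \<Rightarrow> int ^ 'i \<Rightarrow> rat" +
  fixes V :: "int ^ 'i \<Rightarrow> int ^ 'i"
  assumes V_additive: "additive V" and V_bij: "bij V"
    and V_isometry: "\<And>m n. \<beta>' (V m) (V n) = \<beta> m n"
begin

lemma monomial_map_mult:
  "monomial_map V (twisted_mult v \<beta> p q) = twisted_mult v \<beta>' (monomial_map V p) (monomial_map V q)"
proof (induction p rule: poly_mapping_add_induct)
  case (single m a)
  show ?case
  proof (induction q rule: poly_mapping_add_induct)
    case (single n b)
    then show ?case by (simp add: V_isometry additive.add[OF V_additive])
  qed (simp_all add: monomial_map_lin_ext)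
qed (simp_all add: monomial_map_lin_ext)

lemma monomial_map_plus: "monomial_map V (p + q) = monomial_map V p + monomial_map V q"
  by (simp add: monomial_map_lin_ext)

lemma monomial_map_one: "monomial_map V 1 = (1 :: _ \<Rightarrow>\<^sub>0 'k)"
  using monomial_map_single[of V 0 1] by (simp add: additive.zero[OF V_additive])

lemma monomial_map_const: "monomial_map V (const c) = (const c :: _ \<Rightarrow>\<^sub>0 'k)"
  by (simp add: additive.zero[OF V_additive])

lemma torus_hom: "torus_hom T.QT T'.QT (monomial_map V)"
proof -
  have "monomial_map V \<in> ring_hom T.QT T'.QT"
    by (rule ring_hom_memI)
      (simp_all add: T.QT_simps T'.QT_simps monomial_map_mult monomial_map_one monomial_map_plus)
  then show ?thesis using monomial_map_const unfolding torus_hom_def by blast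
qed

sublocale P: ore_partial_hom T.QT T'.QT UNIV "monomial_map V"
proof -
  interpret R: ore_domain T.QT by (rule T.ore_domain_QT)
  interpret R': ore_domain T'.QT by (rule T'.ore_domain_QT)
  show "ore_partial_hom T.QT T'.QT UNIV (monomial_map V)"
  proof unfold_locales
    show "inj_on (monomial_map V) (UNIV :: (_ \<Rightarrow>\<^sub>0 'k) set)"
      using bij_is_inj[OF bij_monomial_map[OF V_bij]] .
    show "\<exists>r\<in>UNIV. r \<noteq> \<zero>\<^bsub>T.QT\<^esub> \<and> (\<forall>a\<in>F. a \<otimes>\<^bsub>T.QT\<^esub> r \<in> UNIV)" for F
      by (rule bexI[of _ 1]) (simp_all add: T.QT_simps)
  qed (simp_all add: T.QT_simps T'.QT_simps monomial_map_mult monomial_map_one monomial_map_plus)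
qed

abbreviation "VF \<equiv> frac_map T.QT T'.QT UNIV (monomial_map V)"

lemma VF_to_frac: "VF (to_frac T.QT p) = to_frac T'.QT (monomial_map V p)"
  by (rule P.frac_map_to_frac) simp

lemma VF_iso: "VF \<in> ring_iso (Frac T.QT) (Frac T'.QT)"
proof -
  have zero: "VF \<zero>\<^bsub>Frac T.QT\<^esub> = \<zero>\<^bsub>Frac T'.QT\<^esub>"
    using VF_to_frac[of 0] by (simp add: T.to_frac_0 T'.to_frac_0 monomial_map_lin_ext)
  have sur: "to_frac T'.QT p \<in> VF ` carrier (Frac T.QT)" for p
  proof -
    obtain q where "p = monomial_map V q"
      using bij_is_surj[OF bij_monomial_map[OF V_bij]] by (metis surj_def)
    then show ?thesis using VF_to_frac[of q] by (metis imageI T.to_frac_in)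
  qed
  have "VF ` carrier (Frac T.QT) = carrier (Frac T'.QT)"
    using frac_hom_surjI[OF T.ore_domain_QT T'.ore_domain_QT P.frac_map_hom zero] sur
      ring_hom_closed[OF P.frac_map_hom] by blast
  then show ?thesis
    using P.frac_map_hom P.frac_map_inj by (simp add: ring_iso_def bij_betw_def)
qed

lemma VF_const: "VF (to_frac T.QT (const c)) = to_frac T'.QT (const c)"
  using VF_to_frac[of "const c"] by (simp only: monomial_map_const)

end

definition frac_algebra_iso ::
    "(int ^ 'i::finite \<Rightarrow>\<^sub>0 'k::idom) ring \<Rightarrow> (int ^ 'i \<Rightarrow>\<^sub>0 'k) ring \<Rightarrow>
     (((int ^ 'i \<Rightarrow>\<^sub>0 'k) \<times> (int ^ 'i \<Rightarrow>\<^sub>0 'k)) set \<Rightarrow> ((int ^ 'i \<Rightarrow>\<^sub>0 'k) \<times> (int ^ 'i \<Rightarrow>\<^sub>0 'k)) set) \<Rightarrow> bool" where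
  "frac_algebra_iso R R' \<phi> \<longleftrightarrow> \<phi> \<in> ring_iso (Frac R) (Frac R') \<and>
     (\<forall>c. \<phi> (to_frac R (const c)) = to_frac R' (const c))"

lemma frac_algebra_iso_hom: "frac_algebra_iso R R' \<phi> \<Longrightarrow> \<phi> \<in> ring_hom (Frac R) (Frac R')"
  and frac_algebra_iso_bij: "frac_algebra_iso R R' \<phi> \<Longrightarrow> bij_betw \<phi> (carrier (Frac R)) (carrier (Frac R'))"
  and frac_algebra_iso_const: "frac_algebra_iso R R' \<phi> \<Longrightarrow> \<phi> (to_frac R (const c)) = to_frac R' (const c)"
  by (auto simp: frac_algebra_iso_def ring_iso_def)

lemma frac_algebra_iso_comp:
  "frac_algebra_iso R R' \<phi> \<Longrightarrow> frac_algebra_iso R' R'' \<psi> \<Longrightarrow> frac_algebra_iso R R'' (\<psi> \<circ> \<phi>)"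
  unfolding frac_algebra_iso_def using ring_iso_compose by fastforce

lemma (in torus_iso) frac_algebra_iso: "frac_algebra_iso T.QT T'.QT VF"
  by (simp add: frac_algebra_iso_def VF_iso VF_const)

lemma (in qtorus) frac_algebra_iso_eqI:
  assumes "ore_domain R'" "frac_algebra_iso QT R' \<phi>" "frac_algebra_iso QT R' \<psi>"
    and "\<And>i. \<phi> (to_frac QT (monomial (basis i))) = \<psi> (to_frac QT (monomial (basis i))) \<or>
      \<phi> (to_frac QT (monomial (- basis i))) = \<psi> (to_frac QT (monomial (- basis i)))"
    and "x \<in> carrier (Frac QT)"
  shows "\<phi> x = \<psi> x"
  using frac_torus_hom_eqI[OF assms(1) frac_algebra_iso_hom[OF assms(2)] frac_algebra_iso_hom[OF assms(3)]
      _ assms(4,5)] assms(2,3) by (simp add: frac_algebra_iso_const)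

text \<open>Any explicitly constructed isomorphism with the right values evaluates the definite
  description: uniqueness holds on the skew field because constants and variables determine a
  homomorphism, and outside it by extensionality, which is where the restriction comes from.\<close>

lemma (in qtorus) iso_on_variables_eq:
  assumes R': "ore_domain R'" and \<phi>: "frac_algebra_iso QT R' \<phi>"
    and g: "\<And>i. \<phi> (to_frac QT (monomial (basis i))) = g i"
  shows "iso_on_variables QT R' g = restrict \<phi> (carrier (Frac QT))"
  unfolding iso_on_variables_def
proof (rule the_equality)
  interpret R: ore_domain QT by (rule ore_domain_QT)
  have F: "a \<in> carrier (Frac QT) \<Longrightarrow> b \<in> carrier (Frac QT) \<Longrightarrow> a \<otimes>\<^bsub>Frac QT\<^esub> b \<in> carrier (Frac QT)"
    "a \<in> carrier (Frac QT) \<Longrightarrow> b \<in> carrier (Frac QT) \<Longrightarrow> a \<oplus>\<^bsub>Frac QT\<^esub> b \<in> carrier (Frac QT)"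
    "\<one>\<^bsub>Frac QT\<^esub> \<in> carrier (Frac QT)" for a b
    by (simp_all add: R.Frac_mult_closed R.Frac_add_closed R.Frac_one_closed)
  have "restrict \<phi> (carrier (Frac QT)) \<in> ring_iso (Frac QT) (Frac R')"
    using \<phi> F unfolding frac_algebra_iso_def ring_iso_def ring_hom_def
    by (auto simp: bij_betw_restrict_eq)
  then show "restrict \<phi> (carrier (Frac QT)) \<in> extensional (carrier (Frac QT)) \<and>
      restrict \<phi> (carrier (Frac QT)) \<in> ring_iso (Frac QT) (Frac R') \<and>
      (\<forall>c. restrict \<phi> (carrier (Frac QT)) (to_frac QT (const c)) = to_frac R' (const c)) \<and>
      (\<forall>i. restrict \<phi> (carrier (Frac QT)) (to_frac QT (monomial (basis i))) = g i)"
    using frac_algebra_iso_const[OF \<phi>] g by simp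
next
  fix \<psi> assume \<psi>: "\<psi> \<in> extensional (carrier (Frac QT)) \<and> \<psi> \<in> ring_iso (Frac QT) (Frac R') \<and>
      (\<forall>c. \<psi> (to_frac QT (const c)) = to_frac R' (const c)) \<and>
      (\<forall>i. \<psi> (to_frac QT (monomial (basis i))) = g i)"
  then have "frac_algebra_iso QT R' \<psi>" by (simp add: frac_algebra_iso_def)
  then have "\<psi> x = \<phi> x" if "x \<in> carrier (Frac QT)" for x
    using frac_algebra_iso_eqI[OF R' _ \<phi> _ that] \<psi> g by simp
  then show "\<psi> = restrict \<phi> (carrier (Frac QT))"
    using \<psi> by (intro extensionalityI[of _ "carrier (Frac QT)"]) auto
qed

text \<open>The image of \<open>z\<^sup>m\<close> is prescribed only where it is a Laurent polynomial; this determines \<open>\<mu>\<close>.\<close>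

locale mutation_step = M: qmut v d \<beta> e w lv + I: torus_iso v d \<beta>' \<beta> \<tau>
  for v :: "rat \<Rightarrow> 'k::idom" and d :: int and \<beta> \<beta>' :: "int ^ 'i::finite \<Rightarrow> int ^ 'i \<Rightarrow> rat"
    and e w lv \<tau> +
  fixes \<mu>
  assumes \<mu>_iso: "frac_algebra_iso I.T.QT M.QT \<mu>"
    and \<mu>_monomial: "\<And>m. lv (\<tau> m) \<ge> 0 \<Longrightarrow>
      \<mu> (to_frac I.T.QT (monomial m)) = to_frac M.QT (binomial_image v e w (lv (\<tau> m)) (\<tau> m))"

lemma mutation_step_exists:
  assumes "qmut v d \<beta> e w lv" "torus_iso v d \<beta>' \<beta> \<tau>"
  obtains \<mu> where "mutation_step v d \<beta> \<beta>' e w lv \<tau> \<mu>"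
proof -
  interpret M: qmut v d \<beta> e w lv by fact
  interpret I: torus_iso v d \<beta>' \<beta> \<tau> by fact
  have \<rho>: "frac_algebra_iso M.QT M.QT M.\<rho>F"
    by (simp add: frac_algebra_iso_def M.\<rho>F_iso M.\<rho>F_const)
  have "mutation_step v d \<beta> \<beta>' e w lv \<tau> (M.\<rho>F \<circ> I.VF)"
  proof
    show "frac_algebra_iso I.T.QT M.QT (M.\<rho>F \<circ> I.VF)"
      using frac_algebra_iso_comp[OF I.frac_algebra_iso \<rho>] .
  qed (simp add: I.VF_to_frac M.\<rho>F_monomial)
  then show ?thesis by (rule that)
qed

context mutation_step
begin

lemma monomial_neg:
  assumes "lv (\<tau> m) \<le> 0"
  shows "\<mu> (to_frac I.T.QT (monomial m)) \<otimes>\<^bsub>Frac M.QT\<^esub>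
      to_frac M.QT (binomial_image v e w (- lv (\<tau> m)) (- \<tau> m)) = \<one>\<^bsub>Frac M.QT\<^esub>"
    and "to_frac M.QT (binomial_image v e w (- lv (\<tau> m)) (- \<tau> m)) \<otimes>\<^bsub>Frac M.QT\<^esub>
      \<mu> (to_frac I.T.QT (monomial m)) = \<one>\<^bsub>Frac M.QT\<^esub>"
proof -
  have \<tau>: "\<tau> (- m) = - \<tau> m" using additive.minus[OF I.V_additive] .
  have neg: "\<mu> (to_frac I.T.QT (monomial (- m))) = to_frac M.QT (binomial_image v e w (- lv (\<tau> m)) (- \<tau> m))"
    using \<mu>_monomial[of "- m"] assms by (simp add: \<tau> M.lv_uminus)
  note h = frac_algebra_iso_hom[OF \<mu>_iso]
  show "\<mu> (to_frac I.T.QT (monomial m)) \<otimes>\<^bsub>Frac M.QT\<^esub>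
      to_frac M.QT (binomial_image v e w (- lv (\<tau> m)) (- \<tau> m)) = \<one>\<^bsub>Frac M.QT\<^esub>"
    using ring_hom_mult[OF h I.T.to_frac_in I.T.to_frac_in, of "monomial m" "monomial (- m)"] ring_hom_one[OF h]
    by (simp only: I.T.frac_monomial_inverse neg)
  show "to_frac M.QT (binomial_image v e w (- lv (\<tau> m)) (- \<tau> m)) \<otimes>\<^bsub>Frac M.QT\<^esub>
      \<mu> (to_frac I.T.QT (monomial m)) = \<one>\<^bsub>Frac M.QT\<^esub>"
    using ring_hom_mult[OF h I.T.to_frac_in I.T.to_frac_in, of "monomial (- m)" "monomial m"] ring_hom_one[OF h]
    by (simp only: I.T.frac_monomial_inverse neg)
qed

text \<open>This is the origin of the inverse in the X rule for b_ki > 0: there the variable has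
  negative level, and the Laurent polynomial is the image of its inverse.\<close>

lemma monomial_inv:
  assumes "lv (\<tau> m) \<le> 0"
  shows "\<mu> (to_frac I.T.QT (monomial m)) =
      m_inv (Frac M.QT) (to_frac M.QT (binomial_image v e w (- lv (\<tau> m)) (- \<tau> m)))"
proof -
  interpret F: monoid "Frac M.QT" by (rule M.R.monoid_Frac)
  have "\<mu> (to_frac I.T.QT (monomial m)) \<in> carrier (Frac M.QT)"
    using ring_hom_closed[OF frac_algebra_iso_hom[OF \<mu>_iso]] by simp
  then show ?thesis
    using monomial_neg[OF assms] by (intro F.inv_char[symmetric]) simp_all
qed

lemma \<rho>_iso: "frac_algebra_iso M.QT M.QT M.\<rho>F"
  by (simp add: frac_algebra_iso_def M.\<rho>F_iso M.\<rho>F_const)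

lemma \<mu>_eq:
  assumes x: "x \<in> carrier (Frac I.T.QT)" shows "\<mu> x = M.\<rho>F (I.VF x)"
proof -
  have "\<mu> x = (M.\<rho>F \<circ> I.VF) x"
  proof (rule I.T.frac_algebra_iso_eqI[OF M.R.ore_domain_axioms \<mu>_iso _ _ x])
    show "frac_algebra_iso I.T.QT M.QT (M.\<rho>F \<circ> I.VF)"
      using frac_algebra_iso_comp[OF I.frac_algebra_iso \<rho>_iso] .
    fix i
    have mon: "\<mu> (to_frac I.T.QT (monomial m)) = (M.\<rho>F \<circ> I.VF) (to_frac I.T.QT (monomial m))"
      if "lv (\<tau> m) \<ge> 0" for m
      using that by (simp add: \<mu>_monomial I.VF_to_frac M.\<rho>F_monomial)
    have "lv (\<tau> (basis i)) \<ge> 0 \<or> lv (\<tau> (- basis i)) \<ge> 0"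
      by (auto simp: additive.minus[OF I.V_additive] M.lv_uminus)
    then show "\<mu> (to_frac I.T.QT (monomial (basis i))) = (M.\<rho>F \<circ> I.VF) (to_frac I.T.QT (monomial (basis i))) \<or>
      \<mu> (to_frac I.T.QT (monomial (- basis i))) = (M.\<rho>F \<circ> I.VF) (to_frac I.T.QT (monomial (- basis i)))"
      using mon by blast
  qed
  then show ?thesis by simp
qed

lemma \<mu>_restrict: "mutation_step v d \<beta> \<beta>' e w lv \<tau> (restrict \<mu> (carrier (Frac I.T.QT)))"
proof
  show "frac_algebra_iso I.T.QT M.QT (restrict \<mu> (carrier (Frac I.T.QT)))"
    using \<mu>_iso I.P.R.Frac_mult_closed I.P.R.Frac_add_closed I.P.R.Frac_one_closed
    unfolding frac_algebra_iso_def ring_iso_def ring_hom_def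
    by (auto simp: bij_betw_restrict_eq)
qed (simp add: \<mu>_monomial)

end

lemma mutation_step_natural:
  assumes "mutation_step v d \<beta>\<^sub>1 \<beta>\<^sub>1' e w\<^sub>1 lv\<^sub>1 \<tau>\<^sub>1 \<mu>\<^sub>1" "mutation_step v d \<beta>\<^sub>2 \<beta>\<^sub>2' e w\<^sub>2 lv\<^sub>2 \<tau>\<^sub>2 \<mu>\<^sub>2"
    and V: "torus_iso v d \<beta>\<^sub>1 \<beta>\<^sub>2 V" and V': "torus_iso v d \<beta>\<^sub>1' \<beta>\<^sub>2' V'"
    and w: "V w\<^sub>1 = w\<^sub>2" and \<tau>: "\<And>m. \<tau>\<^sub>2 (V' m) = V (\<tau>\<^sub>1 m)"
    and x: "x \<in> carrier (Frac (quantum_torus v \<beta>\<^sub>1'))"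
  shows "frac_map (quantum_torus v \<beta>\<^sub>1) (quantum_torus v \<beta>\<^sub>2) UNIV (monomial_map V) (\<mu>\<^sub>1 x) =
    \<mu>\<^sub>2 (frac_map (quantum_torus v \<beta>\<^sub>1') (quantum_torus v \<beta>\<^sub>2') UNIV (monomial_map V') x)"
proof -
  interpret S1: mutation_step v d \<beta>\<^sub>1 \<beta>\<^sub>1' e w\<^sub>1 lv\<^sub>1 \<tau>\<^sub>1 \<mu>\<^sub>1 by fact
  interpret S2: mutation_step v d \<beta>\<^sub>2 \<beta>\<^sub>2' e w\<^sub>2 lv\<^sub>2 \<tau>\<^sub>2 \<mu>\<^sub>2 by fact
  interpret V: torus_iso v d \<beta>\<^sub>1 \<beta>\<^sub>2 V by fact
  interpret V': torus_iso v d \<beta>\<^sub>1' \<beta>\<^sub>2' V' by fact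
  have lv: "lv\<^sub>2 (V m) = lv\<^sub>1 m" for m
  proof -
    have "of_int (lv\<^sub>2 (V m)) * e = of_int (lv\<^sub>1 m) * e"
      using V.V_isometry[of m w\<^sub>1] by (simp add: w S1.M.\<beta>_w S2.M.\<beta>_w)
    then show ?thesis using S1.M.e_nonzero by simp
  qed
  have E: "monomial_map V (binomial_image v e w\<^sub>1 l m) = binomial_image v e w\<^sub>2 l (V m)" for l m
    by (simp add: binomial_image_def monomial_map_lin_ext lin_ext_sum mult_single
        additive.add[OF V.V_additive] additive_int_scale_vec[OF V.V_additive] w)
  have mon: "V.VF (\<mu>\<^sub>1 (to_frac S1.I.T.QT (monomial m))) = \<mu>\<^sub>2 (V'.VF (to_frac S1.I.T.QT (monomial m)))"
    if "lv\<^sub>1 (\<tau>\<^sub>1 m) \<ge> 0" for m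
    using S1.\<mu>_monomial[OF that] S2.\<mu>_monomial[of "V' m"] that
    by (simp add: V.VF_to_frac V'.VF_to_frac E \<tau> lv)
  have "(V.VF \<circ> \<mu>\<^sub>1) x = (\<mu>\<^sub>2 \<circ> V'.VF) x"
  proof (rule S1.I.T.frac_algebra_iso_eqI[OF S2.M.R.ore_domain_axioms _ _ _ x])
    show "frac_algebra_iso S1.I.T.QT S2.M.QT (V.VF \<circ> \<mu>\<^sub>1)"
      by (rule frac_algebra_iso_comp[OF S1.\<mu>_iso V.frac_algebra_iso])
    show "frac_algebra_iso S1.I.T.QT S2.M.QT (\<mu>\<^sub>2 \<circ> V'.VF)"
      by (rule frac_algebra_iso_comp[OF V'.frac_algebra_iso S2.\<mu>_iso])
    fix i
    have "lv\<^sub>1 (\<tau>\<^sub>1 (basis i)) \<ge> 0 \<or> lv\<^sub>1 (\<tau>\<^sub>1 (- basis i)) \<ge> 0"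
      by (auto simp: additive.minus[OF S1.I.V_additive] S1.M.lv_uminus)
    then show "(V.VF \<circ> \<mu>\<^sub>1) (to_frac S1.I.T.QT (monomial (basis i))) = (\<mu>\<^sub>2 \<circ> V'.VF) (to_frac S1.I.T.QT (monomial (basis i))) \<or>
      (V.VF \<circ> \<mu>\<^sub>1) (to_frac S1.I.T.QT (monomial (- basis i))) = (\<mu>\<^sub>2 \<circ> V'.VF) (to_frac S1.I.T.QT (monomial (- basis i)))"
      using mon[of "basis i"] mon[of "- basis i"] by auto
  qed
  then show ?thesis by simp
qed

text \<open>
  Mutating twice in the same direction gives the identity, although the two isometries compose to the
  transvection \<open>m \<mapsto> m - lv m w\<close>: this is compensated by the symmetry of the binomial coefficients.
\<close>

lemma mutation_step_involution:
  assumes "mutation_step v d \<beta> \<beta>' e w lv \<tau> \<mu>" "mutation_step v d \<beta>' \<beta> e w' lv' \<tau>' \<mu>'"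
    and w: "\<tau> w' = - w" and \<tau>: "\<And>m. \<tau> (\<tau>' m) = m - lv m *s w"
    and x: "x \<in> carrier (Frac (quantum_torus v \<beta>))"
  shows "\<mu> (\<mu>' x) = x"
proof -
  interpret S: mutation_step v d \<beta> \<beta>' e w lv \<tau> \<mu> by fact
  interpret S': mutation_step v d \<beta>' \<beta> e w' lv' \<tau>' \<mu>' by fact
  interpret F: monoid "Frac S.M.QT" by (rule S.M.R.monoid_Frac)
  have lv': "lv' m = - lv (\<tau> m)" for m
  proof -
    have "of_int (lv' m) * e = of_int (- lv (\<tau> m)) * e"
      using S.I.V_isometry[of m w'] by (simp add: w S.M.\<beta>_uminus S.M.\<beta>_w S'.M.\<beta>_w)
    then show ?thesis using S.M.e_nonzero by (simp flip: of_int_minus)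
  qed
  have lvt: "lv (m - k *s w) = lv m" for m k
    using S.M.lv_add[of "m - k *s w" "k *s w"] by (simp add: S.M.lv_scale)
  have mon: "\<mu> (\<mu>' (to_frac S.M.QT (monomial m))) = to_frac S.M.QT (monomial m)" if m: "lv m \<le> 0" for m
  proof -
    define a where "a = nat (- lv m)"
    have a: "lv m = - int a" using m by (simp add: a_def)
    let ?P = "S.M.Pol 0 a"
    have l': "lv' (\<tau>' m) = int a" by (simp add: lv' \<tau> lvt a)
    \<comment> \<open>\<tau> after \<tau>' shifts m by a w, while \<tau> w' = - w runs backwards
      from there. The terms thus appear in reversed order, which the symmetry of \<open>qb\<close>
      undoes.\<close>
    have \<tau>s: "\<tau> (\<tau>' m + int s *s w') = m + (int a - int s) *s w" for s
      by (simp add: additive.add[OF S.I.V_additive] additive_int_scale_vec[OF S.I.V_additive] w \<tau> a)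
        (simp add: vec_eq_iff algebra_simps)
    have lvs: "lv (m + k *s w) = - int a" for k
      using S.M.lv_add[of m "k *s w"] by (simp add: S.M.lv_scale a)
    have 1: "\<mu>' (to_frac S.M.QT (monomial m)) = to_frac S.I.T.QT (binomial_image v e w' (int a) (\<tau>' m))"
      using S'.\<mu>_monomial[of m] by (simp add: l')
    define q where "q = binomial_image v e w' (int a) (\<tau>' m)"
    have T: "monomial_map \<tau> q = S.M.tm ?P (monomial m)"
    proof -
      have "monomial_map \<tau> q = (\<Sum>s\<le>a. Poly_Mapping.single (m + (int a - int s) *s w) (qb v e a s))"
        by (simp add: q_def binomial_image_def monomial_map_lin_ext lin_ext_sum mult_single \<tau>s)
      also have "\<dots> = (\<Sum>s\<le>a. Poly_Mapping.single (m + int s *s w) (qb v e a s))"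
        by (rule sum.reindex_bij_witness[where i = "\<lambda>s. a - s" and j = "\<lambda>s. a - s"])
          (auto simp: of_nat_diff S.M.qb_symmetric)
      also have "\<dots> = S.M.tm ?P (monomial m)"
      proof -
        have "S.M.W (- int s * - int a) * S.M.W (- int a * int s) = 1" for s
          unfolding S.M.W_add[symmetric] by simp
        then show ?thesis
          by (simp add: S.M.Pol_def S.M.tm_sum S.M.v_\<beta>_scale a add.commute mult_ac)
      qed
      finally show ?thesis .
    qed
    let ?z = "to_frac S.M.QT (monomial m)" and ?z' = "to_frac S.M.QT (monomial (- m))"
      and ?p = "to_frac S.M.QT ?P"
    note h = frac_algebra_iso_hom[OF S.\<rho>_iso]
    have c: "S.M.\<rho>F ?z \<in> carrier (Frac S.M.QT)" using ring_hom_closed[OF h] by simp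
    have "S.M.\<rho>F ?z' = ?z' \<otimes>\<^bsub>Frac S.M.QT\<^esub> ?p"
      using S.M.\<rho>F_monomial[of "- m"] S.M.binomial_image_eq[of "- m"] m
      by (simp add: S.M.lv_uminus a S.M.to_frac_tm)
    then have inv: "(?z' \<otimes>\<^bsub>Frac S.M.QT\<^esub> ?p) \<otimes>\<^bsub>Frac S.M.QT\<^esub> S.M.\<rho>F ?z = \<one>\<^bsub>Frac S.M.QT\<^esub>"
      using ring_hom_mult[OF h S.M.to_frac_in S.M.to_frac_in, of "monomial (- m)" "monomial m"] ring_hom_one[OF h]
      by (simp only: S.M.frac_monomial_inverse)
    have "\<mu> (\<mu>' ?z) = S.M.\<rho>F (to_frac S.M.QT (S.M.tm ?P (monomial m)))"
      using S.\<mu>_eq[OF S.I.T.to_frac_in, of q] by (simp add: 1 S.I.VF_to_frac T flip: q_def)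
    also have "\<dots> = ?p \<otimes>\<^bsub>Frac S.M.QT\<^esub> S.M.\<rho>F ?z"
      using ring_hom_mult[OF h S.M.to_frac_in S.M.to_frac_in] by (simp add: S.M.to_frac_tm S.M.\<rho>F_Pol)
    \<comment> \<open>Inserting z^m z^-m = 1 exposes the factor (z^-m P) \<rho>(z^m), which equals
      \<rho>(z^-m) \<rho>(z^m) = 1.\<close>
    also have "\<dots> = (?z \<otimes>\<^bsub>Frac S.M.QT\<^esub> ?z') \<otimes>\<^bsub>Frac S.M.QT\<^esub> (?p \<otimes>\<^bsub>Frac S.M.QT\<^esub> S.M.\<rho>F ?z)"
      unfolding S.M.frac_monomial_inverse using c by simp
    also have "\<dots> = ?z"
      using inv c by (simp add: F.m_assoc)
    finally show ?thesis .
  qed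
  have "(\<mu> \<circ> \<mu>') x = id x"
  proof (rule S.M.frac_algebra_iso_eqI[OF S.M.R.ore_domain_axioms _ _ _ x])
    show "frac_algebra_iso S.M.QT S.M.QT (\<mu> \<circ> \<mu>')"
      by (rule frac_algebra_iso_comp[OF S'.\<mu>_iso S.\<mu>_iso])
    show "frac_algebra_iso S.M.QT S.M.QT id"
      by (simp add: frac_algebra_iso_def ring_iso_def ring_hom_def)
    fix i
    have "lv (basis i) \<le> 0 \<or> lv (- basis i) \<le> 0" by (auto simp: S.M.lv_uminus)
    then show "(\<mu> \<circ> \<mu>') (to_frac S.M.QT (monomial (basis i))) = id (to_frac S.M.QT (monomial (basis i))) \<or>
      (\<mu> \<circ> \<mu>') (to_frac S.M.QT (monomial (- basis i))) = id (to_frac S.M.QT (monomial (- basis i)))"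
      using mon by auto
  qed
  then show ?thesis by simp
qed

section \<open>Upper cluster algebras and isometries of seeds\<close>

lemma (in qbase) torus_iso_comp:
  assumes "torus_iso v d \<beta> \<beta>' V" "torus_iso v d \<beta>' \<beta>'' V'"
  shows "torus_iso v d \<beta> \<beta>'' (V' \<circ> V)"
proof -
  interpret A: torus_iso v d \<beta> \<beta>' V by fact
  interpret B: torus_iso v d \<beta>' \<beta>'' V' by fact
  show ?thesis
  proof (intro torus_iso.intro torus_iso_axioms.intro A.T.qtorus_axioms B.T'.qtorus_axioms)
    show "additive (V' \<circ> V)"
      by (simp add: additive_def additive.add[OF A.V_additive] additive.add[OF B.V_additive])
    show "bij (V' \<circ> V)" using A.V_bij B.V_bij by (rule bij_comp)
  qed (simp add: A.V_isometry B.V_isometry)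
qed

lemma (in qbase) torus_iso_inverse:
  assumes "torus_iso v d \<beta> \<beta>' V"
  shows "torus_iso v d \<beta>' \<beta> (inv_into UNIV V)"
proof -
  interpret A: torus_iso v d \<beta> \<beta>' V by fact
  let ?W = "inv_into UNIV V"
  have VW: "V (?W m) = m" for m using A.V_bij by (simp add: bij_is_surj surj_f_inv_f)
  have inj: "V m = V n \<Longrightarrow> m = n" for m n using A.V_bij by (simp add: bij_is_inj inj_eq)
  show ?thesis
  proof (intro torus_iso.intro torus_iso_axioms.intro A.T.qtorus_axioms A.T'.qtorus_axioms)
    show "additive ?W"
    proof (unfold additive_def, intro allI)
      fix x y
      show "?W (x + y) = ?W x + ?W y" by (rule inj) (simp add: VW additive.add[OF A.V_additive])
    qed
    show "bij ?W" using A.V_bij by (rule bij_imp_bij_inv)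
    show "\<beta> (?W m) (?W n) = \<beta>' m n" for m n
      using A.V_isometry[of "?W m" "?W n"] by (simp add: VW)
  qed
qed

primrec mutation_seq ::
    "(('u::finite, 'f::finite) seed \<Rightarrow> 'u \<Rightarrow> 'x \<Rightarrow> 'x) \<Rightarrow> ('u, 'f) seed \<Rightarrow> 'u list \<Rightarrow> 'x \<Rightarrow> 'x" where
  "mutation_seq \<mu> t [] = id"
| "mutation_seq \<mu> t (k # ks) = \<mu> t k \<circ> mutation_seq \<mu> (mutate t k) ks"

lemma frac_algebra_iso_id: "frac_algebra_iso R R id"
  by (simp add: frac_algebra_iso_def ring_iso_def ring_hom_def)

lemma dd_mutate [simp]: "dd (mutate t k) = dd t"
  by (simp add: mutate_def)

text \<open>Mutation at an unfrozen vertex changes the unfrozen block of B by a formula in that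
  block alone.\<close>

lemma similar_mutate:
  assumes "similar \<sigma> t t'" "inj \<sigma>"
  shows "similar \<sigma> (mutate t k) (mutate t' (\<sigma> k))"
  using assms unfolding similar_def mutate_def by (auto simp: inj_eq)

text \<open>
  The data common to the two sides: \<open>A\<close> with \<open>\<beta> = \<lambda>\<close> and \<open>w t k = p\<^sup>* e\<^sub>k\<close>, and \<open>X\<close> with \<open>\<beta> = - \<omega>\<close> and
  \<open>w t k = e\<^sub>k\<close>.
\<close>

locale mutation_system =
  fixes v :: "rat \<Rightarrow> 'k::idom" and d :: int
    and good :: "('u::finite, 'f::finite) seed \<Rightarrow> bool"
    and \<beta> :: "('u, 'f) seed \<Rightarrow> ('u, 'f) lattice \<Rightarrow> ('u, 'f) lattice \<Rightarrow> rat"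
    and w :: "('u, 'f) seed \<Rightarrow> 'u \<Rightarrow> ('u, 'f) lattice"
    and lv :: "('u, 'f) seed \<Rightarrow> 'u \<Rightarrow> ('u, 'f) lattice \<Rightarrow> int"
    and \<tau> :: "('u, 'f) seed \<Rightarrow> 'u \<Rightarrow> ('u, 'f) lattice \<Rightarrow> ('u, 'f) lattice"
    and \<mu> :: "('u, 'f) seed \<Rightarrow> 'u \<Rightarrow> ('u, 'f, 'k) fraction \<Rightarrow> ('u, 'f, 'k) fraction"
  assumes good_mutate: "good t \<Longrightarrow> good (mutate t k)"
    and mutate_mutate: "good t \<Longrightarrow> mutate (mutate t k) k = t"
    and step: "good t \<Longrightarrow> mutation_step v d (\<beta> t) (\<beta> (mutate t k)) (1 / of_int (dd t (Inl k)))
      (w t k) (lv t k) (\<tau> t k) (\<mu> t k)"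
    and \<tau>_w: "good t \<Longrightarrow> \<tau> t k (w (mutate t k) j) =
      (if j = k then - w t k else w t j + pos (bmat t (Inl k) (Inl j)) *s w t k)"
    and \<tau>_\<tau>: "good t \<Longrightarrow> \<tau> t k (\<tau> (mutate t k) k m) = m - lv t k m *s w t k"
begin

abbreviation "T t \<equiv> quantum_torus v (\<beta> t)"
abbreviation "K t \<equiv> carrier (Frac (T t))"
abbreviation "ms \<equiv> mutation_seq \<mu>"
abbreviation "VF t t' V \<equiv> frac_map (T t) (T t') UNIV (monomial_map V)"

lemma good_mutate_seq: "good t \<Longrightarrow> good (mutate_seq t ks)"
  by (induction ks arbitrary: t) (simp_all add: good_mutate)

lemma qtorus: "good t \<Longrightarrow> qtorus v d (\<beta> t)"
  using step[of t undefined] unfolding mutation_step_def qmut_def by blast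

lemma to_frac_in_K: "good t \<Longrightarrow> to_frac (T t) p \<in> K t"
  by (rule qtorus.to_frac_in[OF qtorus])

lemma mutation_iso: "good t \<Longrightarrow> frac_algebra_iso (T (mutate t k)) (T t) (\<mu> t k)"
  using step by (rule mutation_step.\<mu>_iso)

lemma mutation_seq_iso: "good t \<Longrightarrow> frac_algebra_iso (T (mutate_seq t ks)) (T t) (ms t ks)"
proof (induction ks arbitrary: t)
  case Nil
  show ?case by (simp only: mutation_seq.simps mutate_seq.simps frac_algebra_iso_id)
next
  case (Cons k ks)
  show ?case unfolding mutation_seq.simps mutate_seq.simps
    using frac_algebra_iso_comp[OF Cons.IH[OF good_mutate] mutation_iso] Cons.prems by blast
qed

definition upper :: "('u, 'f) seed \<Rightarrow> ('u, 'f, 'k) fraction set" where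
  "upper t = (\<Inter>ks. ms t ks ` range (to_frac (T (mutate_seq t ks))))"

lemma mutation_seq_image_subset:
  assumes "good t" shows "ms t ks ` range (to_frac (T (mutate_seq t ks))) \<subseteq> K t"
  using bij_betw_imp_surj_on[OF frac_algebra_iso_bij[OF mutation_seq_iso[OF assms]]]
    to_frac_in_K[OF good_mutate_seq[OF assms]] by blast

lemma upper_subset_range: "upper t \<subseteq> range (to_frac (T t))"
proof
  fix x assume "x \<in> upper t"
  then have "x \<in> ms t [] ` range (to_frac (T (mutate_seq t [])))" unfolding upper_def by (rule INT_D) simp
  then show "x \<in> range (to_frac (T t))" by simp
qed

lemma upper_subset: "good t \<Longrightarrow> upper t \<subseteq> K t"
  using upper_subset_range to_frac_in_K by blast

lemma mutation_involution:
  assumes "good t" "x \<in> K t" shows "\<mu> t k (\<mu> (mutate t k) k x) = x"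
proof (rule mutation_step_involution[OF step[OF assms(1)] _ _ \<tau>_\<tau>[OF assms(1)] assms(2)])
  show "mutation_step v d (\<beta> (mutate t k)) (\<beta> t) (1 / of_int (dd t (Inl k)))
      (w (mutate t k) k) (lv (mutate t k) k) (\<tau> (mutate t k) k) (\<mu> (mutate t k) k)"
    using step[OF good_mutate[OF assms(1)], of k k] by (simp add: mutate_mutate[OF assms(1)])
  show "\<tau> t k (w (mutate t k) k) = - w t k" using \<tau>_w[OF assms(1)] by simp
qed

text \<open>The sequence k, k, ks ends at the same seed as ks and has the same composite map,
  because the double mutation is the identity. Intersecting only over sequences that begin with k
  therefore loses nothing.\<close>

lemma mutation_upper:
  assumes "good t" shows "\<mu> t k ` upper (mutate t k) = upper t"
proof -
  let ?t = "mutate t k"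
  let ?A = "\<lambda>s ks. ms s ks ` range (to_frac (T (mutate_seq s ks)))"
  have inj: "inj_on (\<mu> t k) (K ?t)"
    using frac_algebra_iso_bij[OF mutation_iso[OF assms]] by (rule bij_betw_imp_inj_on)
  have "\<mu> t k ` upper ?t = (\<Inter>ks. \<mu> t k ` ?A ?t ks)"
    unfolding upper_def
    by (rule image_INT[OF inj, of _ _ "[]"]) (use mutation_seq_image_subset[OF good_mutate[OF assms]] in auto)
  also have "\<dots> = (\<Inter>ks. ?A t (k # ks))" by (simp add: image_comp)
  also have "\<dots> = upper t"
  proof
    show "upper t \<subseteq> (\<Inter>ks. ?A t (k # ks))" unfolding upper_def by blast
    have "?A t (k # k # ks) = ?A t ks" for ks
    proof -
      have "?A t (k # k # ks) = (\<lambda>x. \<mu> t k (\<mu> ?t k x)) ` ?A t ks"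
        by (simp add: mutate_mutate[OF assms] image_comp o_assoc comp_def)
      also have "\<dots> = (\<lambda>x. x) ` ?A t ks"
      proof (rule image_cong[OF refl])
        fix y assume "y \<in> ?A t ks"
        with mutation_seq_image_subset[OF assms, of ks] have "y \<in> K t" by (rule subsetD)
        then show "\<mu> t k (\<mu> ?t k y) = y" by (rule mutation_involution[OF assms])
      qed
      finally show ?thesis by simp
    qed
    then have "(\<Inter>ks. ?A t (k # ks)) \<subseteq> ?A t ks" for ks
      using INT_lower[of "k # ks" UNIV "\<lambda>ks. ?A t (k # ks)"] by simp
    then show "(\<Inter>ks. ?A t (k # ks)) \<subseteq> upper t" unfolding upper_def by (rule INT_greatest)
  qed
  finally show ?thesis .
qed

lemma mutation_seq_upper:
  "good t \<Longrightarrow> ms t ks ` upper (mutate_seq t ks) = upper t"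
proof (induction ks arbitrary: t)
  case (Cons k ks)
  have "ms t (k # ks) ` upper (mutate_seq t (k # ks)) = \<mu> t k ` (ms (mutate t k) ks ` upper (mutate_seq (mutate t k) ks))"
    by (simp add: image_comp)
  then show ?case using Cons good_mutate mutation_upper by simp
qed simp

text \<open>The data compared are those that determine unfrozen mutations: the form, the vectors w,
  and the unfrozen block with its d_i. Frozen directions are constrained only through the form and
  w.\<close>

definition seed_iso :: "('u \<Rightarrow> 'u) \<Rightarrow> ('u, 'f) seed \<Rightarrow> ('u, 'f) seed \<Rightarrow> (('u, 'f) lattice \<Rightarrow> ('u, 'f) lattice) \<Rightarrow> bool" where
  "seed_iso \<sigma> t t' V \<longleftrightarrow> torus_iso v d (\<beta> t) (\<beta> t') V \<and> (\<forall>k. V (w t k) = w t' (\<sigma> k)) \<and> similar \<sigma> t t'"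

text \<open>V' is V conjugated by the two lattice isometries. It again matches the vectors w,
  because \<open>\<tau>_w\<close> expresses the new ones through the old ones and unfrozen entries
  of B.\<close>

lemma seed_iso_mutate:
  assumes t: "good t" and t': "good t'" and \<sigma>: "inj \<sigma>" and V: "seed_iso \<sigma> t t' V"
  obtains V' where "seed_iso \<sigma> (mutate t k) (mutate t' (\<sigma> k)) V'"
    "\<And>m. \<tau> t' (\<sigma> k) (V' m) = V (\<tau> t k m)"
proof -
  interpret qtorus v d "\<beta> t" by (rule qtorus[OF t])
  interpret S: mutation_step v d "\<beta> t" "\<beta> (mutate t k)" "1 / of_int (dd t (Inl k))" "w t k" "lv t k" "\<tau> t k" "\<mu> t k"
    by (rule step[OF t])
  interpret S': mutation_step v d "\<beta> t'" "\<beta> (mutate t' (\<sigma> k))" "1 / of_int (dd t' (Inl (\<sigma> k)))" "w t' (\<sigma> k)"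
    "lv t' (\<sigma> k)" "\<tau> t' (\<sigma> k)" "\<mu> t' (\<sigma> k)"
    by (rule step[OF t'])
  interpret V: torus_iso v d "\<beta> t" "\<beta> t'" V using V by (simp add: seed_iso_def)
  define V' where "V' = inv_into UNIV (\<tau> t' (\<sigma> k)) \<circ> (V \<circ> \<tau> t k)"
  have \<tau>: "\<tau> t' (\<sigma> k) (V' m) = V (\<tau> t k m)" for m
    using S'.I.V_bij by (simp add: V'_def bij_is_surj surj_f_inv_f)
  have inj: "\<tau> t' (\<sigma> k) m = \<tau> t' (\<sigma> k) n \<Longrightarrow> m = n" for m n
    using S'.I.V_bij by (simp add: bij_is_inj inj_eq)
  have iso: "torus_iso v d (\<beta> (mutate t k)) (\<beta> (mutate t' (\<sigma> k))) V'"
    unfolding V'_def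
    by (rule torus_iso_comp[OF torus_iso_comp[OF S.I.torus_iso_axioms V.torus_iso_axioms]
          torus_iso_inverse[OF S'.I.torus_iso_axioms]])
  have sim: "similar \<sigma> t t'" and Vw: "\<And>j. V (w t j) = w t' (\<sigma> j)" using V by (auto simp: seed_iso_def)
  have "V' (w (mutate t k) j) = w (mutate t' (\<sigma> k)) (\<sigma> j)" for j
  proof (rule inj)
    have "bmat t (Inl k) (Inl j) = bmat t' (Inl (\<sigma> k)) (Inl (\<sigma> j))" using sim by (simp add: similar_def)
    then show "\<tau> t' (\<sigma> k) (V' (w (mutate t k) j)) = \<tau> t' (\<sigma> k) (w (mutate t' (\<sigma> k)) (\<sigma> j))"
      using \<sigma> by (simp add: \<tau> \<tau>_w[OF t] \<tau>_w[OF t'] inj_eq Vw additive.add[OF V.V_additive]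
          additive.minus[OF V.V_additive] additive_int_scale_vec[OF V.V_additive])
  qed
  then have "seed_iso \<sigma> (mutate t k) (mutate t' (\<sigma> k)) V'"
    using iso similar_mutate[OF sim \<sigma>] by (simp add: seed_iso_def)
  with \<tau> that show ?thesis by blast
qed

lemma seed_iso_natural:
  assumes "good t" "good t'" "inj \<sigma>" "seed_iso \<sigma> t t' V"
  shows "\<exists>V'. seed_iso \<sigma> (mutate_seq t ks) (mutate_seq t' (map \<sigma> ks)) V' \<and>
    (\<forall>x\<in>K (mutate_seq t ks). VF t t' V (ms t ks x) =
       ms t' (map \<sigma> ks) (VF (mutate_seq t ks) (mutate_seq t' (map \<sigma> ks)) V' x))"
  using assms
proof (induction ks arbitrary: t t' V)
  case Nil
  then show ?case by auto
next
  case (Cons k ks)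
  note t = \<open>good t\<close> and t' = \<open>good t'\<close>
  obtain V1 where V1: "seed_iso \<sigma> (mutate t k) (mutate t' (\<sigma> k)) V1"
      "\<And>m. \<tau> t' (\<sigma> k) (V1 m) = V (\<tau> t k m)"
    using seed_iso_mutate[OF Cons.prems] by metis
  obtain V' where V': "seed_iso \<sigma> (mutate_seq t (k # ks)) (mutate_seq t' (map \<sigma> (k # ks))) V'"
    "\<And>x. x \<in> K (mutate_seq t (k # ks)) \<Longrightarrow> VF (mutate t k) (mutate t' (\<sigma> k)) V1 (ms (mutate t k) ks x) =
       ms (mutate t' (\<sigma> k)) (map \<sigma> ks) (VF (mutate_seq t (k # ks)) (mutate_seq t' (map \<sigma> (k # ks))) V' x)"
    using Cons.IH[OF good_mutate[OF t] good_mutate[OF t'] Cons.prems(3) V1(1)] by auto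
  have dd: "dd t (Inl k) = dd t' (Inl (\<sigma> k))" and w: "V (w t k) = w t' (\<sigma> k)"
    and VI: "torus_iso v d (\<beta> t) (\<beta> t') V"
    using Cons.prems(4) by (auto simp: seed_iso_def similar_def)
  have V1I: "torus_iso v d (\<beta> (mutate t k)) (\<beta> (mutate t' (\<sigma> k))) V1"
    using V1 by (simp add: seed_iso_def)
  have "VF t t' V (ms t (k # ks) x) =
      ms t' (map \<sigma> (k # ks)) (VF (mutate_seq t (k # ks)) (mutate_seq t' (map \<sigma> (k # ks))) V' x)"
    if x: "x \<in> K (mutate_seq t (k # ks))" for x
  proof -
    have "ms (mutate t k) ks x \<in> K (mutate t k)"
      using ring_hom_closed[OF frac_algebra_iso_hom[OF mutation_seq_iso[OF good_mutate[OF t]]]] x by simp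
    then show ?thesis
      using mutation_step_natural[OF step[OF t] step[OF t', of "\<sigma> k", folded dd] VI V1I w V1(2)] V'(2)[OF x]
      by simp
  qed
  with V'(1) show ?case by blast
qed

text \<open>The Laurent ring reached by ks goes to the one reached by the relabelled sequence.
  Injectivity lets the image pass through the intersection, and surjectivity of
  \<open>map \<sigma>\<close> makes every sequence occur on the other side.\<close>

lemma seed_iso_upper:
  assumes t: "good t" and t': "good t'" and \<sigma>: "bij \<sigma>" and V: "seed_iso \<sigma> t t' V"
  shows "VF t t' V ` upper t = upper t'"
proof -
  let ?A = "\<lambda>s ks. ms s ks ` range (to_frac (T (mutate_seq s ks)))"
  interpret V: torus_iso v d "\<beta> t" "\<beta> t'" V using V by (simp add: seed_iso_def)
  have A: "VF t t' V ` ?A t ks = ?A t' (map \<sigma> ks)" for ks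
  proof -
    obtain V' where V': "seed_iso \<sigma> (mutate_seq t ks) (mutate_seq t' (map \<sigma> ks)) V'"
      "\<And>x. x \<in> K (mutate_seq t ks) \<Longrightarrow> VF t t' V (ms t ks x) =
         ms t' (map \<sigma> ks) (VF (mutate_seq t ks) (mutate_seq t' (map \<sigma> ks)) V' x)"
      using seed_iso_natural[OF t t' bij_is_inj[OF \<sigma>] V] by blast
    interpret V': torus_iso v d "\<beta> (mutate_seq t ks)" "\<beta> (mutate_seq t' (map \<sigma> ks))" V'
      using V'(1) by (simp add: seed_iso_def)
    have "range (to_frac (T (mutate_seq t' (map \<sigma> ks)))) =
        range (\<lambda>p. to_frac (T (mutate_seq t' (map \<sigma> ks))) (monomial_map V' p))"
      using bij_is_surj[OF bij_monomial_map[OF V'.V_bij]] by (metis (no_types) range_composition)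
    then show ?thesis
      using V'(2)[OF to_frac_in_K[OF good_mutate_seq[OF t]]] by (simp add: image_image V'.VF_to_frac)
  qed
  have inj: "inj_on (VF t t' V) (K t)" by (rule V.P.frac_map_inj)
  have "VF t t' V ` upper t = (\<Inter>ks. VF t t' V ` ?A t ks)"
    unfolding upper_def
    by (rule image_INT[OF inj, of _ _ "[]"]) (use mutation_seq_image_subset[OF t] in auto)
  also have "\<dots> = (\<Inter>ks. ?A t' (map \<sigma> ks))" unfolding A ..
  also have "\<dots> = \<Inter> (?A t' ` range (map \<sigma>))" by (simp add: image_image)
  also have "range (map \<sigma>) = UNIV" 
    by (rule surjI[of _ "map (inv_into UNIV \<sigma>)"]) (use \<sigma> in \<open>simp add: comp_def bij_is_surj surj_f_inv_f\<close>)
  finally show ?thesis by (simp add: upper_def)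
qed

lemma twist_automorphism:
  assumes t: "good t" and \<sigma>: "bij \<sigma>" and V: "seed_iso \<sigma> t (mutate_seq t ks) V"
  shows "algebra_automorphism (T t) (upper t) (ms t ks \<circ> VF t (mutate_seq t ks) V)"
proof -
  let ?t = "mutate_seq t ks" let ?tw = "ms t ks \<circ> VF t ?t V"
  note t' = good_mutate_seq[OF t, of ks]
  interpret V: torus_iso v d "\<beta> t" "\<beta> ?t" V using V by (simp add: seed_iso_def)
  have iso: "frac_algebra_iso (T t) (T t) ?tw"
    using frac_algebra_iso_comp[OF V.frac_algebra_iso mutation_seq_iso[OF t]] .
  note sub = subsetD[OF upper_subset[OF t]]
  have im: "?tw ` upper t = upper t"
    unfolding image_comp[symmetric] seed_iso_upper[OF t t' \<sigma> V] by (rule mutation_seq_upper[OF t])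
  have inj: "inj_on ?tw (upper t)"
    using bij_betw_imp_inj_on[OF frac_algebra_iso_bij[OF iso]] upper_subset[OF t] by (rule inj_on_subset)
  note h = frac_algebra_iso_hom[OF iso]
  have "?tw \<in> ring_hom (Frac (T t)\<lparr>carrier := upper t\<rparr>) (Frac (T t)\<lparr>carrier := upper t\<rparr>)"
    by (rule ring_hom_memI)
      (use im ring_hom_mult[OF h sub sub] ring_hom_add[OF h sub sub] ring_hom_one[OF h] in auto)
  then show ?thesis
    using im inj frac_algebra_iso_const[OF iso]
    by (auto simp: algebra_automorphism_def ring_iso_def bij_betw_def)
qed

end

section \<open>Mutation of seeds\<close>

lemma additive_expand:
  assumes "additive (f :: int ^ 'i::finite \<Rightarrow> rat)"
  shows "f m = (\<Sum>i\<in>UNIV. of_int (m $ i) * f (basis i))"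
proof -
  interpret additive f by fact
  have "f m = f (\<Sum>i\<in>UNIV. m $ i *s basis i)" by (simp add: basis_expansion)
  then show ?thesis by (simp only: sum additive_int_scale[OF assms])
qed

lemma biadditive_eqI:
  fixes B C :: "int ^ 'i::finite \<Rightarrow> int ^ 'i \<Rightarrow> rat"
  assumes "\<And>m. additive (B m)" "\<And>n. additive (\<lambda>m. B m n)"
    and "\<And>m. additive (C m)" "\<And>n. additive (\<lambda>m. C m n)"
    and eq: "\<And>i j. B (basis i) (basis j) = C (basis i) (basis j)"
  shows "B m n = C m n"
proof -
  have "B (basis i) n = C (basis i) n" for i
    using additive_expand[OF assms(1), of "basis i" n] additive_expand[OF assms(3), of "basis i" n]
    by (simp add: eq)
  then show ?thesis
    using additive_expand[OF assms(2), of m n] additive_expand[OF assms(4), of m n] by simp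
qed

lemma lam_form_additive: "additive (lam_form t m)" "additive (\<lambda>m. lam_form t m n)"
  by (simp_all add: additive_def lam_form_def distrib_right distrib_left sum.distrib)

lemma omega_additive: "additive (omega t m)" "additive (\<lambda>m. omega t m n)"
  by (simp_all add: additive_def omega_def distrib_right distrib_left sum.distrib add_divide_distrib)

lemmas lam_form_add = additive.add[OF lam_form_additive(1)] additive.add[OF lam_form_additive(2)]
lemmas omega_add = additive.add[OF omega_additive(1)] additive.add[OF omega_additive(2)]
lemmas lam_form_minus = additive.minus[OF lam_form_additive(1)] additive.minus[OF lam_form_additive(2)]
lemmas lam_form_scale = additive_int_scale[OF lam_form_additive(1)] additive_int_scale[OF lam_form_additive(2)]
lemmas omega_scale = additive_int_scale[OF omega_additive(1)] additive_int_scale[OF omega_additive(2)]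

lemma sum_basis:
  "(\<Sum>i\<in>UNIV. of_int ((basis k :: int ^ 'i::finite) $ i) * g i) = (g k :: 'b::comm_ring_1)"
proof -
  have "(\<Sum>i\<in>UNIV. of_int ((basis k :: int ^ 'i) $ i) * g i) = (\<Sum>i\<in>UNIV. if i = k then g i else 0)"
    by (intro sum.cong refl) (auto simp: axis_def)
  then show ?thesis by simp
qed

lemma lam_form_basis: "lam_form t (basis i) (basis j) = lam t i j"
  unfolding lam_form_def by (simp only: mult.assoc sum_distrib_left[symmetric] sum_basis)

lemma omega_basis: "omega t (basis i) (basis j) = of_int (bmat t j i) / of_int (dd t j)"
  unfolding omega_def by (simp only: mult.assoc sum_distrib_left[symmetric] sum_basis) simp

lemma pstar_additive: "additive (pstar t)"
  by (simp add: additive_def pstar_def vec_eq_iff distrib_left sum.distrib)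

lemma pstar_basis: "pstar t (basis k) $ i = bmat t i k"
  unfolding pstar_def using sum_basis[of k "bmat t i"] by (simp add: mult.commute)

lemma pos_diff: "pos x - pos (- x) = x"
  by (simp add: pos_def)

lemma basis_nth: "(basis k :: int ^ 'i::finite) $ i = (if i = k then 1 else 0)"
  by (simp add: axis_def)

lemma mut_M_basis_nth:
  "mut_M_basis t k j $ i = (if j = Inl k then pos (- bmat t i (Inl k)) - (if i = Inl k then 1 else 0)
     else if i = j then 1 else 0)"
proof -
  have "(\<Sum>j\<in>UNIV. pos (- bmat t j (Inl k)) * (basis j :: ('a, 'b) lattice) $ i) =
      (\<Sum>j\<in>UNIV. if j = i then pos (- bmat t j (Inl k)) else 0)"
    by (intro sum.cong refl) (simp add: basis_nth)
  then show ?thesis by (simp add: mut_M_basis_def basis_nth)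
qed

text \<open>The entry b_kk remains in the formula because no seed axiom forcing it to vanish is
  assumed here.\<close>

lemma mut_M_nth:
  "mut_M t k m $ i = (if i = Inl k then (pos (- bmat t i (Inl k)) - 1) * m $ i
     else m $ i + m $ Inl k * pos (- bmat t i (Inl k)))"
proof -
  have "mut_M t k m $ i = (\<Sum>j\<in>UNIV. m $ j * mut_M_basis t k j $ i)"
    by (simp add: mut_M_def)
  \<comment> \<open>Each vector is split into its identity part and a correction in column k. The
    identity contributes +1 where the image of f_k has -1, hence the factor 2.\<close>
  also have "\<dots> = (\<Sum>j\<in>UNIV. (if j = i then m $ j else 0) + (if j = Inl k then
      m $ j * (pos (- bmat t i (Inl k)) - 2 * (if i = Inl k then 1 else 0)) else 0))"
    by (intro sum.cong refl) (auto simp: mut_M_basis_nth algebra_simps)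
  also have "\<dots> = m $ i + m $ Inl k * (pos (- bmat t i (Inl k)) - 2 * (if i = Inl k then 1 else 0))"
    unfolding sum.distrib by simp
  finally show ?thesis by (cases "i = Inl k") (simp_all add: algebra_simps)
qed

lemma mut_M_basis_self:
  "mut_M t k (basis (Inl k)) = - basis (Inl k) + (\<Sum>j\<in>UNIV. pos (- bmat t j (Inl k)) *s basis j)"
proof -
  have "mut_M t k (basis (Inl k)) = (\<Sum>i\<in>UNIV. if i = Inl k then mut_M_basis t k i else 0)"
    unfolding mut_M_def by (intro sum.cong refl) (auto simp: axis_def vec_eq_iff)
  then show ?thesis by (simp add: mut_M_basis_def)
qed

lemma mut_M_additive: "additive (mut_M t k)"
  by (simp add: additive_def vec_eq_iff mut_M_nth distrib_left distrib_right)

text \<open>The map e_k to - e_k and, if b_kk = 0, e_i to e_i + [b_ki]_+ e_k for i other than k: the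
  monomial part of the X mutation and the counterpart of \<open>mut_M\<close> under p^*.\<close>

definition mut_N :: "('u::finite, 'f::finite) seed \<Rightarrow> 'u \<Rightarrow> ('u, 'f) lattice \<Rightarrow> ('u, 'f) lattice" where
  "mut_N t k n = n + ((\<Sum>j\<in>UNIV. pos (bmat t (Inl k) j) * n $ j) - 2 * n $ Inl k) *s basis (Inl k)"

lemma mut_N_additive: "additive (mut_N t k)"
  by (simp add: additive_def vec_eq_iff mut_N_def distrib_left distrib_right sum.distrib algebra_simps)

lemma mut_N_basis:
  "mut_N t k (basis i) = basis i + (pos (bmat t (Inl k) i) - (if i = Inl k then 2 else 0)) *s basis (Inl k)"
proof -
  have "(\<Sum>j\<in>UNIV. pos (bmat t (Inl k) j) * (basis i :: ('a, 'b) lattice) $ j) = pos (bmat t (Inl k) i)"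
    using sum_basis[of i "\<lambda>j. pos (bmat t (Inl k) j)"] by (simp add: mult.commute)
  then show ?thesis by (auto simp: mut_N_def axis_def)
qed

lemma mutate_bmat:
  "bmat (mutate t k) i j = (if i = Inl k \<or> j = Inl k then - bmat t i j
     else bmat t i j + bmat t i (Inl k) * pos (bmat t (Inl k) j) + pos (- bmat t i (Inl k)) * bmat t (Inl k) j)"
  by (simp add: mutate_def)

lemma lam_form_mutate: "lam_form (mutate t k) m n = lam_form t (mut_M t k m) (mut_M t k n)"
  by (rule biadditive_eqI)
    (simp_all add: lam_form_additive additive_def additive.add[OF mut_M_additive] lam_form_add
      lam_form_basis, simp add: mutate_def)

context
  fixes t :: "('u::finite, 'f::finite) seed"
  assumes t: "is_seed t"
begin

lemma dd_pos: "dd t i > 0"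
  using t by (simp add: is_seed_def)

lemma seed_skew_rat: "(of_int (bmat t i j) :: rat) / of_int (dd t i) = - (of_int (bmat t j i) / of_int (dd t j))"
  using t unfolding is_seed_def by (metis mult.left_neutral times_divide_eq_left)

lemma bmat_diag [simp]: "bmat t i i = 0"
  using seed_skew_rat[of i i] dd_pos[of i] by simp

lemma seed_skew: "bmat t i j * dd t j = - bmat t j i * dd t i"
proof -
  have "(of_int (bmat t i j * dd t j) :: rat) = of_int (- bmat t j i * dd t i)"
    using seed_skew_rat[of i j] dd_pos[of i] dd_pos[of j] by (simp add: field_simps)
  then show ?thesis by (simp only: of_int_eq_iff)
qed

text \<open>In b_ij d_j = - b_ji d_i both d are positive, so - b_ij and b_ji have the same sign and
  their positive parts scale alike.\<close>

lemma pos_skew: "(of_int (pos (- bmat t i j)) :: rat) / of_int (dd t i) = of_int (pos (bmat t j i)) / of_int (dd t j)"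
proof -
  have d: "dd t i > 0" "dd t j > 0" by (rule dd_pos)+
  have "pos (- bmat t i j) * dd t j = pos (bmat t j i) * dd t i"
  proof (cases "bmat t i j \<le> 0")
    case True
    then have "bmat t i j * dd t j \<le> 0" using d by (simp add: mult_nonpos_nonneg)
    then have "bmat t j i * dd t i \<ge> 0" using seed_skew[of i j] by simp
    then have "bmat t j i \<ge> 0" using d by (simp add: zero_le_mult_iff)
    then have "pos (bmat t j i) = bmat t j i" "pos (- bmat t i j) = - bmat t i j"
      using True by (simp_all add: pos_def)
    then show ?thesis using seed_skew[of i j] by simp
  next
    case False
    then have "bmat t i j * dd t j > 0" using d by simp
    then have "bmat t j i * dd t i < 0" using seed_skew[of i j] by simp
    then have "bmat t j i < 0" using d by (simp add: mult_less_0_iff)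
    then show ?thesis using False by (simp add: pos_def max_def)
  qed
  then have "(of_int (pos (- bmat t i j) * dd t j) :: rat) = of_int (pos (bmat t j i) * dd t i)" by simp
  then show ?thesis using d by (simp add: field_simps)
qed

lemma omega_skew: "omega t m n = - omega t n m"
proof (rule biadditive_eqI)
  show "omega t (basis i) (basis j) = - omega t (basis j) (basis i)" for i j
    using seed_skew_rat[of j i] by (simp add: omega_basis)
qed (simp_all add: additive_def omega_add)

text \<open>Both applications use the same seed, so the same exponents cancel. Returning through
  \<open>mutate t k\<close> flips the sign of column k and gives the transvection of
  \<open>mut_M_mut_M\<close> instead.\<close>

lemma mut_M_invol: "mut_M t k (mut_M t k m) = m"
  by (simp add: vec_eq_iff mut_M_nth pos_def)

lemma mut_M_bij: "bij (mut_M t k)"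
  by (rule involuntory_imp_bij) (rule mut_M_invol)

lemma mut_N_nth: "mut_N t k n $ i = (if i = Inl k then (\<Sum>j\<in>UNIV. pos (bmat t (Inl k) j) * n $ j) - n $ i else n $ i)"
  by (simp add: mut_N_def axis_def)

lemma mut_N_sum: "(\<Sum>j\<in>UNIV. pos (c * bmat t (Inl k) j) * mut_N t' k n $ j) = (\<Sum>j\<in>UNIV. pos (c * bmat t (Inl k) j) * n $ j)"
  by (intro sum.cong refl) (auto simp: mut_N_def axis_def pos_def)

lemma mut_N_invol: "mut_N t k (mut_N t k n) = n"
  using mut_N_sum[of 1 k t n] by (simp add: vec_eq_iff mut_N_nth[of k "mut_N t k n"]) (simp add: mut_N_nth)

lemma mut_N_bij: "bij (mut_N t k)"
  by (rule involuntory_imp_bij) (rule mut_N_invol)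

lemma omega_mutate: "omega (mutate t k) m n = omega t (mut_N t k m) (mut_N t k n)"
proof (rule biadditive_eqI[of "omega (mutate t k)" "\<lambda>m n. omega t (mut_N t k m) (mut_N t k n)"])
  fix i j
  \<comment> \<open>The matrix rule for b_ji contains [-b_jk]_+, whereas \<open>mut_N\<close>
    contributes [b_kj]_+. Skewness of DB converts one into the other.\<close>
  have ps: "(of_int (pos (- bmat t j (Inl k))) :: rat) / of_int (dd t j) = of_int (pos (bmat t (Inl k) j)) / of_int (dd t (Inl k))"
    using pos_skew[of j "Inl k"] .
  have "of_int (bmat t (Inl k) i) * (of_int (pos (- bmat t j (Inl k))) / of_int (dd t j) :: rat) =
      of_int (bmat t (Inl k) i) * (of_int (pos (bmat t (Inl k) j)) / of_int (dd t (Inl k)))"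
    unfolding ps ..
  then show "omega (mutate t k) (basis i) (basis j) = omega t (mut_N t k (basis i)) (mut_N t k (basis j))"
    by (auto simp: mut_N_basis omega_add omega_scale omega_basis mutate_bmat pos_def[of 0]
        add_divide_distrib algebra_simps)
qed (simp_all add: additive_def omega_add additive.add[OF mut_N_additive])

text \<open>Entry by entry this is the matrix mutation rule rewritten with [x]_+ = x + [-x]_+. It is
  what lets p^* intertwine the lattice parts of the two kinds of mutation.\<close>

lemma mut_M_pstar: "mut_M t k (pstar (mutate t k) n) = pstar t (mut_N t k n)"
proof (induction n rule: lattice_induct)
  case (basis j)
  have pd: "pos (bmat t i (Inl k)) = bmat t i (Inl k) + pos (- bmat t i (Inl k))" for i
    using pos_diff[of "bmat t i (Inl k)"] by simp
  show ?case
    by (auto simp: vec_eq_iff mut_M_nth pstar_basis mutate_bmat mut_N_basis additive.add[OF pstar_additive]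
        additive_int_scale_vec[OF pstar_additive] pos_def[of 0] pd algebra_simps)
next
  case (add m n)
  then show ?case
    by (simp add: additive.add[OF pstar_additive] additive.add[OF mut_M_additive] additive.add[OF mut_N_additive])
next
  case (uminus m)
  then show ?case
    by (simp add: additive.minus[OF pstar_additive] additive.minus[OF mut_M_additive] additive.minus[OF mut_N_additive])
qed

lemma pstar_mutate: "pstar (mutate t k) n = mut_M t k (pstar t (mut_N t k n))"
  using mut_M_pstar[of k n] mut_M_invol by metis

text \<open>Skewness of the mutated matrix is skewness of \<omega> pulled back along
  \<open>mut_N\<close>.\<close>

lemma is_seed_mutate: "is_seed (mutate t k)"
proof -
  have *: "(of_int (bmat (mutate t k) i j) :: rat) / of_int (dd t i) = - (of_int (bmat (mutate t k) j i) / of_int (dd t j))" for i j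
    using omega_skew[of "mut_N t k (basis j)" "mut_N t k (basis i)"]
    unfolding omega_mutate[symmetric] omega_basis dd_mutate .
  show ?thesis
    unfolding is_seed_def dd_mutate times_divide_eq_left mult.left_neutral using dd_pos * by blast
qed

lemma mut_M_mut_M: "mut_M t k (mut_M (mutate t k) k m) = m + m $ Inl k *s pstar t (basis (Inl k))"
proof -
  have pd: "pos (bmat t i (Inl k)) = bmat t i (Inl k) + pos (- bmat t i (Inl k))" for i
    using pos_diff[of "bmat t i (Inl k)"] by simp
  show ?thesis
    by (auto simp: vec_eq_iff mut_M_nth pstar_basis mutate_bmat pos_def[of 0] pd algebra_simps)
qed

lemma mut_N_mut_N:
  "mut_N t k (mut_N (mutate t k) k n) = n + (\<Sum>j\<in>UNIV. bmat t (Inl k) j * n $ j) *s basis (Inl k)"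
proof -
  have "(\<Sum>j\<in>UNIV. bmat t (Inl k) j * n $ j) =
      (\<Sum>j\<in>UNIV. pos (bmat t (Inl k) j) * n $ j) - (\<Sum>j\<in>UNIV. pos (- bmat t (Inl k) j) * n $ j)"
    unfolding sum_subtractf[symmetric] left_diff_distrib[symmetric] pos_diff ..
  moreover have "mut_N (mutate t k) k n $ i =
      (if i = Inl k then (\<Sum>j\<in>UNIV. pos (- bmat t (Inl k) j) * n $ j) - n $ i else n $ i)" for i
    by (simp add: mut_N_def axis_def mutate_bmat)
  ultimately show ?thesis
    using mut_N_sum[of 1 k "mutate t k" n]
    by (simp add: vec_eq_iff mut_N_nth axis_def)
qed

lemma bmat_mutate_mutate: "bmat (mutate (mutate t k) k) = bmat t"
proof (intro ext)
  fix i j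
  have pd: "pos (bmat t i j) = bmat t i j + pos (- bmat t i j)" for i j
    using pos_diff[of "bmat t i j"] by simp
  show "bmat (mutate (mutate t k) k) i j = bmat t i j"
    by (auto simp: mutate_bmat pd[of i "Inl k"] pd[of "Inl k" j] algebra_simps)
qed

context
  assumes c: "compatible_poisson t"
begin

lemma lam_form_skew: "lam_form t m n = - lam_form t n m"
proof (rule biadditive_eqI)
  show "lam_form t (basis i) (basis j) = - lam_form t (basis j) (basis i)" for i j
    using c unfolding lam_form_basis compatible_poisson_def by blast
qed (simp_all add: additive_def lam_form_add)

lemma lam_form_pstar: "lam_form t m (pstar t (basis (Inl k))) = - of_int (m $ Inl k) / of_int (dd t (Inl k))"
proof -
  have "lam_form t m (pstar t (basis (Inl k))) =
      (\<Sum>i\<in>UNIV. of_int (m $ i) * (if i = Inl k then - (1 / of_int (dd t (Inl k))) else 0))"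
    using additive_expand[OF lam_form_additive(2)[of t "pstar t (basis (Inl k))"], of m] c
    by (simp add: compatible_poisson_def)
  also have "\<dots> = (\<Sum>i\<in>UNIV. if i = Inl k then - of_int (m $ i) / of_int (dd t (Inl k)) else 0)"
    by (intro sum.cong refl) simp
  finally show ?thesis by simp
qed

lemma lam_form_pstar_left: "lam_form t (pstar t (basis (Inl k))) m = of_int (m $ Inl k) / of_int (dd t (Inl k))"
  using lam_form_skew[of "pstar t (basis (Inl k))" m] by (simp add: lam_form_pstar)

lemma compatible_poisson_mutate: "compatible_poisson (mutate t k)"
  unfolding compatible_poisson_def
proof (intro conjI allI)
  fix i j
  show "lam (mutate t k) i j = - lam (mutate t k) j i"
    using lam_form_skew[of "mut_M t k (basis i)" "mut_M t k (basis j)"] by (simp add: mutate_def)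
next
  fix i j
  have "lam_form (mutate t k) (basis i) (pstar (mutate t k) (basis (Inl j))) =
      lam_form t (mut_M t k (basis i)) (pstar t (mut_N t k (basis (Inl j))))"
    by (simp add: lam_form_mutate mut_M_pstar)
  also have "\<dots> = (if i = Inl j then - (1 / of_int (dd t (Inl j))) else 0)"
    using pos_skew[of "Inl j" "Inl k"]
    by (auto simp: mut_N_basis additive.add[OF pstar_additive] additive_int_scale_vec[OF pstar_additive]
      lam_form_add lam_form_scale lam_form_pstar mut_M_nth pos_def[of 0] basis_nth)
  finally show "lam_form (mutate t k) (basis i) (pstar (mutate t k) (basis (Inl j))) =
      (if i = Inl j then - (1 / of_int (dd (mutate t k) (Inl j))) else 0)" by simp
qed

text \<open>Although the two isometries compose to m to m + m_k p^* e_k, the form \<lambda> returns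
  to itself: by compatibility the two cross terms m_k n_k / d_k cancel, and \<lambda> vanishes on
  p^* e_k paired with itself.\<close>

lemma mutate_mutate: "mutate (mutate t k) k = t"
proof (rule seed.equality)
  show "lam (mutate (mutate t k) k) = lam t"
  proof (intro ext)
    fix i j
    have "lam (mutate (mutate t k) k) i j = lam_form (mutate (mutate t k) k) (basis i) (basis j)"
      by (simp add: lam_form_basis)
    also have "\<dots> = lam_form t (mut_M t k (mut_M (mutate t k) k (basis i))) (mut_M t k (mut_M (mutate t k) k (basis j)))"
      by (simp add: lam_form_mutate)
    also have "\<dots> = lam_form t (basis i) (basis j)"
      unfolding mut_M_mut_M
      by (simp add: lam_form_add lam_form_scale lam_form_pstar lam_form_pstar_left pstar_basis)
    finally show "lam (mutate (mutate t k) k) i j = lam t i j" by (simp add: lam_form_basis)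
  qed
qed (simp_all add: bmat_mutate_mutate)

end

end

text \<open>A package stable under mutation. Divisibility and integrality keep all exponents of v in
  (1/d)Z; the last two conditions make p^* an isometric isomorphism from - \<omega> to
  \<lambda>.\<close>

definition good_seed :: "int \<Rightarrow> ('u::finite, 'f::finite) seed \<Rightarrow> bool" where
  "good_seed d t \<longleftrightarrow> is_seed t \<and> compatible_poisson t \<and> (\<forall>i. dd t i dvd d) \<and>
     (\<forall>i j. lam t i j * of_int d \<in> \<int>) \<and>
     (\<forall>m n. lam_form t (pstar t m) (pstar t n) = - omega t m n) \<and> bij (pstar t)"

lemma lam_form_integral:
  assumes "\<And>i j. lam t i j * of_int d \<in> \<int>"
  shows "lam_form t m n * of_int d \<in> \<int>"
  unfolding lam_form_def sum_distrib_right
  by (intro Ints_sum) (use assms in \<open>simp add: mult.assoc\<close>)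

lemma good_seed_mutate:
  assumes "good_seed d t" shows "good_seed d (mutate t k)"
proof -
  have t: "is_seed t" "compatible_poisson t" "\<And>i. dd t i dvd d" "\<And>i j. lam t i j * of_int d \<in> \<int>"
    "\<And>m n. lam_form t (pstar t m) (pstar t n) = - omega t m n" "bij (pstar t)"
    using assms by (auto simp: good_seed_def)
  have "pstar (mutate t k) = mut_M t k \<circ> (pstar t \<circ> mut_N t k)"
    using pstar_mutate[OF t(1)] by (simp add: fun_eq_iff)
  then have "bij (pstar (mutate t k))"
    using mut_M_bij[OF t(1)] mut_N_bij[OF t(1)] t(6) by (simp add: bij_comp)
  moreover have "lam (mutate t k) i j * of_int d \<in> \<int>" for i j
    using lam_form_integral[OF t(4)] by (simp add: mutate_def)
  ultimately show ?thesis
    unfolding good_seed_def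
    using is_seed_mutate[OF t(1)] compatible_poisson_mutate[OF t(1,2)] t(3,5)
    by (simp add: lam_form_mutate mut_M_pstar[OF t(1)] omega_mutate[OF t(1)])
qed

text \<open>The alternatives are the classical and the quantum case; each supplies
  \<open>e_generic\<close> at e = 1/d_k.\<close>

locale quantum_base = qbase v d for v :: "rat \<Rightarrow> 'k::idom" and d :: int +
  assumes v_generic: "(\<forall>q. q * of_int d \<in> \<int> \<longrightarrow> v q = 1) \<or>
    (\<forall>q > 0. q * of_int d \<in> \<int> \<longrightarrow> v q \<noteq> v (- q))"
begin

lemma good_seed_dd:
  assumes "good_seed d t" shows "dd t i > 0" "1 / of_int (dd t i) * of_int d \<in> (\<int> :: rat set)"
proof -
  have "is_seed t" using assms by (simp add: good_seed_def)
  then show "dd t i > 0" by (rule dd_pos)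
  then show "1 / of_int (dd t i) * of_int d \<in> (\<int> :: rat set)"
    using assms by (auto simp: good_seed_def elim!: dvdE[of "dd t i"] dest!: spec[of _ i])
qed

lemma qexp_dd:
  assumes "good_seed d t" shows "qexp v d (1 / of_int (dd t i))"
proof
  note d = good_seed_dd[OF assms, of i]
  show "1 / of_int (dd t i) * of_int d \<in> (\<int> :: rat set)" by (rule d(2))
  show "v (1 / of_int (dd t i)) = 1 \<or>
      (\<forall>n\<ge>1. v (of_nat n * (1 / of_int (dd t i))) \<noteq> v (- (of_nat n * (1 / of_int (dd t i)))))"
    using v_generic
  proof
    assume "\<forall>q > 0. q * of_int d \<in> \<int> \<longrightarrow> v q \<noteq> v (- q)"
    moreover have "of_nat n * (1 / of_int (dd t i)) * of_int d \<in> (\<int> :: rat set)" for n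
      using Ints_mult[OF Ints_of_nat d(2), of n] by (simp add: mult.assoc)
    moreover have "of_nat n * (1 / of_int (dd t i)) > (0 :: rat)" if "n \<ge> 1" for n
      using d(1) that by simp
    ultimately show ?thesis by blast
  qed (use d(2) in blast)
qed

lemma qtorus_A:
  assumes "good_seed d t" shows "qtorus v d (lam_form t)"
proof unfold_locales
  have t: "is_seed t" "compatible_poisson t" "\<And>i j. lam t i j * of_int d \<in> \<int>"
    using assms by (auto simp: good_seed_def)
  show "lam_form t m n = - lam_form t n m" for m n by (rule lam_form_skew[OF t(1,2)])
  show "lam_form t m n * of_int d \<in> \<int>" for m n by (rule lam_form_integral[OF t(3)])
qed (simp add: lam_form_add)

lemma omega_integral:
  assumes "good_seed d t" shows "omega t m n * of_int d \<in> \<int>"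
proof -
  have "1 / of_int (dd t j) * of_int b * of_int d \<in> (\<int> :: rat set)" for j b
    using Ints_mult[OF good_seed_dd(2)[OF assms, of j] Ints_of_int[of b]] by (simp add: mult_ac)
  then show ?thesis
    unfolding omega_def sum_distrib_right by (intro Ints_sum) (simp only: mult.assoc Ints_mult Ints_of_int)
qed

lemma qtorus_X:
  assumes "good_seed d t" shows "qtorus v d (\<lambda>n n'. - omega t n n')"
proof unfold_locales
  have t: "is_seed t" using assms by (simp add: good_seed_def)
  show "- omega t m n = - (- omega t n m)" for m n using omega_skew[OF t, of m n] by simp
  show "- omega t m n * of_int d \<in> \<int>" for m n using omega_integral[OF assms, of m n] by simp
qed (simp add: omega_add)

text \<open>Compatibility reads \<lambda>(m, p^* e_k) = - m_k / d_k, which gives both the scale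
  1/d_k and the level - m_k.\<close>

lemma qmut_A:
  assumes "good_seed d t"
  shows "qmut v d (lam_form t) (1 / of_int (dd t (Inl k))) (pstar t (basis (Inl k))) (\<lambda>m. - m $ Inl k)"
proof -
  have t: "is_seed t" "compatible_poisson t" using assms by (auto simp: good_seed_def)
  note d = good_seed_dd[OF assms, of "Inl k"]
  show ?thesis
  proof (intro qmut.intro qmut_axioms.intro qtorus_A qexp_dd assms)
    show "pstar t (basis (Inl k)) \<noteq> 0"
    proof
      assume "pstar t (basis (Inl k)) = 0"
      then have "lam_form t (basis (Inl k)) 0 = - (1 / of_int (dd t (Inl k)))"
        using lam_form_pstar[OF t, of "basis (Inl k)" k] by simp
      then show False using d(1) by (simp add: additive.zero[OF lam_form_additive(1)])
    qed
  qed (use d(1) in \<open>simp_all add: lam_form_pstar[OF t]\<close>)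
qed

text \<open>Here e_i has level - b_ki, whose sign is the case distinction in the X mutation
  rule.\<close>

lemma qmut_X:
  assumes "good_seed d t"
  shows "qmut v d (\<lambda>n n'. - omega t n n') (1 / of_int (dd t (Inl k))) (basis (Inl k))
    (\<lambda>n. - (\<Sum>j\<in>UNIV. bmat t (Inl k) j * n $ j))"
proof -
  note d = good_seed_dd[OF assms, of "Inl k"]
  show ?thesis
  proof (intro qmut.intro qmut_axioms.intro qtorus_X qexp_dd assms)
    show "basis (Inl k) \<noteq> (0 :: int ^ ('a + 'b))" by (simp add: axis_eq_0_iff)
    show "- omega t m (basis (Inl k)) =
        of_int (- (\<Sum>j\<in>UNIV. bmat t (Inl k) j * m $ j)) * (1 / of_int (dd t (Inl k)))" for m
      using additive_expand[OF omega_additive(2)[of t "basis (Inl k)"], of m]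
      by (simp add: omega_basis sum_divide_distrib mult.commute)
  qed (use d(1) in simp)
qed

lemma torus_iso_A:
  assumes "good_seed d t"
  shows "torus_iso v d (lam_form (mutate t k)) (lam_form t) (mut_M t k)"
proof (intro torus_iso.intro torus_iso_axioms.intro qtorus_A assms good_seed_mutate mut_M_additive)
  have "is_seed t" using assms by (simp add: good_seed_def)
  then show "bij (mut_M t k)" by (rule mut_M_bij)
qed (simp add: lam_form_mutate)

lemma torus_iso_X:
  assumes "good_seed d t"
  shows "torus_iso v d (\<lambda>n n'. - omega (mutate t k) n n') (\<lambda>n n'. - omega t n n') (mut_N t k)"
proof -
  have t: "is_seed t" using assms by (simp add: good_seed_def)
  show ?thesis
    by (intro torus_iso.intro torus_iso_axioms.intro qtorus_X assms good_seed_mutate mut_N_additive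
        mut_N_bij t) (simp add: omega_mutate[OF t])
qed

text \<open>The transported f_k has level 1, so its binomial image has two terms, and adding w = p^*
  e_k turns the exponents [-b_jk]_+ into [b_jk]_+. All other variables have level 0 and are
  fixed.\<close>

lemma mutation_step_A:
  assumes t: "good_seed d t"
  shows "mutation_step v d (lam_form t) (lam_form (mutate t k)) (1 / of_int (dd t (Inl k)))
    (pstar t (basis (Inl k))) (\<lambda>m. - m $ Inl k) (mut_M t k) (mutation_A v t k)"
proof -
  have s: "is_seed t" using t by (simp add: good_seed_def)
  let ?e = "1 / of_int (dd t (Inl k))" and ?w = "pstar t (basis (Inl k))"
  obtain \<mu> where "mutation_step v d (lam_form t) (lam_form (mutate t k)) ?e ?w
      (\<lambda>m. - m $ Inl k) (mut_M t k) \<mu>"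
    using mutation_step_exists[OF qmut_A[OF t] torus_iso_A[OF t]] .
  then interpret S: mutation_step v d "lam_form t" "lam_form (mutate t k)" ?e ?w
      "\<lambda>m. - m $ Inl k" "mut_M t k" \<mu> .
  have "\<mu> (to_frac S.I.T.QT (monomial (basis i))) = image_A v t k i" for i
  proof (cases "i = Inl k")
    case True
    have lv: "- (mut_M t k (basis (Inl k)) $ Inl k) = 1" using s by (simp add: mut_M_nth pos_def[of 0])
    have w: "mut_M t k (basis (Inl k)) + ?w = - basis (Inl k) + (\<Sum>j\<in>UNIV. pos (bmat t j (Inl k)) *s basis j)"
    proof -
      have "?w = (\<Sum>j\<in>UNIV. bmat t j (Inl k) *s basis j)"
        using basis_expansion[of ?w, symmetric] by (simp add: pstar_basis)
      moreover have "pos (bmat t j (Inl k)) = pos (- bmat t j (Inl k)) + bmat t j (Inl k)" for j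
        using pos_diff[of "bmat t j (Inl k)"] by simp
      ultimately show ?thesis
        unfolding mut_M_basis_self by (simp add: vector_sadd_rdistrib sum.distrib)
    qed
    have "binomial_image v ?e ?w 1 (mut_M t k (basis (Inl k))) =
        monomial (mut_M t k (basis (Inl k))) + monomial (mut_M t k (basis (Inl k)) + ?w)"
      by (simp add: binomial_image_def S.M.qb_Suc_W)
    moreover have "image_A v t k (Inl k) =
        to_frac S.M.QT (monomial (mut_M t k (basis (Inl k))) + monomial (mut_M t k (basis (Inl k)) + ?w))"
      unfolding image_A_def LPA_def w by (simp only: mut_M_basis_self simp_thms if_True)
    ultimately show ?thesis
      using S.\<mu>_monomial[of "basis (Inl k)"] True lv by simp
  next
    case False
    have "mut_M t k (basis i) = basis i"
      using False by (simp add: vec_eq_iff mut_M_nth basis_nth)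
    then show ?thesis
      using S.\<mu>_monomial[of "basis i"] False by (simp add: image_A_def LPA_def binomial_image_def basis_nth)
  qed
  then have "mutation_A v t k = restrict \<mu> (carrier (Frac S.I.T.QT))"
    unfolding mutation_A_def LPA_def by (rule S.I.T.iso_on_variables_eq[OF S.M.R.ore_domain_axioms S.\<mu>_iso])
  then show ?thesis using S.\<mu>_restrict by simp
qed

text \<open>For i other than k the transported vector e_i + [b_ki]_+ e_k has level - b_ki. If b_ki
  <= 0 the image is explicit; if b_ki > 0 it is the inverse of the image at - e_i, and the shift by
  [b_ki]_+ appears as s - b_ki in the exponents.\<close>

lemma mutation_step_X:
  assumes t: "good_seed d t"
  shows "mutation_step v d (\<lambda>n n'. - omega t n n') (\<lambda>n n'. - omega (mutate t k) n n') (1 / of_int (dd t (Inl k)))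
    (basis (Inl k)) (\<lambda>n. - (\<Sum>j\<in>UNIV. bmat t (Inl k) j * n $ j)) (mut_N t k) (mutation_X v t k)"
proof -
  have s: "is_seed t" using t by (simp add: good_seed_def)
  let ?e = "1 / of_int (dd t (Inl k))" and ?lv = "\<lambda>n. - (\<Sum>j\<in>UNIV. bmat t (Inl k) j * n $ j)"
  obtain \<mu> where "mutation_step v d (\<lambda>n n'. - omega t n n') (\<lambda>n n'. - omega (mutate t k) n n') ?e
      (basis (Inl k)) ?lv (mut_N t k) \<mu>"
    using mutation_step_exists[OF qmut_X[OF t] torus_iso_X[OF t]] .
  then interpret S: mutation_step v d "\<lambda>n n'. - omega t n n'" "\<lambda>n n'. - omega (mutate t k) n n'" ?e
      "basis (Inl k)" ?lv "mut_N t k" \<mu> .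
  have lvb: "?lv (basis i) = - bmat t (Inl k) i" for i
    using sum_basis[of i "bmat t (Inl k)"] by (simp add: mult.commute)
  have "\<mu> (to_frac S.I.T.QT (monomial (basis i))) = image_X v t k i" for i
  proof (cases "i = Inl k")
    case True
    have "mut_N t k (basis (Inl k)) = - basis (Inl k)"
      using s by (simp add: mut_N_basis pos_def[of 0] vec_eq_iff)
    moreover have "?lv (- basis (Inl k)) = 0" unfolding S.M.lv_uminus lvb using s by simp
    ultimately show ?thesis
      using S.\<mu>_monomial[of "basis (Inl k)"] True
      by (simp add: image_X_def LPX_def binomial_image_def)
  next
    case False
    let ?b = "bmat t (Inl k) i"
    have \<tau>: "mut_N t k (basis i) = basis i + pos ?b *s basis (Inl k)"
      using False by (simp add: mut_N_basis)
    have lv: "?lv (mut_N t k (basis i)) = - ?b"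
      unfolding \<tau> S.M.lv_add S.M.lv_scale lvb using s by simp
    show ?thesis
    proof (cases "?b \<le> 0")
      case b: True
      have "binomial_image v ?e (basis (Inl k)) (- ?b) (basis i) =
          (\<Sum>s\<in>{0..nat (- ?b)}. Poly_Mapping.single (basis i + int s *s basis (Inl k)) (qbinom v ?e (nat (- ?b)) s))"
        unfolding binomial_image_def atMost_atLeast0
        by (intro sum.cong refl) (simp add: S.M.qbinom_eq_qb)
      moreover have "mut_N t k (basis i) = basis i" using b \<tau> by (simp add: pos_def)
      ultimately show ?thesis
        using S.\<mu>_monomial[of "basis i"] False b lv by (simp add: image_X_def LPX_def Let_def)
    next
      case b: False
      have "binomial_image v ?e (basis (Inl k)) ?b (- mut_N t k (basis i)) =
          (\<Sum>s\<in>{0..nat ?b}. Poly_Mapping.single (- basis i + (int s - ?b) *s basis (Inl k)) (qbinom v ?e (nat ?b) s))"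
        unfolding binomial_image_def atMost_atLeast0
      proof (intro sum.cong refl)
        fix s assume "s \<in> {0..nat ?b}"
        moreover have "- mut_N t k (basis i) + int s *s basis (Inl k) = - basis i + (int s - ?b) *s basis (Inl k)"
          using b by (simp add: \<tau> pos_def vec_eq_iff algebra_simps)
        ultimately show "Poly_Mapping.single (- mut_N t k (basis i) + int s *s basis (Inl k)) (qb v ?e (nat ?b) s) =
            Poly_Mapping.single (- basis i + (int s - ?b) *s basis (Inl k)) (qbinom v ?e (nat ?b) s)"
          by (simp add: S.M.qbinom_eq_qb)
      qed
      then show ?thesis
        using S.monomial_inv[of "basis i"] False b lv by (simp add: image_X_def LPX_def Let_def)
    qed
  qed
  then have "mutation_X v t k = restrict \<mu> (carrier (Frac S.I.T.QT))"
    unfolding mutation_X_def LPX_def by (rule S.I.T.iso_on_variables_eq[OF S.M.R.ore_domain_axioms S.\<mu>_iso])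
  then show ?thesis using S.\<mu>_restrict by simp
qed

sublocale A: mutation_system v d "good_seed d" lam_form "\<lambda>t k. pstar t (basis (Inl k))" "\<lambda>t k m. - m $ Inl k"
  mut_M "mutation_A v"
proof (rule mutation_system.intro, goal_cases)
  case (1 t k)
  then show ?case by (rule good_seed_mutate)
next
  case (2 t k)
  then show ?case unfolding good_seed_def using mutate_mutate by blast
next
  case (3 t k)
  then show ?case by (rule mutation_step_A)
next
  case (4 t k j)
  then have "is_seed t" by (simp add: good_seed_def)
  then show ?case
    by (auto simp: mut_M_pstar mut_N_basis pos_def[of 0] additive.add[OF pstar_additive]
        additive_int_scale_vec[OF pstar_additive] vec_eq_iff)
next
  case (5 t k m)
  then have "is_seed t" by (simp add: good_seed_def)
  then show ?case by (simp add: mut_M_mut_M vec_eq_iff)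
qed

sublocale X: mutation_system v d "good_seed d" "\<lambda>t n n'. - omega t n n'" "\<lambda>t k. basis (Inl k)"
  "\<lambda>t k n. - (\<Sum>j\<in>UNIV. bmat t (Inl k) j * n $ j)" mut_N "mutation_X v"
proof (rule mutation_system.intro, goal_cases)
  case (1 t k)
  then show ?case by (rule good_seed_mutate)
next
  case (2 t k)
  then show ?case unfolding good_seed_def using mutate_mutate by blast
next
  case (3 t k)
  then show ?case by (rule mutation_step_X)
next
  case (4 t k j)
  then have "is_seed t" by (simp add: good_seed_def)
  then show ?case by (auto simp: mut_N_basis pos_def[of 0] vec_eq_iff)
next
  case (5 t k m)
  then have "is_seed t" by (simp add: good_seed_def)
  then show ?case by (simp add: mut_N_mut_N vec_eq_iff)
qed

lemma mutation_seq_A_eq: "mutation_seq_A v t ks = mutation_seq (mutation_A v) t ks"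
  by (induction ks arbitrary: t) simp_all

lemma mutation_seq_X_eq: "mutation_seq_X v t ks = mutation_seq (mutation_X v) t ks"
  by (induction ks arbitrary: t) simp_all

lemma upper_A_eq: "upper_A v t = A.upper t"
  by (simp add: upper_A_def A.upper_def mutation_seq_A_eq LPA_def quantum_torus_def)

lemma upper_X_eq: "upper_X v t = X.upper t"
  by (simp add: upper_X_def X.upper_def mutation_seq_X_eq LPX_def quantum_torus_def)

lemma torus_iso_pstar:
  assumes "good_seed d t"
  shows "torus_iso v d (\<lambda>n n'. - omega t n n') (lam_form t) (pstar t)"
  by (intro torus_iso.intro torus_iso_axioms.intro qtorus_A qtorus_X assms pstar_additive)
    (use assms in \<open>simp_all add: good_seed_def\<close>)

abbreviation "PF t \<equiv> frac_map (X.T t) (A.T t) UNIV (monomial_map (pstar t))"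

text \<open>At every seed p^* is an isometry taking the X vector e_k to the A vector p^* e_k and
  intertwining \<open>mut_N\<close> with \<open>mut_M\<close>; naturality of a single step then
  applies along the sequence.\<close>

lemma pstar_mutation_seq:
  assumes "good_seed d t" "x \<in> X.K (mutate_seq t ks)"
  shows "PF t (X.ms t ks x) = A.ms t ks (PF (mutate_seq t ks) x)"
  using assms
proof (induction ks arbitrary: t)
  case (Cons k ks)
  note t = \<open>good_seed d t\<close>
  have s: "is_seed t" using t by (simp add: good_seed_def)
  have "X.ms (mutate t k) ks x \<in> X.K (mutate t k)"
    using ring_hom_closed[OF frac_algebra_iso_hom[OF X.mutation_seq_iso[OF good_seed_mutate[OF t]]]] Cons.prems by simp
  then show ?case
    using mutation_step_natural[OF mutation_step_X[OF t] mutation_step_A[OF t] torus_iso_pstar[OF t]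
        torus_iso_pstar[OF good_seed_mutate[OF t]] refl mut_M_pstar[OF s], of "X.ms (mutate t k) ks x"]
      Cons.IH[OF good_seed_mutate[OF t]] Cons.prems by simp
qed simp

lemma pstar_frac_eq:
  assumes t: "good_seed d t"
  shows "pstar_frac v t (to_frac (LPX v t) p) = PF t (to_frac (LPX v t) p)"
proof -
  interpret P: torus_iso v d "\<lambda>n n'. - omega t n n'" "lam_form t" "pstar t" by (rule torus_iso_pstar[OF t])
  have "inv_into UNIV (to_frac P.T.QT) (to_frac P.T.QT p) = p"
    by (rule inv_into_f_f) (auto simp: inj_def P.T.to_frac_eq_iff)
  then show ?thesis
    by (simp add: pstar_frac_def LPA_def LPX_def P.VF_to_frac P.T.QT_simps(1))
qed

end

section \<open>Variation maps for principal coefficients\<close>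

primrec mut_M_seq :: "('u::finite, 'f::finite) seed \<Rightarrow> 'u list \<Rightarrow> ('u, 'f) lattice \<Rightarrow> ('u, 'f) lattice" where
  "mut_M_seq t [] = id"
| "mut_M_seq t (k # ks) = mut_M t k \<circ> mut_M_seq (mutate t k) ks"

primrec mut_N_seq :: "('u::finite, 'f::finite) seed \<Rightarrow> 'u list \<Rightarrow> ('u, 'f) lattice \<Rightarrow> ('u, 'f) lattice" where
  "mut_N_seq t [] = id"
| "mut_N_seq t (k # ks) = mut_N t k \<circ> mut_N_seq (mutate t k) ks"

lemma mut_M_seq_additive: "additive (mut_M_seq t ks)"
  by (induction ks arbitrary: t) (simp_all add: additive_def mut_M_additive[THEN additive.add])

lemma mut_N_seq_additive: "additive (mut_N_seq t ks)"
  by (induction ks arbitrary: t) (simp_all add: additive_def mut_N_additive[THEN additive.add])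

lemma mut_M_seq_bij: "is_seed t \<Longrightarrow> bij (mut_M_seq t ks)"
  by (induction ks arbitrary: t) (simp_all add: bij_comp mut_M_bij is_seed_mutate)

lemma mut_N_seq_bij: "is_seed t \<Longrightarrow> bij (mut_N_seq t ks)"
  by (induction ks arbitrary: t) (simp_all add: bij_comp mut_N_bij is_seed_mutate)

lemma mut_M_seq_pstar:
  "is_seed t \<Longrightarrow> mut_M_seq t ks (pstar (mutate_seq t ks) n) = pstar t (mut_N_seq t ks n)"
  by (induction ks arbitrary: t) (simp_all add: mut_M_pstar is_seed_mutate)

lemma lam_form_mutate_seq:
  "lam_form (mutate_seq t ks) m n = lam_form t (mut_M_seq t ks m) (mut_M_seq t ks n)"
  by (induction ks arbitrary: t) (simp_all add: lam_form_mutate)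

text \<open>\<open>mut_M\<close> alters a vector only through its coordinate at an unfrozen
  vertex.\<close>

lemma mut_M_seq_frozen: "m \<in> frozen_M \<Longrightarrow> mut_M_seq t ks m = m"
proof (induction ks arbitrary: t)
  case (Cons k ks)
  moreover have "mut_M t k m = m"
    using Cons.prems by (auto simp: vec_eq_iff mut_M_nth frozen_M_def)
  ultimately show ?case by simp
qed simp

lemma mut_N_seq_Inr: "mut_N_seq t ks n $ Inr j = n $ Inr j"
  by (induction ks arbitrary: t) (simp_all add: mut_N_def axis_def)

definition unfrozen :: "('u \<Rightarrow> int) \<Rightarrow> int ^ ('u::finite + 'f::finite)" where
  "unfrozen a = (\<chi> i. case i of Inl k \<Rightarrow> a k | Inr j \<Rightarrow> 0)"

lemma unfrozen_nth [simp]: "unfrozen a $ Inl k = a k" "unfrozen a $ Inr j = 0"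
  by (simp_all add: unfrozen_def)

lemma vec_eq_Plus_iff:
  "m = n \<longleftrightarrow> (\<forall>k. m $ Inl k = n $ Inl k) \<and> (\<forall>j. m $ Inr j = n $ Inr j)"
  for m n :: "'b ^ ('u::finite + 'f::finite)"
proof -
  have "(\<forall>i. m $ i = n $ i) \<longleftrightarrow> (\<forall>k. m $ Inl k = n $ Inl k) \<and> (\<forall>j. m $ Inr j = n $ Inr j)"
    by (auto simp: split_sum_all)
  then show ?thesis by (simp add: vec_eq_iff)
qed

locale principal_seed =
  fixes t0 :: "('u::finite, 'u) seed"
  assumes seed: "is_seed t0" and principal: "principal_coefficients t0" and canonical: "canonical_poisson t0"
begin

lemma pstar_Inr: "pstar t0 n $ Inr k = n $ Inl k"
proof -
  have "pstar t0 n $ Inr k = (\<Sum>j\<in>UNIV. (if k = j then n $ Inl j else 0))"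
    using principal unfolding pstar_def
    by (simp add: sum_over_Plus principal_coefficients_def if_distrib[of "\<lambda>x. x * _"] cong: if_cong)
  then show ?thesis by simp
qed

lemma pstar_Inl: "pstar t0 n $ Inl k = (\<Sum>j\<in>UNIV. bmat t0 (Inl k) (Inl j) * n $ Inl j) - n $ Inr k"
proof -
  have "(\<Sum>j\<in>UNIV. bmat t0 (Inl k) (Inr j) * n $ Inr j) = (\<Sum>j\<in>UNIV. (if k = j then - n $ Inr j else 0))"
    using principal by (intro sum.cong) (auto simp: principal_coefficients_def)
  then show ?thesis by (simp add: pstar_def sum_over_Plus)
qed

lemma compatible: "compatible_poisson t0"
  using canonical_poisson_compatible[OF seed principal canonical] .

lemma bij_pstar: "bij (pstar t0)"
proof (rule bijI')
  fix m n
  show "pstar t0 m = pstar t0 n \<longleftrightarrow> m = n"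
  proof
    assume eq: "pstar t0 m = pstar t0 n"
    then have 1: "m $ Inl k = n $ Inl k" for k using pstar_Inr[of m k] pstar_Inr[of n k] by simp
    then have "m $ Inr k = n $ Inr k" for k
      using eq pstar_Inl[of m k] pstar_Inl[of n k] by simp
    with 1 show "m = n" by (simp add: vec_eq_Plus_iff)
  qed simp
next
  fix m
  define n :: "('u, 'u) lattice" where "n = (\<chi> i. case i of Inl k \<Rightarrow> m $ Inr k
    | Inr k \<Rightarrow> (\<Sum>j\<in>UNIV. bmat t0 (Inl k) (Inl j) * m $ Inr j) - m $ Inl k)"
  have "m = pstar t0 n"
    by (simp add: vec_eq_Plus_iff pstar_Inl pstar_Inr) (simp add: n_def)
  then show "\<exists>n. m = pstar t0 n" by blast
qed

lemma lam_pstar_isometry: "lam_form t0 (pstar t0 m) (pstar t0 n) = - omega t0 m n"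
proof (rule biadditive_eqI[of "\<lambda>m n. lam_form t0 (pstar t0 m) (pstar t0 n)" "\<lambda>m n. - omega t0 m n"])
  fix i j
  have *: "lam_form t0 (pstar t0 (basis i)) (pstar t0 (basis (Inl k))) = - omega t0 (basis i) (basis (Inl k))" for i k
    by (simp add: lam_form_pstar[OF seed compatible] pstar_basis omega_basis)
  show "lam_form t0 (pstar t0 (basis i)) (pstar t0 (basis j)) = - omega t0 (basis i) (basis j)"
  proof (cases i; cases j)
    fix a b assume ij: "i = Inr a" "j = Inr b"
    have p: "pstar t0 (basis (Inr a)) = - basis (Inl a)" for a
      using principal by (simp add: vec_eq_Plus_iff pstar_basis basis_nth principal_coefficients_def)
    have "lam t0 (Inl a) (Inl b) = 0" "bmat t0 (Inr b) (Inr a) = 0"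
      using canonical principal by (auto simp: canonical_poisson_def principal_coefficients_def)
    then show ?thesis by (simp add: ij p lam_form_minus lam_form_basis omega_basis)
  next
    fix a b assume ij: "i = Inl a" "j = Inr b"
    show ?thesis
      using *[of j a] lam_form_skew[OF seed compatible, of "pstar t0 (basis i)" "pstar t0 (basis j)"]
        omega_skew[OF seed, of "basis i" "basis j"] by (simp add: ij)
  qed (simp_all only: *)
qed (simp_all add: additive_def lam_form_add omega_add additive.add[OF pstar_additive])

lemma good_seed:
  assumes d: "\<And>i. dd t0 i dvd d" shows "good_seed d t0"
proof -
  have i: "1 / of_int (dd t0 i) * of_int d \<in> (\<int> :: rat set)" for i
  proof -
    obtain c where "d = dd t0 i * c" using d[of i] by (rule dvdE)
    then show ?thesis using dd_pos[OF seed, of i] by simp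
  qed
  have b: "of_int b * (1 / of_int (dd t0 i)) * of_int d \<in> (\<int> :: rat set)" for b i
    using Ints_mult[OF Ints_of_int i, of b i] by (simp add: mult.assoc)
  have "lam t0 i j * of_int d \<in> \<int>" for i j
  proof (cases i; cases j)
    fix a b assume "i = Inl a" "j = Inr b"
    then show ?thesis using canonical b[of "- 1" "Inr b"] by (simp add: canonical_poisson_def)
  next
    fix a b assume "i = Inr a" "j = Inl b"
    then show ?thesis using canonical i[of "Inl b"] by (simp add: canonical_poisson_def)
  next
    fix a c assume "i = Inr a" "j = Inr c"
    then show ?thesis using canonical b[of _ "Inr c"] by (simp only: canonical_poisson_def)
  qed (use canonical in \<open>simp add: canonical_poisson_def\<close>)
  then show ?thesis
    using seed compatible d lam_pstar_isometry bij_pstar by (simp add: good_seed_def)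
qed

text \<open>The vectors \<open>f\<^sub>k\<close> and \<open>p\<^sup>* e\<^sub>k\<close> with \<open>k\<close> unfrozen form a basis, since \<open>p\<^sup>* e\<^sub>k - f\<^sub>k\<^sub>'\<close> is unfrozen.\<close>

lemma additive_eqI:
  fixes f g :: "('u, 'u) lattice \<Rightarrow> rat"
  assumes f: "additive f" and g: "additive g"
    and 1: "\<And>k. f (basis (Inl k)) = g (basis (Inl k))"
    and 2: "\<And>k. f (pstar t0 (basis (Inl k))) = g (pstar t0 (basis (Inl k)))"
  shows "f m = g m"
proof -
  have e: "h (pstar t0 (basis (Inl k))) =
      (\<Sum>j\<in>UNIV. of_int (bmat t0 (Inl j) (Inl k)) * h (basis (Inl j))) + h (basis (Inr k))"
    if "additive h" for h :: "('u, 'u) lattice \<Rightarrow> rat" and k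
  proof -
    have "(\<Sum>j\<in>UNIV. of_int (pstar t0 (basis (Inl k)) $ Inr j) * h (basis (Inr j))) = h (basis (Inr k))"
      unfolding pstar_Inr basis_nth by (simp add: sum_delta_mult)
    then show ?thesis
      using additive_expand[OF that, of "pstar t0 (basis (Inl k))"] by (simp add: sum_over_Plus pstar_basis)
  qed
  have "f (basis (Inr k)) = g (basis (Inr k))" for k
    using e[OF f, of k] e[OF g, of k] 1 2 by simp
  then show ?thesis
    using additive_expand[OF f, of m] additive_expand[OF g, of m] 1 by (simp add: sum_over_Plus)
qed

lemma variation_exists:
  assumes \<sigma>: "bij \<sigma>" and sim: "similar \<sigma> t0 (mutate_seq t0 ks)"
  obtains V where "variation_M \<sigma> t0 (mutate_seq t0 ks) V" "bij V"
    "\<And>m n. lam_form (mutate_seq t0 ks) (V m) (V n) = lam_form t0 m n"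
proof -
  define t where "t = mutate_seq t0 ks"
  define \<tau> where "\<tau> = mut_M_seq t0 ks"
  define \<tau>' where "\<tau>' = mut_N_seq t0 ks"
  define \<sigma>' where "\<sigma>' = inv_into UNIV \<sigma>"
  have \<sigma>': "\<sigma>' (\<sigma> k) = k" "\<sigma> (\<sigma>' k) = k" for k
    using \<sigma> by (simp_all add: \<sigma>'_def bij_is_inj bij_is_surj surj_f_inv_f)
  have \<sigma>'_eq: "\<sigma>' j = k \<longleftrightarrow> j = \<sigma> k" for j k using \<sigma>' by metis
  note \<tau>_add = mut_M_seq_additive[of t0 ks, folded \<tau>_def] and \<tau>'_add = mut_N_seq_additive[of t0 ks, folded \<tau>'_def]
  have \<tau>_bij: "bij \<tau>" and \<tau>'_bij: "bij \<tau>'"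
    using mut_M_seq_bij[OF seed] mut_N_seq_bij[OF seed] by (simp_all add: \<tau>_def \<tau>'_def)
  have \<tau>_eq: "\<tau> m = \<tau> n \<longleftrightarrow> m = n" for m n using \<tau>_bij by (simp add: bij_is_inj inj_eq)
  have \<tau>_pstar: "\<tau> (pstar t n) = pstar t0 (\<tau>' n)" for n
    using mut_M_seq_pstar[OF seed] by (simp add: t_def \<tau>_def \<tau>'_def)
  have \<tau>_frozen: "m \<in> frozen_M \<Longrightarrow> \<tau> m = m" for m by (simp add: \<tau>_def mut_M_seq_frozen)
  have lam_t: "lam_form t m n = lam_form t0 (\<tau> m) (\<tau> n)" for m n by (simp add: t_def \<tau>_def lam_form_mutate_seq)
  define \<pi> where "\<pi> m = (unfrozen (\<lambda>k. m $ Inl k) :: ('u, 'u) lattice)" for m :: "('u, 'u) lattice"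
  define c where "c m = (unfrozen (\<lambda>k. m $ Inr (\<sigma>' k)) :: ('u, 'u) lattice)" for m :: "('u, 'u) lattice"
  define c0 where "c0 m = (unfrozen (\<lambda>k. m $ Inr k) :: ('u, 'u) lattice)" for m :: "('u, 'u) lattice"
  define a where "a m = (unfrozen (\<lambda>k. (m - pstar t0 (c0 m)) $ Inl (\<sigma>' k)) :: ('u, 'u) lattice)" for m :: "('u, 'u) lattice"
  define \<Theta> where "\<Theta> m = \<pi> (\<tau> (a m)) + pstar t0 (\<tau>' (c m))" for m
  define V where "V m = inv_into UNIV \<tau> (\<Theta> m)" for m
  have \<tau>V: "\<tau> (V m) = \<Theta> m" for m using \<tau>_bij by (simp add: V_def bij_is_surj surj_f_inv_f)
  have \<pi>_add: "additive \<pi>" and c_add: "additive c" and c0_add: "additive c0"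
    by (simp_all add: additive_def \<pi>_def c_def c0_def vec_eq_Plus_iff)
  have a_add: "additive a"
    by (simp add: additive_def a_def vec_eq_Plus_iff additive.add[OF c0_add] additive.add[OF pstar_additive])
  have \<Theta>_add: "additive \<Theta>"
    by (simp add: additive_def \<Theta>_def additive.add[OF \<pi>_add] additive.add[OF \<tau>_add] additive.add[OF a_add]
        additive.add[OF pstar_additive] additive.add[OF \<tau>'_add] additive.add[OF c_add])
  have V_add: "additive V"
    unfolding additive_def
  proof (intro allI)
    fix m n
    have "\<tau> (V (m + n)) = \<tau> (V m + V n)" by (simp only: \<tau>V additive.add[OF \<tau>_add] additive.add[OF \<Theta>_add])
    then show "V (m + n) = V m + V n" by (simp only: \<tau>_eq)
  qed
  have \<Theta>_f: "\<Theta> (basis (Inl k)) = \<pi> (\<tau> (basis (Inl (\<sigma> k))))" for k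
  proof -
    have z: "c (basis (Inl k)) = 0" "c0 (basis (Inl k)) = 0"
      by (simp_all add: c_def c0_def vec_eq_Plus_iff basis_nth)
    have "a (basis (Inl k)) = basis (Inl (\<sigma> k))"
      by (simp add: a_def z vec_eq_Plus_iff basis_nth additive.zero[OF pstar_additive] \<sigma>'_eq)
    then show ?thesis by (simp add: \<Theta>_def z additive.zero[OF \<tau>'_add] additive.zero[OF pstar_additive])
  qed
  have V_p: "V (pstar t0 (basis (Inl k))) = pstar t (basis (Inl (\<sigma> k)))" for k
  proof -
    have c: "c (pstar t0 (basis (Inl k))) = basis (Inl (\<sigma> k))"
      by (simp add: c_def pstar_Inr vec_eq_Plus_iff basis_nth \<sigma>'_eq)
    have c0: "c0 (pstar t0 (basis (Inl k))) = basis (Inl k)"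
      by (simp add: c0_def pstar_Inr vec_eq_Plus_iff basis_nth)
    have "a (pstar t0 (basis (Inl k))) = 0" unfolding a_def c0 by (simp add: vec_eq_Plus_iff)
    then have "\<Theta> (pstar t0 (basis (Inl k))) = \<tau> (pstar t (basis (Inl (\<sigma> k))))"
      by (simp add: \<Theta>_def c \<tau>_pstar additive.zero[OF \<tau>_add] additive.zero[OF \<pi>_add])
    then show ?thesis using \<tau>V[of "pstar t0 (basis (Inl k))"] by (simp add: \<tau>_eq)
  qed
  have \<pi>_frozen: "m - \<pi> m \<in> frozen_M" for m by (simp add: \<pi>_def frozen_M_def)
  \<comment> \<open>The projection \<pi> only removes a frozen vector, and \<tau> fixes frozen
    vectors, so the correction can be pulled back through \<tau>.\<close>
  have V_f: "\<exists>m\<in>frozen_M. V (basis (Inl k)) = basis (Inl (\<sigma> k)) + m" for k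
  proof -
    let ?m = "\<tau> (basis (Inl (\<sigma> k)))"
    have "\<tau> (V (basis (Inl k))) = \<tau> (basis (Inl (\<sigma> k)) - (?m - \<pi> ?m))"
      using additive.diff[OF \<tau>_add, of "basis (Inl (\<sigma> k))" "?m - \<pi> ?m"]
      by (simp add: \<tau>V \<Theta>_f \<tau>_frozen[OF \<pi>_frozen])
    then have "V (basis (Inl k)) = basis (Inl (\<sigma> k)) + - (?m - \<pi> ?m)" by (simp add: \<tau>_eq)
    moreover have "- (?m - \<pi> ?m) \<in> frozen_M" using \<pi>_frozen[of ?m] by (simp add: frozen_M_def)
    ultimately show ?thesis by blast
  qed
  have V_f_nth: "V (basis (Inl k)) $ Inl j = (if j = \<sigma> k then 1 else 0)" for k j
    using V_f[of k] by (auto simp: frozen_M_def basis_nth)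
  \<comment> \<open>This value is forced, because p^* e_k is f_k' plus the sum of b_ik f_i. Its
    unfrozen coordinates cancel since similarity matches the entries of B at both seeds.\<close>
  have V_f': "V (basis (Inr k)) \<in> frozen_M" for k
    unfolding frozen_M_def
  proof (intro CollectI allI)
    fix j
    have add: "additive (\<lambda>m. of_int (V m $ Inl j) :: rat)"
      by (simp add: additive_def additive.add[OF V_add])
    have "(of_int (V (pstar t0 (basis (Inl k))) $ Inl j) :: rat) =
        (\<Sum>i\<in>UNIV. of_int (bmat t0 (Inl i) (Inl k)) * of_int (V (basis (Inl i)) $ Inl j)) +
        (\<Sum>i\<in>UNIV. of_int (if i = k then 1 else 0) * of_int (V (basis (Inr i)) $ Inl j))"
      using additive_expand[OF add, of "pstar t0 (basis (Inl k))"]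
      by (simp add: sum_over_Plus pstar_basis pstar_Inr[of "basis (Inl k)", unfolded pstar_basis basis_nth])
    also have "(\<Sum>i\<in>UNIV. of_int (if i = k then 1 else 0) * of_int (V (basis (Inr i)) $ Inl j)) =
        (of_int (V (basis (Inr k)) $ Inl j) :: rat)"
      by (rule sum_delta_mult)
    also have "(\<Sum>i\<in>UNIV. of_int (bmat t0 (Inl i) (Inl k)) * of_int (V (basis (Inl i)) $ Inl j)) =
        (\<Sum>i\<in>UNIV. if i = \<sigma>' j then of_int (bmat t0 (Inl i) (Inl k)) else (0 :: rat))"
      by (intro sum.cong refl) (auto simp: V_f_nth \<sigma>')
    also have "\<dots> = of_int (bmat t (Inl j) (Inl (\<sigma> k)))"
      using sim \<sigma>' by (simp add: similar_def t_def)
    finally show "V (basis (Inr k)) $ Inl j = 0" by (simp add: V_p pstar_basis)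
  qed
  have "variation_M \<sigma> t0 t V"
    unfolding variation_M_def using V_add V_f V_f' V_p by blast
  moreover have "bij V"
  proof -
    have "inj \<Theta>"
    proof (rule injI)
      fix m n assume "\<Theta> m = \<Theta> n"
      then have z: "\<Theta> (m - n) = 0" by (simp add: additive.diff[OF \<Theta>_add])
      let ?m = "m - n"
      have "\<tau>' (c ?m) $ Inl k = 0" for k
        using arg_cong[OF z, of "\<lambda>x. x $ Inr k"] by (simp add: \<Theta>_def pstar_Inr \<pi>_def)
      moreover have "\<tau>' (c ?m) $ Inr k = 0" for k by (simp add: \<tau>'_def mut_N_seq_Inr c_def)
      ultimately have y: "\<tau>' (c ?m) = 0" by (simp add: vec_eq_Plus_iff)
      then have "c ?m = 0"
        using \<tau>'_bij additive.zero[OF \<tau>'_add] by (metis bij_is_inj injD)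
      then have r: "?m $ Inr k = 0" for k
      proof -
        have "c ?m $ Inl (\<sigma> k) = 0" using \<open>c ?m = 0\<close> by simp
        then show ?thesis by (simp only: c_def unfrozen_nth \<sigma>')
      qed
      then have c0: "c0 ?m = 0" by (simp add: c0_def vec_eq_Plus_iff)
      have "\<pi> (\<tau> (a ?m)) = 0" using z y by (simp add: \<Theta>_def additive.zero[OF pstar_additive])
      then have "\<tau> (a ?m) \<in> frozen_M" by (simp add: \<pi>_def frozen_M_def vec_eq_Plus_iff)
      \<comment> \<open>A frozen vector is fixed by \<tau>, so injectivity gives \<tau> (a m) = a m.
        This vector is at once frozen and unfrozen, hence zero.\<close>
      then have "\<tau> (a ?m) = a ?m" using \<tau>_frozen \<tau>_eq by metis
      with \<open>\<tau> (a ?m) \<in> frozen_M\<close> have "a ?m $ Inl (\<sigma> k) = 0" for k by (simp add: frozen_M_def)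
      then have "?m $ Inl k = 0" for k
        by (simp add: a_def c0 \<sigma>' additive.zero[OF pstar_additive])
      with r have "?m = 0" by (simp add: vec_eq_Plus_iff)
      then show "m = n" by simp
    qed
    moreover have "surj \<Theta>"
    proof (rule surjI)
      fix z :: "('u, 'u) lattice"
      obtain n where n: "\<tau>' n = c0 z" using \<tau>'_bij by (metis bij_pointE)
      have n_Inr: "n $ Inr k = 0" for k
        using arg_cong[OF n, of "\<lambda>x. x $ Inr k"] by (simp add: \<tau>'_def mut_N_seq_Inr c0_def)
      define x where "x = z - pstar t0 (c0 z)"
      have x_Inr: "x $ Inr k = 0" for k by (simp add: x_def pstar_Inr c0_def)
      obtain x' where x': "\<tau> x' = x" using \<tau>_bij by (metis bij_pointE)
      have "\<tau> (\<pi> x') = x - (x' - \<pi> x')"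
        using additive.diff[OF \<tau>_add, of x' "x' - \<pi> x'"] by (simp add: x' \<tau>_frozen[OF \<pi>_frozen])
      then have \<pi>x: "\<pi> (\<tau> (\<pi> x')) = x"
        using x_Inr by (simp add: \<pi>_def vec_eq_Plus_iff)
      define m where "m = unfrozen (\<lambda>k. x' $ Inl (\<sigma> k)) + pstar t0 (unfrozen (\<lambda>k. n $ Inl (\<sigma> k)))"
      have m_Inr: "m $ Inr k = n $ Inl (\<sigma> k)" for k by (simp add: m_def pstar_Inr)
      have "c m = n" using n_Inr by (simp add: c_def m_Inr \<sigma>' vec_eq_Plus_iff)
      moreover have "c0 m = unfrozen (\<lambda>k. n $ Inl (\<sigma> k))" by (simp add: c0_def m_Inr)
      then have "a m = \<pi> x'" by (simp add: a_def m_def \<sigma>' \<pi>_def)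
      ultimately have "\<Theta> m = z" by (simp add: \<Theta>_def n \<pi>x) (simp add: x_def)
      then show "\<Theta> (SOME m. \<Theta> m = z) = z" by (rule someI)
    qed
    ultimately have "bij (inv_into UNIV \<tau> \<circ> \<Theta>)"
      by (intro bij_comp bij_imp_bij_inv \<tau>_bij) (simp add: bij_def)
    moreover have "V = inv_into UNIV \<tau> \<circ> \<Theta>" by (simp add: V_def fun_eq_iff)
    ultimately show ?thesis by simp
  qed
  moreover have "lam_form t (V m) (V n) = lam_form t0 m n" for m n
  proof -
    have good: "is_seed t" "compatible_poisson t"
    proof -
      have "is_seed (mutate_seq s ks) \<and> compatible_poisson (mutate_seq s ks)"
        if "is_seed s" "compatible_poisson s" for s :: "('u, 'u) seed"
        using that by (induction ks arbitrary: s) (simp_all add: is_seed_mutate compatible_poisson_mutate)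
      then show "is_seed t" "compatible_poisson t" using seed compatible by (simp_all add: t_def)
    qed
    have dd: "dd t (Inl (\<sigma> k)) = dd t0 (Inl k)" and b: "bmat t (Inl (\<sigma> j)) (Inl (\<sigma> k)) = bmat t0 (Inl j) (Inl k)" for j k
      using sim by (simp_all add: similar_def t_def)
    let ?B = "\<lambda>m n. lam_form t (V m) (V n)"
    have B_add: "additive (?B m)" "additive (\<lambda>m. ?B m n)" for m n
      by (simp_all add: additive_def additive.add[OF V_add] lam_form_add)
    \<comment> \<open>Compatibility at both seeds expresses each pairing with p^* e_k through one
      unfrozen coordinate and d_k, which V respects up to \<sigma>.\<close>
    have right: "?B m (pstar t0 (basis (Inl k))) = lam_form t0 m (pstar t0 (basis (Inl k)))" for m k
    proof (rule additive_eqI[OF B_add(2) lam_form_additive(2)])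
      fix j
      show "?B (basis (Inl j)) (pstar t0 (basis (Inl k))) = lam_form t0 (basis (Inl j)) (pstar t0 (basis (Inl k)))"
        using \<sigma> by (simp add: V_p lam_form_pstar[OF good] lam_form_pstar[OF seed compatible] V_f_nth dd basis_nth
          bij_is_inj inj_eq)
      show "?B (pstar t0 (basis (Inl j))) (pstar t0 (basis (Inl k))) =
          lam_form t0 (pstar t0 (basis (Inl j))) (pstar t0 (basis (Inl k)))"
        by (simp add: V_p lam_form_pstar[OF good] lam_form_pstar[OF seed compatible] pstar_basis dd b)
    qed
    \<comment> \<open>What remains are the pairings of V f_j with V f_k. Their \<tau>-images were
      projected to the unfrozen span, which is isotropic for the canonical form.\<close>
    have uf: "lam_form t0 (\<pi> m) (\<pi> n) = 0" for m n
      unfolding lam_form_def sum_over_Plus using canonical by (simp add: \<pi>_def canonical_poisson_def)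
    have left: "?B (basis (Inl k)) n = lam_form t0 (basis (Inl k)) n" for k n
    proof (rule additive_eqI[OF B_add(1) lam_form_additive(1)])
      fix j
      show "?B (basis (Inl k)) (basis (Inl j)) = lam_form t0 (basis (Inl k)) (basis (Inl j))"
        using canonical by (simp add: lam_t \<tau>V \<Theta>_f uf lam_form_basis canonical_poisson_def)
    qed (rule right)
    have "?B (pstar t0 (basis (Inl k))) n = lam_form t0 (pstar t0 (basis (Inl k))) n" for k
      using right[of n k] lam_form_skew[OF good, of "V (pstar t0 (basis (Inl k)))" "V n"]
        lam_form_skew[OF seed compatible, of "pstar t0 (basis (Inl k))" n] by simp
    then show ?thesis
      using additive_eqI[OF B_add(2) lam_form_additive(2)] left by blast
  qed
  ultimately show ?thesis using that t_def by blast
qed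

end

section \<open>Twist automorphisms on both sides\<close>

context quantum_base
begin

lemma twist_A_X_exist:
  fixes t0 :: "('u::finite, 'u) seed"
  assumes p: "principal_seed t0" and d: "\<And>i. dd t0 i dvd d"
    and \<sigma>: "bij \<sigma>" and sim: "similar \<sigma> t0 (mutate_seq t0 ks)"
  obtains twA twX where "twist_A v \<sigma> t0 ks twA" "twist_X v \<sigma> t0 ks twX"
    "\<And>y. y \<in> upper_X v t0 \<Longrightarrow> pstar_frac v t0 (twX y) = twA (pstar_frac v t0 y)"
proof -
  interpret principal_seed t0 by (rule p)
  define t where "t = mutate_seq t0 ks"
  have good0: "good_seed d t0" using d by (rule good_seed)
  have good: "good_seed d t" unfolding t_def by (rule A.good_mutate_seq[OF good0])
  obtain V where V: "variation_M \<sigma> t0 t V" "bij V"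
    "\<And>m n. lam_form t (V m) (V n) = lam_form t0 m n"
    using variation_exists[OF \<sigma> sim] unfolding t_def by metis
  interpret VA: torus_iso v d "lam_form t0" "lam_form t" V
    using V by (intro torus_iso.intro torus_iso_axioms.intro qtorus_A good0 good) (simp_all add: variation_M_def)
  interpret P0: torus_iso v d "\<lambda>n n'. - omega t0 n n'" "lam_form t0" "pstar t0" by (rule torus_iso_pstar[OF good0])
  interpret P: torus_iso v d "\<lambda>n n'. - omega t n n'" "lam_form t" "pstar t" by (rule torus_iso_pstar[OF good])
  define N where "N = inv_into UNIV (pstar t) \<circ> (V \<circ> pstar t0)"
  interpret VX: torus_iso v d "\<lambda>n n'. - omega t0 n n'" "\<lambda>n n'. - omega t n n'" N
    unfolding N_def
    by (rule torus_iso_comp[OF torus_iso_comp[OF P0.torus_iso_axioms VA.torus_iso_axioms]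
          torus_iso_inverse[OF P.torus_iso_axioms]])
  have pN: "pstar t (N n) = V (pstar t0 n)" for n
    using P.V_bij by (simp add: N_def bij_is_surj surj_f_inv_f)
  have Vp: "V (pstar t0 (basis (Inl k))) = pstar t (basis (Inl (\<sigma> k)))" for k
    using V(1) by (simp add: variation_M_def)
  have N_e: "N (basis (Inl k)) = basis (Inl (\<sigma> k))" for k
    using pN[of "basis (Inl k)"] P.V_bij by (simp add: Vp bij_is_inj inj_eq)
  have isoA: "A.seed_iso \<sigma> t0 t V"
    unfolding A.seed_iso_def using VA.torus_iso_axioms Vp sim by (simp add: t_def)
  have isoX: "X.seed_iso \<sigma> t0 t N"
    unfolding X.seed_iso_def using VX.torus_iso_axioms N_e sim by (simp add: t_def)
  define twA where "twA = A.ms t0 ks \<circ> A.VF t0 t V"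
  define twX where "twX = X.ms t0 ks \<circ> X.VF t0 t N"
  have autA: "algebra_automorphism (LPA v t0) (upper_A v t0) twA"
    using A.twist_automorphism[OF good0 \<sigma> isoA[unfolded t_def]] by (simp add: LPA_def upper_A_eq twA_def t_def)
  have autX: "algebra_automorphism (LPX v t0) (upper_X v t0) twX"
    using X.twist_automorphism[OF good0 \<sigma> isoX[unfolded t_def]] by (simp add: LPX_def upper_X_eq twX_def t_def)
  have N_var: "variation_N \<sigma> t0 t N"
    unfolding variation_N_def using VX.V_additive N_e VX.V_isometry by (metis neg_equal_iff_equal)
  have "is_variation_A v \<sigma> t0 t (monomial_map V)"
    unfolding is_variation_A_def LPA_def using V(1) VA.torus_hom by blast
  moreover have "twA (to_frac (LPA v t0) x) = mutation_seq_A v t0 ks (to_frac (LPA v t) (monomial_map V x))" for x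
    by (simp add: twA_def LPA_def mutation_seq_A_eq VA.VF_to_frac)
  ultimately have A: "twist_A v \<sigma> t0 ks twA"
    unfolding twist_A_def t_def[symmetric] using autA bij_monomial_map[OF V(2)] by blast
  have "is_variation_X v \<sigma> t0 t (monomial_map N)"
    unfolding is_variation_X_def LPX_def using N_var VX.torus_hom by blast
  moreover have twX_eq: "twX (to_frac (LPX v t0) x) = mutation_seq_X v t0 ks (to_frac (LPX v t) (monomial_map N x))" for x
    by (simp add: twX_def LPX_def mutation_seq_X_eq VX.VF_to_frac)
  ultimately have X: "twist_X v \<sigma> t0 ks twX"
    unfolding twist_X_def t_def[symmetric] using autX bij_monomial_map[OF VX.V_bij] by blast
  have "pstar_frac v t0 (twX y) = twA (pstar_frac v t0 y)" if y: "y \<in> upper_X v t0" for y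
  proof -
    have range: "z \<in> upper_X v t0 \<Longrightarrow> z \<in> range (to_frac (LPX v t0))" for z
      using X.upper_subset_range[of t0] by (auto simp: upper_X_eq LPX_def)
    obtain x where x: "y = to_frac (LPX v t0) x" using range[OF y] by blast
    \<comment> \<open>\<open>pstar_frac\<close> inverts the embedding of the X torus, so it can be
      evaluated at \<open>twX y\<close> only once that element is known to lie in the embedded
      torus. Preservation of the upper cluster algebra provides this.\<close>
    have "twX y \<in> upper_X v t0"
      using autX y by (auto simp: algebra_automorphism_def ring_iso_def bij_betw_def)
    then obtain x' where x': "twX y = to_frac (LPX v t0) x'" using range by blast
    have "pstar_frac v t0 (twX y) = PF t0 (X.ms t0 ks (to_frac (X.T t) (monomial_map N x)))"
    proof -
      have "to_frac (LPX v t0) x' = X.ms t0 ks (to_frac (X.T t) (monomial_map N x))"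
        using twX_eq[of x] x x' by (simp add: mutation_seq_X_eq LPX_def)
      then show ?thesis unfolding x' pstar_frac_eq[OF good0] by simp
    qed
    also have "\<dots> = A.ms t0 ks (PF t (to_frac (X.T t) (monomial_map N x)))"
      using pstar_mutation_seq[OF good0, of _ ks] X.to_frac_in_K[OF good] by (simp add: t_def)
    also have "PF t (to_frac (X.T t) (monomial_map N x)) = A.VF t0 t V (PF t0 (to_frac (X.T t0) x))"
    proof -
      have "pstar t \<circ> N = V \<circ> pstar t0" using pN by (simp add: fun_eq_iff)
      then show ?thesis by (simp add: P.VF_to_frac P0.VF_to_frac VA.VF_to_frac monomial_map_comp)
    qed
    also have "A.ms t0 ks \<dots> = twA (pstar_frac v t0 y)"
      unfolding x pstar_frac_eq[OF good0] by (simp add: twA_def LPX_def)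
    finally show ?thesis .
  qed
  with A X that show ?thesis by blast
qed

end

lemma quantum_base_classical: "quantum_base classical_v d"
  by unfold_locales (simp_all add: classical_v_def)

text \<open>For q > 0 with q d integral, positivity of d makes n = q d positive, so v^q and v^-q are
  distinct monomials with exponents n and - n.\<close>

lemma quantum_base_quantum:
  assumes "d > 0" shows "quantum_base (quantum_v d) d"
proof unfold_locales
  show "quantum_v d 0 = 1" by (simp add: quantum_v_def)
next
  fix q r :: rat assume "q * of_int d \<in> \<int>" "r * of_int d \<in> \<int>"
  then show "quantum_v d (q + r) = quantum_v d q * quantum_v d r"
    by (auto simp: quantum_v_def distrib_right mult_single elim!: Ints_cases)
next
  have "quantum_v d q \<noteq> quantum_v d (- q)" if q: "q > 0" "q * of_int d \<in> \<int>" for q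
  proof
    assume eq: "quantum_v d q = quantum_v d (- q)"
    obtain n where n: "q * of_int d = of_int n" using q(2) by (rule Ints_cases)
    have "n > 0" using q(1) assms n by (metis mult_pos_pos of_int_0_less_iff)
    have "Poly_Mapping.keys (quantum_v d q) = Poly_Mapping.keys (quantum_v d (- q))" using eq by simp
    then have "n = - n" by (simp add: quantum_v_def n flip: of_int_minus)
    with \<open>n > 0\<close> show False by simp
  qed
  then show "(\<forall>q. q * of_int d \<in> \<int> \<longrightarrow> quantum_v d q = 1) \<or>
      (\<forall>q > 0. q * of_int d \<in> \<int> \<longrightarrow> quantum_v d q \<noteq> quantum_v d (- q))" by blast
qed

theorem theorem5p4:
  fixes t0 :: "('u::finite, 'u) seed" and ks :: "'u list" and \<sigma> :: "'u \<Rightarrow> 'u"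
  assumes "is_seed t0"
    and "principal_coefficients t0"
    and "canonical_poisson t0"
    and "bij \<sigma>"
    and "similar \<sigma> t0 (mutate_seq t0 ks)"
  shows
      "((\<exists>twA. twist_A classical_v \<sigma> t0 ks twA) \<and>
        (\<exists>twX. twist_X classical_v \<sigma> t0 ks twX) \<and>
        (\<exists>twA twX. twist_A classical_v \<sigma> t0 ks twA \<and> twist_X classical_v \<sigma> t0 ks twX \<and>
           (\<forall>y\<in>upper_X classical_v t0.
              pstar_frac classical_v t0 (twX y) = twA (pstar_frac classical_v t0 y)))) \<and>
       (\<forall>d' :: int. d' > 0 \<longrightarrow> (\<forall>i. dd t0 i dvd d') \<longrightarrow>
        (\<exists>twA. twist_A (quantum_v d') \<sigma> t0 ks twA) \<and>
        (\<exists>twX. twist_X (quantum_v d') \<sigma> t0 ks twX) \<and>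
        (\<exists>twA twX. twist_A (quantum_v d') \<sigma> t0 ks twA \<and> twist_X (quantum_v d') \<sigma> t0 ks twX \<and>
           (\<forall>y\<in>upper_X (quantum_v d') t0.
              pstar_frac (quantum_v d') t0 (twX y) = twA (pstar_frac (quantum_v d') t0 y))))"
proof -
  have p: "principal_seed t0" using assms by (simp add: principal_seed_def)
  \<comment> \<open>In the classical case v is constantly 1, so any common multiple of the d_i can
    serve as d.\<close>
  have dvd: "dd t0 i dvd (\<Prod>i\<in>UNIV. dd t0 i)" for i by (rule dvd_prodI) simp_all
  obtain twA twX where "twist_A classical_v \<sigma> t0 ks twA" "twist_X classical_v \<sigma> t0 ks twX"
    "\<forall>y\<in>upper_X classical_v t0. pstar_frac classical_v t0 (twX y) = twA (pstar_frac classical_v t0 y)"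
    using quantum_base.twist_A_X_exist[OF quantum_base_classical p dvd assms(4,5)] by metis
  moreover have "\<exists>twA twX. twist_A (quantum_v d) \<sigma> t0 ks twA \<and> twist_X (quantum_v d) \<sigma> t0 ks twX \<and>
      (\<forall>y\<in>upper_X (quantum_v d) t0. pstar_frac (quantum_v d) t0 (twX y) = twA (pstar_frac (quantum_v d) t0 y))"
    if d: "d > 0" "\<forall>i. dd t0 i dvd d" for d
    using quantum_base.twist_A_X_exist[OF quantum_base_quantum[OF d(1)] p _ assms(4,5)] d(2) by metis
  ultimately show ?thesis by blast
qed

end
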